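(* Let $A\in\mathbb{C}^{m\times m}$ be in (upper) Jordan normal form, $B_i\in\mathbb{C}^{m\times q_i}$, $C_i\in\mathbb{C}^{r_i\times m}$ for $1\le i\le v$, let $\lambda$ be an eigenvalue of $A$, and let $m_\lambda$ be the number of Jordan blocks of $A$ with eigenvalue $\lambda$. With $A_{\lambda,2,2}(\lambda)$, $B_{i,\lambda,1},B_{i,\lambda,2}$, $C_{i,\lambda,1},C_{i,\lambda,2}$, $G_{jd,\lambda}(\lambda,K)$ and $\mathcal{N}_{jd,\lambda}(\lambda)$ as defined in the context, the following statements are equivalent. (1) $\lambda$ is a fixed mode of the decentralized linear system $\mathcal{L}(A,B_i,C_i)$. (2) $\operatorname{rank}\,G_{jd,\lambda}(\lambda,K)<m_\lambda$. (3) The rank of the transfer matrix of the LTI network $\mathcal{N}_{jd,\lambda}(\lambda)$ is less than $m_\lambda$. (4) The mincut rank of the LTI network $\mathcal{N}_{jd,\lambda}(\lambda)$ is less than $m_\lambda$. (5) $\displaystyle\min_{V\subseteq\{1,\dots,v\}}\operatorname{rank}\begin{bmatrix}0&-B_{V,\lambda,1}\\ C_{V^c,\lambda,1}&C_{V^c,\lambda,2}A_{\lambda,2,2}(\lambda)^{-1}B_{V,\lambda,2}\end{bmatrix}<m_\lambda$.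
   Context: The decentralized linear system $\mathcal{L}(A,B_i,C_i)$ is $x[n+1]=Ax[n]+\sum_{i=1}^vB_iu_i[n]$, $y_i[n]=C_ix[n]$. $\lambda$ is a fixed mode of it if $\lambda\in\bigcap_{K_i\in\mathbb{C}^{q_i\times r_i}}\sigma(A+\sum_iB_iK_iC_i)$, $\sigma$ denoting the set of eigenvalues. Let $L\subseteq\{1,\dots,m\}$ be the set of indices that are the last (bottom-right) index of a Jordan block of $A$ with eigenvalue $\lambda$, and $R$ the set of indices that are the first (top-left) index of such a block; $|L|=|R|=m_\lambda$. Reorder the rows of $zI-A$ and of each $B_i$ so that rows in $L$ come first (in increasing order), followed by the others (in increasing order); reorder the columns of $zI-A$ and of each $C_i$ so that columns in $R$ come first (in increasing order), followed by the others (in increasing order). After reordering, partition (first part of size $m_\lambda$): $$zI-A\to\begin{bmatrix} A_{\lambda,1,1}(z) & A_{\lambda,1,2}(z) \\ A_{\lambda,2,1}(z) & A_{\lambda,2,2}(z) \end{bmatrix},\quad B_i\to\begin{bmatrix} B_{i,\lambda,1} \\ B_{i,\lambda,2} \end{bmatrix},\quad C_i\to\begin{bmatrix} C_{i,\lambda,1} & C_{i,\lambda,2} \end{bmatrix}.$$ Then $A_{\lambda,1,1}(\lambda),A_{\lambda,1,2}(\lambda),A_{\lambda,2,1}(\lambda)$ are zero and $A_{\lambda,2,2}(\lambda)$ is invertible. Let the entries of the $q_i\times r_i$ matrices $K_i$ be distinct independent indeterminates (collectively $K$). Define, with all sums over $1\le i\le v$, $$G_{jd,\lambda}(z,K)=\Big(A_{\lambda,1,1}(z)-\sum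 B_{i,\lambda,1}K_iC_{i,\lambda,1}\Big)+\Big(A_{\lambda,1,2}(z)-\sum B_{i,\lambda,1}K_iC_{i,\lambda,2}\Big)\Big(A_{\lambda,2,2}(z)-\sum B_{i,\lambda,2}K_iC_{i,\lambda,2}\Big)^{-1}\Big(-A_{\lambda,2,1}(z)+\sum B_{i,\lambda,2}K_iC_{i,\lambda,1}\Big),$$ and $G_{jd,\lambda}(\lambda,K)$ is this at $z=\lambda$, with rank over $\mathbb{C}(K)$. $\mathcal{N}_{jd,\lambda}(\lambda)$ is the LTI network with nodes $tx$, relays $1,\dots,v$, $rx$ and channel matrices $H_{tx,rx}=0$, $H_{tx,i}=C_{i,\lambda,1}$, $H_{i,rx}=-B_{i,\lambda,1}$, $H_{i,j}=C_{j,\lambda,2}A_{\lambda,2,2}(\lambda)^{-1}B_{i,\lambda,2}$ (from $i$ to $j$), relay $i$ having gain $K_i$. The transfer matrix of such a network is $H_{tx,rx}+[H_{1,rx}K_1\ \cdots\ H_{v,rx}K_v](I-[H_{j,i}K_j]_{i,j=1}^v)^{-1}[H_{tx,1};\dots;H_{tx,v}]$ (block row $i$, block column $j$ is $H_{j,i}K_j$; $[\cdot;\cdot]$ is vertical stacking), rank over $\mathbb{C}(K)$. Its mincut rank is the minimum over $W\subseteq\{tx,1,\dots,v,rx\}$, $tx\in W$, $rx\notin W$, of the rank of $H_{W,W^c}$, which has block rows $j\in W^c$, block columns $i\in W$, and $(j,i)$ block $H_{i,j}$. For $V\subseteq\{1,\dots,v\}$, $V^c=\{1,\dots,v\}\setminus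 V$; $B_{V,\lambda,k}$ is the horizontal concatenation of the $B_{i,\lambda,k}$, $i\in V$, and $C_{V^c,\lambda,k}$ the vertical concatenation of the $C_{i,\lambda,k}$, $i\in V^c$. *)

theory Defs
  imports
    "Jordan_Normal_Form.Spectral_Radius"
    "Jordan_Normal_Form.DL_Rank"
    "Jordan_Normal_Form.DL_Submatrix"
    "HOL-Library.Nat_Bijection"
    "HOL-Library.Poly_Mapping"
    "HOL-Computational_Algebra.Fraction_Field"
begin

text \<open>All indices (matrix entries, Jordan blocks, channels and relays) start at 0: the channels
  \<open>1, \<dots>, v\<close> of the mathematical text are \<open>0, \<dots>, v - 1\<close> here.\<close>


section \<open>Matrices\<close>

abbreviation mrank :: "'a::field mat \<Rightarrow> nat" where
  "mrank M \<equiv> vec_space.rank (dim_row M) M"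

text \<open>Only meaningful for invertible \<open>M\<close>; this is the case wherever it is used below
  (over the rational functions, because the matrix is invertible at \<open>K = 0\<close>).\<close>

definition minv :: "'a::field mat \<Rightarrow> 'a mat" where
  "minv M = the (mat_inverse M)"

text \<open>Sum of \<open>nr \<times> nc\<close> matrices (matrices of varying size do not form a
  \<open>comm_monoid_add\<close>).\<close>

definition msum :: "nat \<Rightarrow> nat \<Rightarrow> (nat \<Rightarrow> 'a::comm_monoid_add mat) \<Rightarrow> nat set \<Rightarrow> 'a mat" where
  "msum nr nc F I = mat nr nc (\<lambda>(a, b). \<Sum>i\<in>I. F i $$ (a, b))"

definition append_cols :: "'a::zero mat \<Rightarrow> 'a mat \<Rightarrow> 'a mat" where
  "append_cols M N = four_block_mat M N (0\<^sub>m 0 (dim_col M)) (0\<^sub>m 0 (dim_col N))"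

text \<open>The first argument is the common number of rows (columns), which is needed for the empty
  list.\<close>

definition hcat :: "nat \<Rightarrow> 'a::zero mat list \<Rightarrow> 'a mat" where
  "hcat nr Ms = foldr append_cols Ms (0\<^sub>m nr 0)"

definition vcat :: "nat \<Rightarrow> 'a::zero mat list \<Rightarrow> 'a mat" where
  "vcat nc Ms = foldr append_rows Ms (0\<^sub>m 0 nc)"

text \<open>Block rows \<open>j \<in> js\<close> of height \<open>rd j\<close>, block columns \<open>i \<in> is\<close> of width \<open>cd i\<close>,
  and \<open>(j, i)\<close> block \<open>F j i\<close>.\<close>

definition block_mat ::
  "('b \<Rightarrow> nat) \<Rightarrow> ('c \<Rightarrow> nat) \<Rightarrow> 'b list \<Rightarrow> 'c list \<Rightarrow> ('b \<Rightarrow> 'c \<Rightarrow> 'a::zero mat) \<Rightarrow> 'a mat" where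
  "block_mat rd cd js is F =
     vcat (\<Sum>i\<leftarrow>is. cd i) (map (\<lambda>j. hcat (rd j) (map (F j) is)) js)"


section \<open>The field of rational functions in the gain entries\<close>

text \<open>Rational functions over the complex numbers in countably many indeterminates; monomials are
  finitely supported exponent functions. Only the finitely many indeterminates
  \<open>gain_var i a b\<close> that are entries of the matrices \<open>K\<^sub>i\<close> ever occur, and adjoining further
  indeterminates to the field does not change the rank of a matrix.\<close>

type_synonym ratfun = "((nat \<Rightarrow>\<^sub>0 nat) \<Rightarrow>\<^sub>0 complex) fract"

definition const_rf :: "complex \<Rightarrow> ratfun" where
  "const_rf c = Fraction_Field.Fract (Poly_Mapping.single 0 c) 1"

definition gain_var :: "nat \<Rightarrow> nat \<Rightarrow> nat \<Rightarrow> ratfun" where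
  "gain_var i a b = Fraction_Field.Fract
     (Poly_Mapping.single (Poly_Mapping.single (prod_encode (i, prod_encode (a, b))) 1) 1) 1"

text \<open>The \<open>q \<times> r\<close> matrix \<open>K\<^sub>i\<close> of distinct indeterminates.\<close>

definition gain_mat :: "nat \<Rightarrow> nat \<Rightarrow> nat \<Rightarrow> ratfun mat" where
  "gain_mat i q r = mat q r (\<lambda>(a, b). gain_var i a b)"

abbreviation lift_rf :: "complex mat \<Rightarrow> ratfun mat" where
  "lift_rf \<equiv> map_mat const_rf"


section \<open>Fixed modes of decentralized linear systems\<close>

text \<open>\<open>K i\<close> ranges over the \<open>q\<^sub>i \<times> r\<^sub>i\<close> matrices, where \<open>q\<^sub>i\<close> and \<open>r\<^sub>i\<close> are the numbers of columns
  of \<open>B i\<close> and of rows of \<open>C i\<close>.\<close>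

definition fixed_mode ::
  "nat \<Rightarrow> complex mat \<Rightarrow> (nat \<Rightarrow> complex mat) \<Rightarrow> (nat \<Rightarrow> complex mat) \<Rightarrow> complex \<Rightarrow> bool" where
  "fixed_mode v A B C \<mu> \<longleftrightarrow>
     \<mu> \<in> (\<Inter>K \<in> {K. \<forall>i<v. K i \<in> carrier_mat (dim_col (B i)) (dim_row (C i))}.
            spectrum (A + msum (dim_row A) (dim_col A) (\<lambda>i. B i * K i * C i) {..<v}))"


section \<open>LTI networks\<close>

datatype node = Tx | Relay nat | Rx

text \<open>\<open>tdim x\<close> and \<open>rdim x\<close> are the dimensions of the signals transmitted and received by node
  \<open>x\<close>; the channel matrix \<open>chan x y\<close> from \<open>x\<close> to \<open>y\<close> has size \<open>rdim y \<times> tdim x\<close>.\<close>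

record lti_network =
  nrelays :: nat
  tdim :: "node \<Rightarrow> nat"
  rdim :: "node \<Rightarrow> nat"
  chan :: "node \<Rightarrow> node \<Rightarrow> complex mat"

definition relays :: "lti_network \<Rightarrow> nat list" where
  "relays N = [0..<nrelays N]"

definition nodes :: "lti_network \<Rightarrow> node list" where
  "nodes N = Tx # map Relay (relays N) @ [Rx]"

definition relay_gain :: "lti_network \<Rightarrow> nat \<Rightarrow> ratfun mat" where
  "relay_gain N i = gain_mat i (tdim N (Relay i)) (rdim N (Relay i))"

definition transfer_matrix :: "lti_network \<Rightarrow> ratfun mat" where
  "transfer_matrix N =
     (let rd = (\<lambda>i. rdim N (Relay i));
          d = (\<Sum>i\<leftarrow>relays N. rd i);
          out = hcat (rdim N Rx)
                  (map (\<lambda>i. lift_rf (chan N (Relay i) Rx) * relay_gain N i) (relays N));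
          loop = block_mat rd rd (relays N) (relays N)
                  (\<lambda>i j. lift_rf (chan N (Relay j) (Relay i)) * relay_gain N j);
          inp = vcat (tdim N Tx) (map (\<lambda>i. lift_rf (chan N Tx (Relay i))) (relays N))
      in lift_rf (chan N Tx Rx) + out * minv (1\<^sub>m d - loop) * inp)"

definition cut_matrix :: "lti_network \<Rightarrow> node set \<Rightarrow> complex mat" where
  "cut_matrix N W =
     block_mat (rdim N) (tdim N) (filter (\<lambda>x. x \<notin> W) (nodes N)) (filter (\<lambda>x. x \<in> W) (nodes N))
       (\<lambda>j i. chan N i j)"

definition mincut_rank :: "lti_network \<Rightarrow> nat" where
  "mincut_rank N =
     Min ((\<lambda>W. mrank (cut_matrix N W)) ` {W. W \<subseteq> set (nodes N) \<and> Tx \<in> W \<and> Rx \<notin> W})"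


section \<open>Partition of a system in Jordan form with respect to an eigenvalue\<close>

text \<open>Below, \<open>ns\<close> lists the sizes and eigenvalues of the Jordan blocks of
  \<open>A = jordan_matrix ns\<close> from top left to bottom right, all sizes being positive.\<close>

definition num_jblocks :: "(nat \<times> complex) list \<Rightarrow> complex \<Rightarrow> nat" where
  "num_jblocks ns \<mu> = card {k. k < length ns \<and> snd (ns ! k) = \<mu>}"

definition first_idx :: "(nat \<times> complex) list \<Rightarrow> complex \<Rightarrow> nat set" where
  "first_idx ns \<mu> =
     {sum_list (map fst (take k ns)) | k. k < length ns \<and> snd (ns ! k) = \<mu>}"

definition last_idx :: "(nat \<times> complex) list \<Rightarrow> complex \<Rightarrow> nat set" where
  "last_idx ns \<mu> =
     {sum_list (map fst (take (Suc k) ns)) - 1 | k. k < length ns \<and> snd (ns ! k) = \<mu>}"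

text \<open>\<open>submatrix M I J\<close> selects the rows in \<open>I\<close> and the columns in \<open>J\<close>, both in increasing order,
  ignoring elements of \<open>I\<close> and \<open>J\<close> out of range. Hence these are the blocks obtained by moving
  the rows in \<open>last_idx\<close> and the columns in \<open>first_idx\<close> to the front.\<close>

definition pencil :: "(nat \<times> complex) list \<Rightarrow> complex \<Rightarrow> complex mat" where
  "pencil ns z = z \<cdot>\<^sub>m 1\<^sub>m (dim_row (jordan_matrix ns)) - jordan_matrix ns"

definition jd_A11 :: "(nat \<times> complex) list \<Rightarrow> complex \<Rightarrow> complex \<Rightarrow> complex mat" where
  "jd_A11 ns \<mu> z = submatrix (pencil ns z) (last_idx ns \<mu>) (first_idx ns \<mu>)"

definition jd_A12 :: "(nat \<times> complex) list \<Rightarrow> complex \<Rightarrow> complex \<Rightarrow> complex mat" where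
  "jd_A12 ns \<mu> z = submatrix (pencil ns z) (last_idx ns \<mu>) (- first_idx ns \<mu>)"

definition jd_A21 :: "(nat \<times> complex) list \<Rightarrow> complex \<Rightarrow> complex \<Rightarrow> complex mat" where
  "jd_A21 ns \<mu> z = submatrix (pencil ns z) (- last_idx ns \<mu>) (first_idx ns \<mu>)"

definition jd_A22 :: "(nat \<times> complex) list \<Rightarrow> complex \<Rightarrow> complex \<Rightarrow> complex mat" where
  "jd_A22 ns \<mu> z = submatrix (pencil ns z) (- last_idx ns \<mu>) (- first_idx ns \<mu>)"

definition jd_B1 :: "(nat \<times> complex) list \<Rightarrow> complex \<Rightarrow> complex mat \<Rightarrow> complex mat" where
  "jd_B1 ns \<mu> M = submatrix M (last_idx ns \<mu>) UNIV"

definition jd_B2 :: "(nat \<times> complex) list \<Rightarrow> complex \<Rightarrow> complex mat \<Rightarrow> complex mat" where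
  "jd_B2 ns \<mu> M = submatrix M (- last_idx ns \<mu>) UNIV"

definition jd_C1 :: "(nat \<times> complex) list \<Rightarrow> complex \<Rightarrow> complex mat \<Rightarrow> complex mat" where
  "jd_C1 ns \<mu> M = submatrix M UNIV (first_idx ns \<mu>)"

definition jd_C2 :: "(nat \<times> complex) list \<Rightarrow> complex \<Rightarrow> complex mat \<Rightarrow> complex mat" where
  "jd_C2 ns \<mu> M = submatrix M UNIV (- first_idx ns \<mu>)"

definition G_jd ::
  "nat \<Rightarrow> (nat \<times> complex) list \<Rightarrow> (nat \<Rightarrow> complex mat) \<Rightarrow> (nat \<Rightarrow> complex mat) \<Rightarrow>
   complex \<Rightarrow> complex \<Rightarrow> ratfun mat" where
  "G_jd v ns B C \<mu> z =
     (let n1 = num_jblocks ns \<mu>;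
          n2 = dim_row (jordan_matrix ns) - n1;
          K = (\<lambda>i. gain_mat i (dim_col (B i)) (dim_row (C i)));
          B1 = (\<lambda>i. lift_rf (jd_B1 ns \<mu> (B i)));
          B2 = (\<lambda>i. lift_rf (jd_B2 ns \<mu> (B i)));
          C1 = (\<lambda>i. lift_rf (jd_C1 ns \<mu> (C i)));
          C2 = (\<lambda>i. lift_rf (jd_C2 ns \<mu> (C i)))
      in (lift_rf (jd_A11 ns \<mu> z) - msum n1 n1 (\<lambda>i. B1 i * K i * C1 i) {..<v})
         + (lift_rf (jd_A12 ns \<mu> z) - msum n1 n2 (\<lambda>i. B1 i * K i * C2 i) {..<v})
           * minv (lift_rf (jd_A22 ns \<mu> z) - msum n2 n2 (\<lambda>i. B2 i * K i * C2 i) {..<v})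
           * (- lift_rf (jd_A21 ns \<mu> z) + msum n2 n1 (\<lambda>i. B2 i * K i * C1 i) {..<v}))"

text \<open>The network \<open>\<N>\<^sub>j\<^sub>d\<close> at \<open>z = \<mu>\<close>. Nothing is received by \<open>Tx\<close> or transmitted by \<open>Rx\<close>,
  so the corresponding dimensions are 0.\<close>

definition jd_network ::
  "nat \<Rightarrow> (nat \<times> complex) list \<Rightarrow> (nat \<Rightarrow> complex mat) \<Rightarrow> (nat \<Rightarrow> complex mat) \<Rightarrow>
   complex \<Rightarrow> lti_network" where
  "jd_network v ns B C \<mu> =
     (let n1 = num_jblocks ns \<mu>;
          td = (\<lambda>x. case x of Tx \<Rightarrow> n1 | Relay i \<Rightarrow> dim_col (B i) | Rx \<Rightarrow> 0);
          rd = (\<lambda>x. case x of Tx \<Rightarrow> 0 | Relay i \<Rightarrow> dim_row (C i) | Rx \<Rightarrow> n1)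
      in \<lparr> nrelays = v, tdim = td, rdim = rd,
           chan = (\<lambda>x y. case (x, y) of
               (Tx, Rx) \<Rightarrow> 0\<^sub>m n1 n1
             | (Tx, Relay i) \<Rightarrow> jd_C1 ns \<mu> (C i)
             | (Relay i, Rx) \<Rightarrow> - jd_B1 ns \<mu> (B i)
             | (Relay i, Relay j) \<Rightarrow>
                 jd_C2 ns \<mu> (C j) * minv (jd_A22 ns \<mu> \<mu>) * jd_B2 ns \<mu> (B i)
             | _ \<Rightarrow> 0\<^sub>m (rd y) (td x)) \<rparr>)"

text \<open>Concatenations \<open>B\<^sub>V\<^sub>,\<^sub>\<lambda>\<^sub>,\<^sub>k\<close> and \<open>C\<^sub>V\<^sub>,\<^sub>\<lambda>\<^sub>,\<^sub>k\<close>, in increasing order of the index.\<close>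

definition hcat_on :: "nat \<Rightarrow> (nat \<Rightarrow> 'a::zero mat) \<Rightarrow> nat set \<Rightarrow> 'a mat" where
  "hcat_on nr F V = hcat nr (map F (sorted_list_of_set V))"

definition vcat_on :: "nat \<Rightarrow> (nat \<Rightarrow> 'a::zero mat) \<Rightarrow> nat set \<Rightarrow> 'a mat" where
  "vcat_on nc F V = vcat nc (map F (sorted_list_of_set V))"

definition partition_matrix ::
  "nat \<Rightarrow> (nat \<times> complex) list \<Rightarrow> (nat \<Rightarrow> complex mat) \<Rightarrow> (nat \<Rightarrow> complex mat) \<Rightarrow>
   complex \<Rightarrow> nat set \<Rightarrow> complex mat" where
  "partition_matrix v ns B C \<mu> V =
     (let n1 = num_jblocks ns \<mu>;
          n2 = dim_row (jordan_matrix ns) - n1;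
          Vc = {..<v} - V
      in four_block_mat
           (0\<^sub>m n1 n1)
           (- hcat_on n1 (\<lambda>i. jd_B1 ns \<mu> (B i)) V)
           (vcat_on n1 (\<lambda>i. jd_C1 ns \<mu> (C i)) Vc)
           (vcat_on n2 (\<lambda>i. jd_C2 ns \<mu> (C i)) Vc * minv (jd_A22 ns \<mu> \<mu>)
              * hcat_on n2 (\<lambda>i. jd_B2 ns \<mu> (B i)) V))"

end

theory Submission
  imports Defs
begin

text \<open>Reorder the system so that \<open>\<mu> I - A\<close> becomes the block diagonal matrix with blocks \<open>A\<^sub>2\<^sub>2\<close> (invertible)
  and \<open>0\<close>. The number \<open>\<mu>\<close> is not a fixed mode iff \<open>\<mu> I - A - \<Sum> B\<^sub>i K\<^sub>i C\<^sub>i\<close> is invertible for some complex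
  gains, equivalently over the rational functions; by Schur complements this says that \<open>G\<close>, which
  is the transfer matrix up to a push-through identity, has full rank.

  If the matrix with blocks \<open>\<mu> I - A, -B\<^sub>V, C\<^sub>W, 0\<close> (\<open>W\<close> the complement of \<open>V\<close>) has rank less than \<open>m\<close>
  for some \<open>V\<close>, then so has \<open>\<mu> I - A - \<Sum> B\<^sub>i K\<^sub>i C\<^sub>i\<close> for all gains, since it is a product with that matrix
  as a factor. Conversely, suppose that all these ranks are at least \<open>m\<close>. For one channel, the largest
  rank of \<open>X + b K c\<close> over all \<open>K\<close> is the minimum of the ranks of \<open>X\<close> bordered by \<open>b\<close> and by \<open>c\<close>.
  Applied to every cut of the remaining channels at once (each condition on \<open>K\<close> is generic), this
  removes one channel after the other. A final Schur complement turns these block matrices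
  into the partition matrices, which are the cut matrices of the network with permuted block rows.\<close>

text \<open>The obstacle is that the matrices met while channels are removed are rectangular, so
  rank at least n is not the non-vanishing of one determinant. It is expressed by a certificate
  \<open>P * X * Q = 1\<^sub>m n\<close>. Such an equation survives ring homomorphisms, so ranks do
  not depend on the field; with P and Q frozen, det (P X Q) turns it into a polynomial condition, so
  it is generic. Dually, rank at most k is a factorisation through dimension k. The zero corner of
  the bordered matrices closes the induction: bordering the cut V of the remaining channels by the
  columns or by the rows of channel j gives, up to order, the cut with j added to V or V itself, now
  as cuts of all channels. A gain in channel j changes only the upper left block, so one new matrix
  M serves every V. The conditions for different V are compatible because two gains can be joined by
  a line, on which each condition that holds somewhere fails only finitely often.\<close>

text \<open>The ring laws restated with side conditions that the simplifier can discharge.\<close>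

lemma mat_assoc: "dim_col A = dim_row B \<Longrightarrow> dim_col B = dim_row C \<Longrightarrow> (A * B) * C = A * (B * C)"
  for A :: "'a::semiring_0 mat"
  by (rule assoc_mult_mat[of _ "dim_row A" "dim_col A" _ "dim_col B" _ "dim_col C"]) (auto intro: carrier_matI)

lemma mat_distribs:
  fixes A :: "'a::ring mat"
  shows "dim_row A = dim_row B \<Longrightarrow> dim_col A = dim_col B \<Longrightarrow> dim_col A = dim_row C \<Longrightarrow>
      (A + B) * C = A * C + B * C"
    "dim_row A = dim_row B \<Longrightarrow> dim_col A = dim_col B \<Longrightarrow> dim_col A = dim_row C \<Longrightarrow>
      (A - B) * C = A * C - B * C"
    "dim_row A = dim_row B \<Longrightarrow> dim_col A = dim_col B \<Longrightarrow> dim_col C = dim_row A \<Longrightarrow>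
      C * (A + B) = C * A + C * B"
    "dim_row A = dim_row B \<Longrightarrow> dim_col A = dim_col B \<Longrightarrow> dim_col C = dim_row A \<Longrightarrow>
      C * (A - B) = C * A - C * B"
    "dim_col A = dim_row C \<Longrightarrow> (- A) * C = - (A * C)"
    "dim_col C = dim_row A \<Longrightarrow> C * (- A) = - (C * A)"
  by (auto intro!: eq_matI simp: scalar_prod_def algebra_simps sum.distrib sum_subtractf sum_negf)

lemma mat_cancel:
  fixes A :: "'a::semiring_1 mat"
  assumes "A * B = 1\<^sub>m n" "dim_col A = dim_row B" "dim_row M = n"
  shows "A * (B * M) = M"
proof -
  have "dim_col B = n" using assms(1) by (metis index_mult_mat(3) index_one_mat(3))
  then show ?thesis using assms by (metis carrier_matI left_mult_one_mat mat_assoc)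
qed

section \<open>Inverses, and rank from one-sided inverses\<close>

lemma minv_inverse:
  fixes A :: "'a::field mat"
  assumes A: "A \<in> carrier_mat n n" and d: "det A \<noteq> 0"
  shows "minv A \<in> carrier_mat n n" "A * minv A = 1\<^sub>m n" "minv A * A = 1\<^sub>m n"
proof -
  have "mat_inverse A \<noteq> None"
    using mat_inverse(1)[OF A, of undefined] det_non_zero_imp_unit[OF A d, of undefined] by blast
  then obtain B where B: "mat_inverse A = Some B" by auto
  show "minv A \<in> carrier_mat n n" "A * minv A = 1\<^sub>m n" "minv A * A = 1\<^sub>m n"
    using mat_inverse(2)[OF A B] B by (auto simp: minv_def)
qed

lemma minv_eqI:
  fixes A :: "'a::field mat"
  assumes A: "A \<in> carrier_mat n n" and B: "B \<in> carrier_mat n n" and AB: "A * B = 1\<^sub>m n"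
  shows "minv A = B" "det A \<noteq> 0"
proof -
  show d: "det A \<noteq> 0"
    using arg_cong[OF AB, of det] det_mult[OF A B] by auto
  have "minv A * (A * B) = minv A"
    using minv_inverse[OF A d] AB by simp
  moreover have "minv A * (A * B) = minv A * A * B"
    using minv_inverse[OF A d] A B by (intro assoc_mult_mat[symmetric]) auto
  ultimately show "minv A = B" using minv_inverse[OF A d] B by simp
qed

lemma mrank_eq_dim_colI:
  fixes X :: "'a::field mat"
  assumes X: "X \<in> carrier_mat nr n" and P: "P \<in> carrier_mat n nr" and PX: "P * X = 1\<^sub>m n"
  shows "mrank X = n" "n \<le> nr"
proof -
  interpret vec_space "TYPE('a)" nr .
  have inj: "w = 0\<^sub>v n" if w: "w \<in> carrier_vec n" "X *\<^sub>v w = 0\<^sub>v nr" for w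
  proof -
    have "w = (P * X) *\<^sub>v w" using PX w by simp
    also have "\<dots> = P *\<^sub>v (X *\<^sub>v w)" using assoc_mult_mat_vec[OF P X w(1)] .
    also have "\<dots> = 0\<^sub>v n" unfolding w(2) using P by auto
    finally show ?thesis .
  qed
  \<comment> \<open>Independence is a property of the set of columns, so equal columns have to be
    excluded separately: they would give equal columns of
    \<open>P * X = 1\<^sub>m n\<close>.\<close>
  have dist: "distinct (cols X)"
  proof (rule ccontr)
    assume "\<not> distinct (cols X)"
    then obtain i j where ij: "i < n" "j < n" "i \<noteq> j" "col X i = col X j"
      using X by (auto simp: distinct_conv_nth)
    have "col (P * X) i = col (P * X) j" using ij P X by (simp del: col_one)
    then have "unit_vec n i = (unit_vec n j :: 'a vec)" using PX ij by simp
    then show False using ij by simp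
  qed
  have li: "lin_indpt (set (cols X))"
  proof
    assume "lin_dep (set (cols X))"
    from lin_depE[OF X this dist] inj show False by metis
  qed
  then have "rank X = n" using lin_indpt_full_rank[OF X dist] by blast
  then show "mrank X = n" using X by simp
  have "card (set (cols X)) \<le> dim"
    using li cols_dim[of X] X by (intro li_le_dim(2)) auto
  then show "n \<le> nr" using distinct_card[OF dist] X dim_is_n by simp
qed

lemma col_space_mult_subset:
  fixes X :: "'a::field mat"
  assumes X: "X \<in> carrier_mat nr n" and Y: "Y \<in> carrier_mat n nc"
  shows "vec_space.col_space nr (X * Y) \<subseteq> vec_space.col_space nr X"
proof -
  interpret vec_space "TYPE('a)" nr .
  have XY: "X * Y \<in> carrier_mat nr nc" using X Y by simp
  show ?thesis
  proof
    fix y assume "y \<in> col_space (X * Y)"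
    then obtain x where x: "x \<in> carrier_vec nc" and y: "y = X * Y *\<^sub>v x"
      unfolding col_space_eq[OF XY] using Y by auto
    have "y = X *\<^sub>v (Y *\<^sub>v x)" unfolding y by (rule assoc_mult_mat_vec[OF X Y x])
    moreover have "Y *\<^sub>v x \<in> carrier_vec n" by (rule mult_mat_vec_carrier[OF Y x])
    moreover have "y \<in> carrier_vec nr" unfolding y by (rule mult_mat_vec_carrier[OF XY x])
    ultimately show "y \<in> col_space X"
      unfolding col_space_eq[OF X] carrier_matD[OF X] by blast
  qed
qed

section \<open>Block products, rank factorisations and Schur complements\<close>

lemma append_cols_carrier [simp, intro]:
  "M \<in> carrier_mat nr a \<Longrightarrow> N \<in> carrier_mat nr b \<Longrightarrow> append_cols M N \<in> carrier_mat nr (a + b)"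
  unfolding append_cols_def by (rule carrier_matI) auto

lemma append_rows_mult:
  fixes M :: "'a::semiring_0 mat"
  assumes "P \<in> carrier_mat a n" "R \<in> carrier_mat b n" "M \<in> carrier_mat n m"
  shows "(P @\<^sub>r R) * M = (P * M) @\<^sub>r (R * M)"
proof -
  \<comment> \<open>Padding with empty blocks lets the four-block product law cover one-sided
    concatenations as well.\<close>
  have M: "M = four_block_mat M (0\<^sub>m n 0) (0\<^sub>m 0 m) (0\<^sub>m 0 0)"
    using assms by (intro eq_matI) auto
  have "(P @\<^sub>r R) * M = four_block_mat P (0\<^sub>m a 0) R (0\<^sub>m b 0) * four_block_mat M (0\<^sub>m n 0) (0\<^sub>m 0 m) (0\<^sub>m 0 0)"
    using M assms unfolding append_rows_def by simp
  also have "\<dots> = (P * M) @\<^sub>r (R * M)"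
    using assms by (subst mult_four_block_mat[of _ a n _ 0 _ b _ _ m _ 0]) (auto simp: append_rows_def)
  finally show ?thesis .
qed

lemma mult_append_cols:
  fixes M :: "'a::semiring_0 mat"
  assumes "Q \<in> carrier_mat m a" "S \<in> carrier_mat m b" "M \<in> carrier_mat n m"
  shows "M * append_cols Q S = append_cols (M * Q) (M * S)"
proof -
  have M: "M = four_block_mat M (0\<^sub>m n 0) (0\<^sub>m 0 m) (0\<^sub>m 0 0)"
    using assms by (intro eq_matI) auto
  have "M * append_cols Q S = four_block_mat M (0\<^sub>m n 0) (0\<^sub>m 0 m) (0\<^sub>m 0 0) * four_block_mat Q S (0\<^sub>m 0 a) (0\<^sub>m 0 b)"
    using M assms unfolding append_cols_def by simp
  also have "\<dots> = append_cols (M * Q) (M * S)"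
    using assms by (subst mult_four_block_mat[of _ n m _ 0 _ 0 _ _ a _ b]) (auto simp: append_cols_def)
  finally show ?thesis .
qed

lemma append_rows_mult_append_cols:
  fixes P :: "'a::semiring_0 mat"
  assumes "P \<in> carrier_mat a n" "R \<in> carrier_mat b n" "Q \<in> carrier_mat n c" "S \<in> carrier_mat n d"
  shows "(P @\<^sub>r R) * append_cols Q S = four_block_mat (P * Q) (P * S) (R * Q) (R * S)"
proof -
  have "(P @\<^sub>r R) * append_cols Q S = four_block_mat P (0\<^sub>m a 0) R (0\<^sub>m b 0) * four_block_mat Q S (0\<^sub>m 0 c) (0\<^sub>m 0 d)"
    using assms unfolding append_rows_def append_cols_def by simp
  also have "\<dots> = four_block_mat (P * Q) (P * S) (R * Q) (R * S)"
    using assms by (subst mult_four_block_mat[of _ a n _ 0 _ b _ _ c _ d]) auto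
  finally show ?thesis .
qed

lemma append_cols_mult_append_rows:
  fixes P :: "'a::semiring_0 mat"
  assumes "P \<in> carrier_mat n a" "R \<in> carrier_mat n b" "Q \<in> carrier_mat a m" "S \<in> carrier_mat b m"
  shows "append_cols P R * (Q @\<^sub>r S) = P * Q + R * S"
proof -
  have "append_cols P R * (Q @\<^sub>r S) = four_block_mat P R (0\<^sub>m 0 a) (0\<^sub>m 0 b) * four_block_mat Q (0\<^sub>m a 0) S (0\<^sub>m b 0)"
    using assms unfolding append_rows_def append_cols_def by simp
  also have "\<dots> = four_block_mat (P * Q + R * S) (0\<^sub>m n 0) (0\<^sub>m 0 m) (0\<^sub>m 0 0)"
    using assms by (subst mult_four_block_mat[of _ n a _ b _ 0 _ _ m _ 0]) auto
  also have "\<dots> = P * Q + R * S" using assms by (intro eq_matI) auto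
  finally show ?thesis .
qed

text \<open>The product consists of the blocks P X Q, P X z, w X Q and w X z. This is how a
  certificate of rank r grows; it is applied with k = 1.\<close>

lemma sandwich_extend:
  fixes X :: "'a::semiring_1 mat"
  assumes "X \<in> carrier_mat nr nc" "P \<in> carrier_mat r nr" "Q \<in> carrier_mat nc r"
    "w \<in> carrier_mat k nr" "z \<in> carrier_mat nc k"
    "P * (X * Q) = 1\<^sub>m r" "P * (X * z) = 0\<^sub>m r k" "w * (X * Q) = 0\<^sub>m k r" "w * (X * z) = 1\<^sub>m k"
  shows "(P @\<^sub>r w) * X * append_cols Q z = 1\<^sub>m (r + k)"
proof -
  have "(P @\<^sub>r w) * X * append_cols Q z = (P @\<^sub>r w) * append_cols (X * Q) (X * z)"
    using assms by (simp add: assoc_mult_mat[of _ "r + k" nr _ nc _ "r + k"] mult_append_cols[of _ nc r _ k _ nr])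
  also have "\<dots> = 1\<^sub>m (r + k)"
    using assms by (subst append_rows_mult_append_cols[of _ r nr _ k _ r _ k]) auto
  finally show ?thesis .
qed

text \<open>\<open>u\<close> selects the row of a non-zero entry, and \<open>v\<close> selects its
  column and divides by the entry: a rank certificate of size 1.\<close>

lemma nonzero_entry_sandwich:
  fixes E :: "'a::field mat"
  assumes E: "E \<in> carrier_mat nr nc" and nz: "E \<noteq> 0\<^sub>m nr nc"
  obtains u v where "u \<in> carrier_mat 1 nr" "v \<in> carrier_mat nc 1" "u * (E * v) = 1\<^sub>m 1"
proof -
  obtain i j where ij: "i < nr" "j < nc" "E $$ (i, j) \<noteq> 0"
    using E nz by (metis eq_matI carrier_matD index_zero_mat)
  define u :: "'a mat" where "u = mat_of_rows nr [unit_vec nr i]"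
  define v :: "'a mat" where "v = mat_of_cols nc [inverse (E $$ (i, j)) \<cdot>\<^sub>v unit_vec nc j]"
  have u: "u \<in> carrier_mat 1 nr" and v: "v \<in> carrier_mat nc 1"
    by (auto simp: u_def v_def)
  have "E * v = mat_of_cols nr [inverse (E $$ (i, j)) \<cdot>\<^sub>v col E j]"
    using E ij by (intro eq_matI) (auto simp: v_def mat_of_cols_index)
  then have "u * (E * v) = 1\<^sub>m 1"
    using E ij by (intro eq_matI) (auto simp: u_def)
  with u v that show ?thesis by blast
qed

text \<open>For the largest \<open>r\<close> with \<open>P X Q = 1\<close> of size \<open>r\<close> the residual \<open>X - X Q P X\<close> vanishes,
  because a non-zero entry of it would yield such a factorisation of size \<open>r + 1\<close>.\<close>

lemma rank_factorization:
  fixes X :: "'a::field mat"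
  assumes X: "X \<in> carrier_mat nr nc"
  obtains P Q where "P \<in> carrier_mat (mrank X) nr" "Q \<in> carrier_mat nc (mrank X)"
    "P * X * Q = 1\<^sub>m (mrank X)" "X = X * Q * (P * X)"
proof -
  define S where "S = {r. \<exists>P \<in> carrier_mat r nr. \<exists>Q \<in> carrier_mat nc r. P * X * Q = 1\<^sub>m r}"
  have bound: "r \<le> nc" if "r \<in> S" for r
  proof -
    from that obtain P Q where P: "P \<in> carrier_mat r nr" and Q: "Q \<in> carrier_mat nc r"
      and "P * X * Q = 1\<^sub>m r" by (auto simp: S_def)
    then show ?thesis using X by (intro mrank_eq_dim_colI(2)[of Q nc r "P * X"]) auto
  qed
  have "0 \<in> S" using X by (auto simp: S_def intro!: bexI[of _ "0\<^sub>m 0 nr" "carrier_mat 0 nr"] bexI[of _ "0\<^sub>m nc 0" "carrier_mat nc 0"] eq_matI)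
  have "finite S" using bound by (meson finite_nat_set_iff_bounded_le)
  define r where "r = Max S"
  have rS: "r \<in> S" and rmax: "\<And>k. k \<in> S \<Longrightarrow> k \<le> r"
    using Max_in[OF \<open>finite S\<close>] Max_ge[OF \<open>finite S\<close>] \<open>0 \<in> S\<close> by (auto simp: r_def)
  from rS obtain P Q where P: "P \<in> carrier_mat r nr" and Q: "Q \<in> carrier_mat nc r"
    and PXQ: "P * X * Q = 1\<^sub>m r" by (auto simp: S_def)
  \<comment> \<open>The projections complementary to X Q P and Q P X, with W X = X Z = E. Replacing
    \<open>u\<close> by \<open>u * W\<close> and \<open>v\<close> by \<open>Z * v\<close> makes the
    off-diagonal blocks of the enlarged certificate vanish, because P E = 0 and E Q = 0.\<close>
  define W where "W = 1\<^sub>m nr - X * (Q * P)"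
  define Z where "Z = 1\<^sub>m nc - Q * (P * X)"
  have W: "W \<in> carrier_mat nr nr" and Z: "Z \<in> carrier_mat nc nc"
    using X P Q by (auto simp: W_def Z_def)
  define E where "E = X - X * (Q * (P * X))"
  have E: "E \<in> carrier_mat nr nc" using X P Q by (auto simp: E_def)
  note dims = carrier_matD[OF X] carrier_matD[OF P] carrier_matD[OF Q] carrier_matD[OF W] carrier_matD[OF Z]
    carrier_matD[OF E]
  have WX: "W * X = E" and XZ: "X * Z = E"
    unfolding W_def Z_def E_def using X by (simp_all add: mat_assoc mat_distribs dims)
  have PXQM: "P * (X * (Q * M)) = M" if "dim_row M = r" for M
    using mat_cancel[OF PXQ] that by (simp add: dims mat_assoc)
  have PE: "P * E = 0\<^sub>m r nc"
    unfolding E_def using P X by (simp add: mat_assoc mat_distribs dims PXQM minus_r_inv_mat)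
  have EQ: "E * Q = 0\<^sub>m nr r"
    unfolding E_def using PXQ Q X by (simp add: mat_assoc mat_distribs dims)
  have "E = 0\<^sub>m nr nc"
  proof (rule ccontr)
    assume "E \<noteq> 0\<^sub>m nr nc"
    then obtain u v where u: "u \<in> carrier_mat 1 nr" and v: "v \<in> carrier_mat nc 1"
      and uEv: "u * (E * v) = 1\<^sub>m 1"
      using nonzero_entry_sandwich[OF E] by blast
    note dims = dims carrier_matD[OF u] carrier_matD[OF v]
    have EQM: "E * (Q * M) = 0\<^sub>m nr (dim_col M)" if "dim_row M = r" for M
      using arg_cong[OF EQ, of "\<lambda>Y. Y * M"] that by (simp add: mat_assoc dims)
    have EZ: "E * (Z * v) = E * v"
      unfolding Z_def using E v by (simp add: mat_assoc mat_distribs dims EQM) (auto intro: eq_matI)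
    have "(P @\<^sub>r (u * W)) * X * append_cols Q (Z * v) = 1\<^sub>m (r + 1)"
    proof (rule sandwich_extend)
      have "P * (X * (Z * v)) = (P * (X * Z)) * v"
        by (simp add: mat_assoc dims)
      then show "P * (X * (Z * v)) = 0\<^sub>m r 1"
        using v by (simp add: XZ PE dims)
      have "u * W * (X * Q) = u * ((W * X) * Q)"
        by (simp add: mat_assoc dims)
      then show "u * W * (X * Q) = 0\<^sub>m 1 r"
        using u by (simp add: WX EQ dims)
      have "u * W * (X * (Z * v)) = u * ((W * X) * (Z * v))"
        by (simp add: mat_assoc dims)
      then show "u * W * (X * (Z * v)) = 1\<^sub>m 1"
        by (simp add: WX EZ uEv)
    qed (use X P Q W Z u v PXQ in auto)
    then have "r + 1 \<in> S"
      unfolding S_def using carrier_append_rows[of P r nr "u * W" 1] append_cols_carrier[of Q nc r "Z * v" 1] P Q W Z u v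
      by (intro CollectI bexI) auto
    with rmax show False by force
  qed
  then have "X - X * (Q * (P * X)) = 0\<^sub>m nr nc" by (simp add: E_def)
  then have "X = X * (Q * (P * X))"
    using X P Q by (auto simp: mat_eq_iff)
  moreover have "X * Q * (P * X) = X * (Q * (P * X))" by (simp add: mat_assoc dims)
  ultimately have fact: "X = X * Q * (P * X)" by (rule trans[OF _ sym])
  \<comment> \<open>The rank is the dimension of the column space. The left inverse \<open>P\<close>
    gives \<open>X * Q\<close> rank \<open>r\<close>, and the factorisation shows that
    \<open>X\<close> and \<open>X * Q\<close> have the same column space.\<close>
  have "mrank (X * Q) = r"
    using X P Q PXQ by (intro mrank_eq_dim_colI(1)[of _ nr _ P]) auto
  moreover have "vec_space.col_space nr X = vec_space.col_space nr (X * Q)"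
  proof (rule antisym)
    have "vec_space.col_space nr (X * Q * (P * X)) \<subseteq> vec_space.col_space nr (X * Q)"
      by (rule col_space_mult_subset) (use X P Q in auto)
    then show "vec_space.col_space nr X \<subseteq> vec_space.col_space nr (X * Q)"
      unfolding fact[symmetric] .
  qed (rule col_space_mult_subset[OF X Q])
  ultimately have "mrank X = r"
    unfolding vec_space.rank_def vec_space.col_space_def carrier_matD(1)[OF X] 
      index_mult_mat(2) by simp
  with that[of P Q] P Q PXQ fact show ?thesis by blast
qed

text \<open>Inserting the factorisation of \<open>X\<close> makes the identity of size n a product
  through dimension \<open>mrank X\<close>. Hence \<open>P' * X * Q\<close> has a left inverse, and
  therefore at least n rows.\<close>

lemma mrank_geI:
  fixes X :: "'a::field mat"
  assumes X: "X \<in> carrier_mat nr nc" and P: "P \<in> carrier_mat n nr" and Q: "Q \<in> carrier_mat nc n"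
    and PXQ: "P * X * Q = 1\<^sub>m n"
  shows "n \<le> mrank X"
proof -
  obtain P' Q' where P': "P' \<in> carrier_mat (mrank X) nr" and Q': "Q' \<in> carrier_mat nc (mrank X)"
    and fact: "X = X * Q' * (P' * X)"
    using rank_factorization[OF X] by blast
  have "(P * X * Q') * (P' * X * Q) = P * (X * Q' * (P' * X)) * Q"
    using P X Q P' Q' by (simp add: mat_assoc)
  then have "(P * X * Q') * (P' * X * Q) = 1\<^sub>m n"
    using fact PXQ by simp
  then show ?thesis
    using P X Q P' Q' by (intro mrank_eq_dim_colI(2)[of "P' * X * Q" _ _ "P * X * Q'"]) auto
qed

text \<open>A certificate of the full size \<open>mrank X\<close> is cut down to size n by the
  truncated identities \<open>S\<close> and \<open>T\<close>.\<close>

lemma mrank_geE: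
  fixes X :: "'a::field mat"
  assumes X: "X \<in> carrier_mat nr nc" and "n \<le> mrank X"
  obtains P Q where "P \<in> carrier_mat n nr" "Q \<in> carrier_mat nc n" "P * X * Q = 1\<^sub>m n"
proof -
  obtain P Q where P: "P \<in> carrier_mat (mrank X) nr" and Q: "Q \<in> carrier_mat nc (mrank X)"
    and PXQ: "P * X * Q = 1\<^sub>m (mrank X)"
    using rank_factorization[OF X] by blast
  define S where "S = mat n (mrank X) (\<lambda>(i, j). if i = j then 1 else (0 :: 'a))"
  define T where "T = mat (mrank X) n (\<lambda>(i, j). if i = j then 1 else (0 :: 'a))"
  have "S * T = 1\<^sub>m n"
    using \<open>n \<le> mrank X\<close> by (intro eq_matI) (auto simp: S_def T_def scalar_prod_def if_distrib cong: if_cong)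
  moreover have S: "S \<in> carrier_mat n (mrank X)" and T: "T \<in> carrier_mat (mrank X) n"
    by (auto simp: S_def T_def)
  moreover have "(S * P) * X * (Q * T) = S * ((P * X * Q) * T)"
    using X P Q S T by (simp add: mat_assoc)
  ultimately show ?thesis
    using P Q PXQ that[of "S * P" "Q * T"] by simp
qed

text \<open>A rank certificate of \<open>Y * Z\<close> has to pass through dimension k. Together
  with \<open>mrank_leE\<close>, rank at most k becomes the same as a factorisation through
  dimension k.\<close>

lemma mrank_leI:
  fixes Y :: "'a::field mat"
  assumes Y: "Y \<in> carrier_mat nr k" and Z: "Z \<in> carrier_mat k nc"
  shows "mrank (Y * Z) \<le> k"
proof -
  obtain P Q where P: "P \<in> carrier_mat (mrank (Y * Z)) nr" and Q: "Q \<in> carrier_mat nc (mrank (Y * Z))"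
    and PXQ: "P * (Y * Z) * Q = 1\<^sub>m (mrank (Y * Z))"
    using rank_factorization[OF mult_carrier_mat[OF Y Z]] by blast
  have "(P * Y) * (Z * Q) = 1\<^sub>m (mrank (Y * Z))"
    using PXQ P Y Z Q by (simp add: mat_assoc)
  then show ?thesis
    using P Y Z Q by (intro mrank_eq_dim_colI(2)[of "Z * Q" _ _ "P * Y"]) auto
qed

lemma mrank_leE:
  fixes X :: "'a::field mat"
  assumes X: "X \<in> carrier_mat nr nc"
  obtains Y Z where "Y \<in> carrier_mat nr (mrank X)" "Z \<in> carrier_mat (mrank X) nc" "X = Y * Z"
proof -
  obtain P Q where P: "P \<in> carrier_mat (mrank X) nr" and Q: "Q \<in> carrier_mat nc (mrank X)"
    and fact: "X = X * Q * (P * X)"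
    using rank_factorization[OF X] by blast
  show ?thesis by (rule that[OF mult_carrier_mat[OF X Q] mult_carrier_mat[OF P X] fact])
qed

lemma mrank_mult_le:
  fixes X :: "'a::field mat"
  assumes X: "X \<in> carrier_mat nr nc" and U: "U \<in> carrier_mat a nr" and W: "W \<in> carrier_mat nc b"
  shows "mrank (U * X * W) \<le> mrank X"
proof -
  define k where "k = mrank X"
  obtain Y Z where Y: "Y \<in> carrier_mat nr k" and Z: "Z \<in> carrier_mat k nc"
    and XYZ: "X = Y * Z"
    unfolding k_def by (rule mrank_leE[OF X])
  have "U * X * W = (U * Y) * (Z * W)"
    unfolding XYZ by (simp only: mat_assoc index_mult_mat carrier_matD[OF Y] carrier_matD[OF U]
        carrier_matD[OF W] carrier_matD[OF Z])
  moreover have "mrank ((U * Y) * (Z * W)) \<le> k"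
    by (rule mrank_leI) (use U Y Z W in auto)
  ultimately show ?thesis by (simp only: k_def)
qed

lemma mrank_mult_invertible:
  fixes X :: "'a::field mat"
  assumes X: "X \<in> carrier_mat nr nc" and U: "U \<in> carrier_mat a nr" and W: "W \<in> carrier_mat nc b"
    and U': "U' \<in> carrier_mat nr a" and W': "W' \<in> carrier_mat b nc"
    and "U' * U = 1\<^sub>m nr" "W * W' = 1\<^sub>m nc"
  shows "mrank (U * X * W) = mrank X"
proof (rule antisym)
  show "mrank (U * X * W) \<le> mrank X" using mrank_mult_le[OF X U W] .
  have "X = (U' * U) * X * (W * W')" unfolding assms(6,7) using X by simp
  also have "\<dots> = U' * (U * X * W) * W'"
    by (simp only: mat_assoc index_mult_mat carrier_matD[OF X] carrier_matD[OF U]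
        carrier_matD[OF W] carrier_matD[OF U'] carrier_matD[OF W'])
  finally have "X = U' * (U * X * W) * W'" .
  then have "mrank X = mrank (U' * (U * X * W) * W')" by (rule arg_cong)
  also have "\<dots> \<le> mrank (U * X * W)"
    by (rule mrank_mult_le[OF _ U' W']) (use X U W in auto)
  finally show "mrank X \<le> mrank (U * X * W)" .
qed

lemma mrank_le_dim:
  fixes X :: "'a::field mat"
  assumes X: "X \<in> carrier_mat nr nc"
  shows "mrank X \<le> nr" "mrank X \<le> nc"
proof -
  show "mrank X \<le> nr"
    using mrank_leI[OF one_carrier_mat X] unfolding left_mult_one_mat[OF X] .
  show "mrank X \<le> nc"
    using mrank_leI[OF X one_carrier_mat] unfolding right_mult_one_mat[OF X] .
qed

lemma mrank_full_iff_det: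
  fixes X :: "'a::field mat"
  assumes X: "X \<in> carrier_mat n n"
  shows "n \<le> mrank X \<longleftrightarrow> det X \<noteq> 0"
proof -
  have "det X \<noteq> 0 \<longleftrightarrow> mrank X = n"
    unfolding carrier_matD(1)[OF X] by (rule vec_space.det_rank_iff[OF X])
  then show ?thesis using mrank_le_dim(1)[OF X] by auto
qed

text \<open>Block elimination with pivot \<open>D\<close>. The matrix is \<open>L * N * U\<close>,
  where \<open>D\<close> is kept inside \<open>U\<close> so that \<open>N\<close> is block diagonal
  with an identity and the Schur complement; \<open>L'\<close> and \<open>U'\<close> undo the outer
  factors.\<close>

lemma mrank_four_block_schur:
  fixes D :: "'a::field mat"
  assumes D: "D \<in> carrier_mat m m" and R: "R \<in> carrier_mat m b"
    and S: "S \<in> carrier_mat a m" and T: "T \<in> carrier_mat a b"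
    and Di: "Di \<in> carrier_mat m m" "D * Di = 1\<^sub>m m" "Di * D = 1\<^sub>m m"
  shows "m + n \<le> mrank (four_block_mat D R S T) \<longleftrightarrow> n \<le> mrank (T - S * Di * R)"
proof -
  define E where "E = T - S * Di * R"
  have E: "E \<in> carrier_mat a b" using assms by (auto simp: E_def)
  note dims = carrier_matD[OF D] carrier_matD[OF R] carrier_matD[OF S] carrier_matD[OF T]
    carrier_matD[OF Di(1)] carrier_matD[OF E]
  have DiD: "Di * (D * M) = M" "D * (Di * M) = M" if "dim_row M = m" for M
    using that Di(2,3) dims by (auto intro!: mat_cancel)
  define L where "L = four_block_mat (1\<^sub>m m) (0\<^sub>m m a) (S * Di) (1\<^sub>m a)"
  define L' where "L' = four_block_mat (1\<^sub>m m) (0\<^sub>m m a) (- (S * Di)) (1\<^sub>m a)"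
  define U where "U = four_block_mat D R (0\<^sub>m b m) (1\<^sub>m b)"
  define U' where "U' = four_block_mat Di (- (Di * R)) (0\<^sub>m b m) (1\<^sub>m b)"
  define N where "N = four_block_mat (1\<^sub>m m) (0\<^sub>m m b) (0\<^sub>m a m) E"
  have NU: "N * U = four_block_mat D R (0\<^sub>m a m) E"
    unfolding N_def U_def using assms E
    by (subst mult_four_block_mat[of _ m m _ b _ a _ _ m _ b]) auto
  have "L * (N * U) = four_block_mat D R S (S * Di * R + E)"
    unfolding L_def NU using assms E DiD
    by (subst mult_four_block_mat[of _ m m _ a _ a _ _ m _ b]) (auto simp: mat_assoc dims DiD Di(3))
  also have "S * Di * R + E = T"
    unfolding E_def using S Di R T by (intro eq_matI) auto
  finally have X: "L * N * U = four_block_mat D R S T"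
    using assms E unfolding L_def N_def U_def by (simp add: mat_assoc)
  have L'L: "L' * L = 1\<^sub>m (m + a)"
    unfolding L_def L'_def using S Di E
    by (subst mult_four_block_mat[of _ m m _ a _ a _ _ m _ a]) (auto simp: uminus_l_inv_mat[of _ a m])
  have UU': "U * U' = 1\<^sub>m (m + b)"
    unfolding U_def U'_def using assms E DiD
    by (subst mult_four_block_mat[of _ m m _ b _ b _ _ m _ b]) 
      (auto simp: mat_assoc mat_distribs uminus_l_inv_mat[of _ m b] simp flip: four_block_one_mat)
  have "mrank (L * N * U) = mrank N"
    by (rule mrank_mult_invertible[OF _ _ _ _ _ L'L UU'])
      (use assms E in \<open>auto simp: N_def L_def U_def L'_def U'_def intro!: four_block_carrier_mat\<close>)
  \<comment> \<open>A certificate for \<open>E\<close> is enlarged by an identity block to one for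
    \<open>N\<close>; conversely a factorisation of \<open>E\<close> through dimension
    \<open>mrank E\<close> gives one of \<open>N\<close> through m more dimensions.\<close>
  moreover have "m + n \<le> mrank N \<longleftrightarrow> n \<le> mrank E"
  proof
    assume "n \<le> mrank E"
    then obtain P Q where PQ: "P \<in> carrier_mat n a" "Q \<in> carrier_mat b n" "P * E * Q = 1\<^sub>m n"
      using mrank_geE[OF E] by blast
    have "four_block_mat (1\<^sub>m m) (0\<^sub>m m a) (0\<^sub>m n m) P * N * four_block_mat (1\<^sub>m m) (0\<^sub>m m n) (0\<^sub>m b m) Q
        = 1\<^sub>m (m + n)"
      unfolding N_def using PQ E
      by (subst mult_four_block_mat[of _ m m _ a _ n _ _ m _ b], simp_all)
        (subst mult_four_block_mat[of _ m m _ b _ n _ _ m _ n], simp_all)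
    then show "m + n \<le> mrank N"
      using PQ E by (intro mrank_geI[of N "m + a" "m + b"]) (auto simp: N_def)
  next
    assume mn: "m + n \<le> mrank N"
    obtain Y Z where YZ: "Y \<in> carrier_mat a (mrank E)" "Z \<in> carrier_mat (mrank E) b" "E = Y * Z"
      using mrank_leE[OF E] .
    have "N = four_block_mat (1\<^sub>m m) (0\<^sub>m m (mrank E)) (0\<^sub>m a m) Y *
        four_block_mat (1\<^sub>m m) (0\<^sub>m m b) (0\<^sub>m (mrank E) m) Z"
      using YZ unfolding N_def by (subst mult_four_block_mat[of _ m m _ "mrank E" _ a _ _ m _ b]) auto
    also have "mrank \<dots> \<le> m + mrank E"
      by (rule mrank_leI) (use YZ in \<open>auto intro!: four_block_carrier_mat\<close>)
    finally have "mrank N \<le> m + mrank E" .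
    with mn show "n \<le> mrank E" by simp
  qed
  ultimately show ?thesis unfolding X E_def by simp
qed

section \<open>One channel: the largest rank that a gain can reach\<close>

lemma uminus_zero_mat [simp]: "- 0\<^sub>m a b = (0\<^sub>m a b :: 'a::group_add mat)"
  by (intro eq_matI) auto

text \<open>W = 1 - X Q P annihilates X from the left. If it annihilated b too, then b = X Q P b, so
  X and b together would factor through \<open>X * Q\<close> and the border would not raise the
  rank. A non-zero entry of \<open>W * b\<close> then selects a row of the required kind.\<close>

lemma append_cols_rank_witness:
  fixes X :: "'a::field mat"
  assumes X: "X \<in> carrier_mat nr nc" and b: "b \<in> carrier_mat nr q"
    and less: "mrank X < mrank (append_cols X b)"
  obtains w where "w \<in> carrier_mat 1 nr" "w * X = 0\<^sub>m 1 nc" "w * b \<noteq> 0\<^sub>m 1 q"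
proof -
  obtain P Q where P: "P \<in> carrier_mat (mrank X) nr" and Q: "Q \<in> carrier_mat nc (mrank X)"
    and fact: "X = X * Q * (P * X)"
    using rank_factorization[OF X] by blast
  define k where "k = mrank X"
  note P = P[folded k_def] and Q = Q[folded k_def]
  note dims = carrier_matD[OF X] carrier_matD[OF b] carrier_matD[OF P] carrier_matD[OF Q]
  define W where "W = 1\<^sub>m nr - X * Q * P"
  have W: "W \<in> carrier_mat nr nr" unfolding W_def by (auto intro!: carrier_matI simp: dims)
  have "W * X = X - X * Q * (P * X)"
    unfolding W_def using X by (simp add: mat_distribs mat_assoc dims)
  then have WX: "W * X = 0\<^sub>m nr nc" using fact X by (metis minus_r_inv_mat)
  have Wb: "W * b = b - X * Q * (P * b)"
    unfolding W_def using b by (simp add: mat_distribs mat_assoc dims)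
  have "W * b \<noteq> 0\<^sub>m nr q"
  proof
    assume "W * b = 0\<^sub>m nr q"
    with Wb have bz: "b - X * Q * (P * b) = 0\<^sub>m nr q" by simp
    have "b = X * Q * (P * b)"
    proof (rule eq_matI)
      fix i j assume ij: "i < dim_row (X * Q * (P * b))" "j < dim_col (X * Q * (P * b))"
      then have "(b - X * Q * (P * b)) $$ (i, j) = b $$ (i, j) - (X * Q * (P * b)) $$ (i, j)"
        by (intro index_minus_mat) (auto simp: dims)
      then show "b $$ (i, j) = (X * Q * (P * b)) $$ (i, j)"
        using ij unfolding bz by (simp add: dims del: index_mult_mat(1))
    qed (auto simp: dims)
    then have "append_cols X b = append_cols (X * Q * (P * X)) (X * Q * (P * b))"
      using fact by simp
    also have "\<dots> = X * Q * append_cols (P * X) (P * b)"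
      by (rule mult_append_cols[symmetric, of _ k nc _ q]) (auto intro: carrier_matI simp: dims)
    also have "mrank \<dots> \<le> k"
      by (rule mrank_leI[of _ nr _ _ "nc + q"]) (auto intro!: carrier_matI simp: dims append_cols_def)
    finally show False using less by (simp add: k_def)
  qed
  then obtain u v where u: "u \<in> carrier_mat 1 nr" and v: "v \<in> carrier_mat q 1"
    and uv: "u * (W * b * v) = 1\<^sub>m 1"
    using nonzero_entry_sandwich[of "W * b" nr q] W b by (metis mult_carrier_mat)
  note dims = dims carrier_matD[OF u] carrier_matD[OF v] carrier_matD[OF W]
  show ?thesis
  proof (rule that)
    show "u * W \<in> carrier_mat 1 nr" using u W by auto
    have "u * W * X = u * (W * X)" by (simp add: mat_assoc dims)
    then show "u * W * X = 0\<^sub>m 1 nc" unfolding WX using u by simp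
    show "u * W * b \<noteq> 0\<^sub>m 1 q"
    proof
      assume z: "u * W * b = 0\<^sub>m 1 q"
      have "u * (W * b * v) = u * W * b * v" by (simp add: mat_assoc dims)
      also have "\<dots> = 0\<^sub>m 1 1" unfolding z using v by simp
      finally have "(1\<^sub>m 1 :: 'a mat) = 0\<^sub>m 1 1" using uv by simp
      then have "(1\<^sub>m 1 :: 'a mat) $$ (0, 0) = 0\<^sub>m 1 1 $$ (0, 0)" by (rule arg_cong)
      then show False by simp
    qed
  qed
qed

text \<open>The mirror image, with Z = 1 - Q P X on the right: c Z = 0 would write the rows of c as
  combinations of those of \<open>P * X\<close>, and the stacked matrix would again factor through
  dimension \<open>mrank X\<close>.\<close>

lemma append_rows_rank_witness:
  fixes X :: "'a::field mat"
  assumes X: "X \<in> carrier_mat nr nc" and c: "c \<in> carrier_mat r nc"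
    and less: "mrank X < mrank (X @\<^sub>r c)"
  obtains z where "z \<in> carrier_mat nc 1" "X * z = 0\<^sub>m nr 1" "c * z \<noteq> 0\<^sub>m r 1"
proof -
  obtain P Q where P: "P \<in> carrier_mat (mrank X) nr" and Q: "Q \<in> carrier_mat nc (mrank X)"
    and fact: "X = X * Q * (P * X)"
    using rank_factorization[OF X] by blast
  define k where "k = mrank X"
  note P = P[folded k_def] and Q = Q[folded k_def]
  note dims = carrier_matD[OF X] carrier_matD[OF c] carrier_matD[OF P] carrier_matD[OF Q]
  define Z where "Z = 1\<^sub>m nc - Q * (P * X)"
  have Z: "Z \<in> carrier_mat nc nc" unfolding Z_def using X by (auto intro!: carrier_matI simp: dims)
  have "X * Z = X - X * Q * (P * X)"
    unfolding Z_def using X by (simp add: mat_distribs mat_assoc dims)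
  then have XZ: "X * Z = 0\<^sub>m nr nc" using fact X by (metis minus_r_inv_mat)
  have cZ: "c * Z = c - c * Q * (P * X)"
    unfolding Z_def using c by (simp add: mat_distribs mat_assoc dims)
  have "c * Z \<noteq> 0\<^sub>m r nc"
  proof
    assume "c * Z = 0\<^sub>m r nc"
    with cZ have cz: "c - c * Q * (P * X) = 0\<^sub>m r nc" by simp
    have "c = c * Q * (P * X)"
    proof (rule eq_matI)
      fix i j assume ij: "i < dim_row (c * Q * (P * X))" "j < dim_col (c * Q * (P * X))"
      then have "(c - c * Q * (P * X)) $$ (i, j) = c $$ (i, j) - (c * Q * (P * X)) $$ (i, j)"
        by (intro index_minus_mat) (auto simp: dims)
      then show "c $$ (i, j) = (c * Q * (P * X)) $$ (i, j)"
        using ij unfolding cz by (simp add: dims del: index_mult_mat(1))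
    qed (auto simp: dims)
    then have "X @\<^sub>r c = (X * Q * (P * X)) @\<^sub>r (c * Q * (P * X))"
      using fact by simp
    also have "\<dots> = ((X * Q) @\<^sub>r (c * Q)) * (P * X)"
      by (rule append_rows_mult[symmetric, of _ nr k _ r _ nc]) (auto intro: carrier_matI simp: dims)
    also have "mrank \<dots> \<le> k"
      by (rule mrank_leI[of _ "nr + r" _ _ nc]) (auto intro!: carrier_matI simp: dims append_rows_def)
    finally show False using less by (simp add: k_def)
  qed
  then obtain u v where u: "u \<in> carrier_mat 1 r" and v: "v \<in> carrier_mat nc 1"
    and uv: "u * (c * Z * v) = 1\<^sub>m 1"
    using nonzero_entry_sandwich[of "c * Z" r nc] Z c by (metis mult_carrier_mat)
  note dims = dims carrier_matD[OF u] carrier_matD[OF v] carrier_matD[OF Z]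
  show ?thesis
  proof (rule that)
    show "Z * v \<in> carrier_mat nc 1" using v Z by auto
    have "X * (Z * v) = X * Z * v" by (simp add: mat_assoc dims)
    then show "X * (Z * v) = 0\<^sub>m nr 1" unfolding XZ using v by simp
    show "c * (Z * v) \<noteq> 0\<^sub>m r 1"
    proof
      assume z: "c * (Z * v) = 0\<^sub>m r 1"
      have "u * (c * Z * v) = u * (c * (Z * v))" by (simp add: mat_assoc dims)
      also have "\<dots> = 0\<^sub>m 1 1" unfolding z using u by simp
      finally have "(1\<^sub>m 1 :: 'a mat) = 0\<^sub>m 1 1" using uv by simp
      then have "(1\<^sub>m 1 :: 'a mat) $$ (0, 0) = 0\<^sub>m 1 1 $$ (0, 0)" by (rule arg_cong)
      then show False by simp
    qed
  qed
qed

text \<open>A rank-one gain that joins a left kernel vector not killed by \<open>b\<close> to a right kernel vector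
  not killed by \<open>c\<close> raises the rank by one.\<close>

lemma rank_one_gain_increase:
  fixes X :: "'a::field mat"
  assumes X: "X \<in> carrier_mat nr nc" and b: "b \<in> carrier_mat nr q" and c: "c \<in> carrier_mat r nc"
    and lessb: "mrank X < mrank (append_cols X b)" and lessc: "mrank X < mrank (X @\<^sub>r c)"
  obtains K where "K \<in> carrier_mat q r" "mrank X < mrank (X + b * K * c)"
proof -
  obtain w where w: "w \<in> carrier_mat 1 nr" and wX: "w * X = 0\<^sub>m 1 nc" and "w * b \<noteq> 0\<^sub>m 1 q"
    using append_cols_rank_witness[OF X b lessb] .
  then obtain u v where u: "u \<in> carrier_mat 1 1" and v: "v \<in> carrier_mat q 1"
    and uv: "u * (w * b * v) = 1\<^sub>m 1"
    using nonzero_entry_sandwich[OF mult_carrier_mat[OF w b]] by blast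
  obtain z where z: "z \<in> carrier_mat nc 1" and Xz: "X * z = 0\<^sub>m nr 1" and "c * z \<noteq> 0\<^sub>m r 1"
    using append_rows_rank_witness[OF X c lessc] .
  then obtain s t where s: "s \<in> carrier_mat 1 r" and t: "t \<in> carrier_mat 1 1"
    and st: "s * (c * z * t) = 1\<^sub>m 1"
    using nonzero_entry_sandwich[OF mult_carrier_mat[OF c z]] by blast
  define k where "k = mrank X"
  obtain P Q where P: "P \<in> carrier_mat k nr" and Q: "Q \<in> carrier_mat nc k"
    and PXQ: "P * X * Q = 1\<^sub>m k"
    unfolding k_def using rank_factorization[OF X] by blast
  \<comment> \<open>The factors \<open>u\<close>, \<open>v\<close>, \<open>s\<close>,
    \<open>t\<close> normalise the pairings to \<open>w1 * b1 = 1\<^sub>m 1\<close> and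
    \<open>c1 * z1 = 1\<^sub>m 1\<close>.\<close>
  define w1 where "w1 = u * w"
  define z1 where "z1 = z * t"
  define b1 where "b1 = b * v"
  define c1 where "c1 = s * c"
  have w1: "w1 \<in> carrier_mat 1 nr" and z1: "z1 \<in> carrier_mat nc 1"
    and b1: "b1 \<in> carrier_mat nr 1" and c1: "c1 \<in> carrier_mat 1 nc"
    using u w z t b v s c by (auto simp: w1_def z1_def b1_def c1_def)
  note dims = carrier_matD[OF X] carrier_matD[OF b] carrier_matD[OF c] carrier_matD[OF P] carrier_matD[OF Q]
    carrier_matD[OF w] carrier_matD[OF z] carrier_matD[OF u] carrier_matD[OF v] carrier_matD[OF s] carrier_matD[OF t]
    carrier_matD[OF w1] carrier_matD[OF z1] carrier_matD[OF b1] carrier_matD[OF c1]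
  have "w1 * X = u * (w * X)" by (simp add: w1_def mat_assoc dims)
  then have w1X: "w1 * X = 0\<^sub>m 1 nc" unfolding wX using u by simp
  have "X * z1 = X * z * t" by (simp add: z1_def mat_assoc dims)
  then have Xz1: "X * z1 = 0\<^sub>m nr 1" unfolding Xz using t by simp
  have w1b1: "w1 * b1 = 1\<^sub>m 1" unfolding uv[symmetric] w1_def b1_def by (simp add: mat_assoc dims)
  have c1z1: "c1 * z1 = 1\<^sub>m 1" unfolding st[symmetric] z1_def c1_def by (simp add: mat_assoc dims)
  define Y where "Y = X + b1 * c1"
  \<comment> \<open>The old certificate is corrected so that \<open>P1\<close> annihilates
    \<open>b1\<close> and \<open>c1\<close> annihilates \<open>Q1\<close>. Since \<open>w1\<close>
    and \<open>z1\<close> lie in the kernels of \<open>X\<close>, the products with \<open>X\<close>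
    stay the same, and the rank-one term affects only the new row and column.\<close>
  define P1 where "P1 = P - P * b1 * w1"
  define Q1 where "Q1 = Q - z1 * (c1 * Q)"
  have P1: "P1 \<in> carrier_mat k nr" and Q1: "Q1 \<in> carrier_mat nc k" and Y: "Y \<in> carrier_mat nr nc"
    by (auto intro!: carrier_matI simp: P1_def Q1_def Y_def dims)
  have P1b1: "P1 * b1 = 0\<^sub>m k 1"
    unfolding P1_def using mult_carrier_mat[OF P b1]
    by (simp add: mat_assoc mat_distribs dims w1b1 del: assoc_mult_mat)
  have c1Q1: "c1 * Q1 = 0\<^sub>m 1 k"
    unfolding Q1_def using mult_carrier_mat[OF c1 Q] mat_cancel[OF c1z1, of "c1 * Q"]
    by (simp add: mat_assoc mat_distribs dims del: assoc_mult_mat)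
  have XQ1: "X * Q1 = X * Q"
  proof -
    have "X * (z1 * (c1 * Q)) = X * z1 * (c1 * Q)" by (simp add: mat_assoc dims)
    then show ?thesis
      unfolding Q1_def using mult_carrier_mat[OF X Q] Xz1 mult_carrier_mat[OF c1 Q]
      by (auto simp: mat_distribs dims del: assoc_mult_mat intro!: eq_matI)
  qed
  have P1XQ: "P1 * (X * Q) = 1\<^sub>m k"
  proof -
    have "P1 * (X * Q) = P * X * Q - P * b1 * (w1 * X * Q)"
      unfolding P1_def by (simp add: mat_assoc mat_distribs dims del: assoc_mult_mat)
    then show ?thesis unfolding PXQ w1X using P b1 Q by (auto intro!: eq_matI)
  qed
  have YM: "Y * M = X * M + b1 * (c1 * M)" if "dim_row M = nc" for M
    unfolding Y_def using that by (simp add: mat_distribs mat_assoc dims)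
  have YQ: "Y * Q1 = X * Q"
    using mult_carrier_mat[OF X Q] b1 by (simp add: YM dims carrier_matD[OF Q1] c1Q1 XQ1)
  have Yz: "Y * z1 = b1"
    using b1 by (simp add: YM dims c1z1 Xz1)
  have "(P1 @\<^sub>r w1) * Y * append_cols Q1 z1 = 1\<^sub>m (k + 1)"
  proof (rule sandwich_extend[OF Y P1 Q1 w1 z1])
    show "P1 * (Y * Q1) = 1\<^sub>m k" unfolding YQ by (rule P1XQ)
    show "P1 * (Y * z1) = 0\<^sub>m k 1" unfolding Yz by (rule P1b1)
    have "w1 * (X * Q) = w1 * X * Q" by (simp add: mat_assoc dims)
    then show "w1 * (Y * Q1) = 0\<^sub>m 1 k" unfolding YQ w1X using Q by simp
    show "w1 * (Y * z1) = 1\<^sub>m 1" unfolding Yz by (rule w1b1)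
  qed
  then have "k + 1 \<le> mrank Y"
    by (rule mrank_geI[OF Y carrier_append_rows[OF P1 w1] append_cols_carrier[OF Q1 z1]])
  moreover have "Y = X + b * (v * s) * c"
    by (simp add: Y_def b1_def c1_def mat_assoc dims)
  ultimately show ?thesis
    using that[of "v * s"] mult_carrier_mat[OF v s] by (simp add: k_def)
qed

text \<open>Take a gain of maximal resulting rank, and let Y be the resulting matrix. Closing the
  loop does not lower the ranks of the bordered matrices, so if Y had rank below n, both borders
  would raise its rank and one more rank-one gain would beat the maximum.\<close>

lemma single_channel_rank:
  fixes X :: "'a::field mat"
  assumes X: "X \<in> carrier_mat nr nc" and b: "b \<in> carrier_mat nr q" and c: "c \<in> carrier_mat r nc"
    and nb: "n \<le> mrank (append_cols X b)" and nc: "n \<le> mrank (X @\<^sub>r c)"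
  obtains K where "K \<in> carrier_mat q r" "n \<le> mrank (X + b * K * c)"
proof -
  define S where "S = {mrank (X + b * K * c) | K. K \<in> carrier_mat q r}"
  have carr: "X + b * K * c \<in> carrier_mat nr nc" if "K \<in> carrier_mat q r" for K
    using X b c that by simp
  have "S \<subseteq> {..nr}" using mrank_le_dim(1)[OF carr] by (auto simp: S_def)
  then have fin: "finite S" by (rule finite_subset) simp
  have ne: "S \<noteq> {}" using zero_carrier_mat[of q r] by (auto simp: S_def)
  obtain K where K: "K \<in> carrier_mat q r" and max: "Max S = mrank (X + b * K * c)"
    using Max_in[OF fin ne] by (auto simp: S_def)
  define Y where "Y = X + b * K * c"
  have Y: "Y \<in> carrier_mat nr nc" unfolding Y_def by (rule carr[OF K])
  note dims = carrier_matD[OF X] carrier_matD[OF b] carrier_matD[OF c] carrier_matD[OF K] carrier_matD[OF Y]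
  have "mrank (append_cols X b) \<le> mrank (append_cols Y b)"
  proof -
    \<comment> \<open>A column operation: subtracting b times \<open>K * c\<close> from the first
      columns turns \<open>Y\<close> back into \<open>X\<close> and leaves the border unchanged. The
      row case below is analogous.\<close>
    define U where "U = four_block_mat (1\<^sub>m nc) (0\<^sub>m nc q) (- (K * c)) (1\<^sub>m q)"
    have U: "U \<in> carrier_mat (nc + q) (nc + q)"
      unfolding U_def by (rule four_block_carrier_mat) auto
    have "append_cols Y b * U = append_cols X b"
    proof -
      have "append_cols Y b * U = four_block_mat (Y * 1\<^sub>m nc + b * - (K * c)) (Y * 0\<^sub>m nc q + b * 1\<^sub>m q)
         (0\<^sub>m 0 nc * 1\<^sub>m nc + 0\<^sub>m 0 q * - (K * c)) (0\<^sub>m 0 nc * 0\<^sub>m nc q + 0\<^sub>m 0 q * 1\<^sub>m q)"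
        unfolding U_def append_cols_def dims using Y b K c
        by (intro mult_four_block_mat[of _ nr nc _ q _ 0 _ _ nc _ q]) auto
      also have "Y * 1\<^sub>m nc + b * - (K * c) = X"
        unfolding Y_def using X b K c
        by (intro eq_matI) (auto simp: mat_distribs mat_assoc dims simp del: index_mult_mat(1))
      finally show ?thesis using Y b K c unfolding append_cols_def by (simp add: dims)
    qed
    moreover have "mrank (1\<^sub>m nr * append_cols Y b * U) \<le> mrank (append_cols Y b)"
      by (rule mrank_mult_le[OF append_cols_carrier[OF Y b] one_carrier_mat U])
    ultimately show ?thesis using append_cols_carrier[OF Y b] by simp
  qed
  moreover have "mrank (X @\<^sub>r c) \<le> mrank (Y @\<^sub>r c)"
  proof -
    define U where "U = four_block_mat (1\<^sub>m nr) (- (b * K)) (0\<^sub>m r nr) (1\<^sub>m r)"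
    have U: "U \<in> carrier_mat (nr + r) (nr + r)"
      unfolding U_def by (rule four_block_carrier_mat) auto
    have "U * (Y @\<^sub>r c) = X @\<^sub>r c"
    proof -
      have "U * (Y @\<^sub>r c) = four_block_mat (1\<^sub>m nr * Y + - (b * K) * c) (1\<^sub>m nr * 0\<^sub>m nr 0 + - (b * K) * 0\<^sub>m r 0)
         (0\<^sub>m r nr * Y + 1\<^sub>m r * c) (0\<^sub>m r nr * 0\<^sub>m nr 0 + 1\<^sub>m r * 0\<^sub>m r 0)"
        unfolding U_def append_rows_def dims using Y b K c
        by (intro mult_four_block_mat[of _ nr nr _ r _ r _ _ nc _ 0]) auto
      also have "1\<^sub>m nr * Y + - (b * K) * c = X"
        unfolding Y_def using X b K c
        by (intro eq_matI) (auto simp: mat_distribs mat_assoc dims simp del: index_mult_mat(1))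
      finally show ?thesis using Y b K c unfolding append_rows_def by (simp add: dims)
    qed
    moreover have "mrank (U * (Y @\<^sub>r c) * 1\<^sub>m nc) \<le> mrank (Y @\<^sub>r c)"
      by (rule mrank_mult_le[OF carrier_append_rows[OF Y c] U one_carrier_mat])
    ultimately show ?thesis using carrier_append_rows[OF X c] by simp
  qed
  ultimately have "n \<le> mrank Y" if "\<not> n \<le> mrank Y \<Longrightarrow> False" using that by blast
  moreover have False if "\<not> n \<le> mrank Y"
  proof -
    have "mrank Y < mrank (append_cols Y b)" "mrank Y < mrank (Y @\<^sub>r c)"
      using that nb nc \<open>mrank (append_cols X b) \<le> _\<close> \<open>mrank (X @\<^sub>r c) \<le> _\<close> by linarith+
    from rank_one_gain_increase[OF Y b c this] obtain K' where
      K': "K' \<in> carrier_mat q r" and less: "mrank Y < mrank (Y + b * K' * c)" .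
    have "Y + b * K' * c = X + b * (K + K') * c"
    proof -
      have "b * (K + K') * c = b * K * c + b * K' * c"
        using K K' b c by (simp add: mat_distribs dims)
      then show ?thesis unfolding Y_def using X b c K K'
        by (simp del: index_mult_mat add: assoc_add_mat[of _ nr nc])
    qed
    then have "mrank (Y + b * K' * c) \<in> S"
      unfolding S_def using K K' by (auto intro!: exI[of _ "K + K'"])
    then have "mrank (Y + b * K' * c) \<le> Max S" by (rule Max_ge[OF fin])
    then show False using less max by (simp add: Y_def)
  qed
  ultimately show ?thesis using that[OF K] unfolding Y_def by blast
qed

text \<open>Selection is multiplication by 0/1 matrices. The index maps are arbitrary, so every
  reordering of rows and columns below is covered; an equality of ranks follows by applying this in
  both directions.\<close>

lemma mrank_select_le:
  fixes X :: "'a::field mat"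
  assumes X: "X \<in> carrier_mat nr nc"
    and f: "\<And>i. i < a \<Longrightarrow> f i < nr" and g: "\<And>j. j < b \<Longrightarrow> g j < nc"
  shows "mrank (mat a b (\<lambda>(i, j). X $$ (f i, g j))) \<le> mrank X"
proof -
  define U where "U = mat a nr (\<lambda>(i, j). if j = f i then 1 else (0 :: 'a))"
  define W where "W = mat nc b (\<lambda>(i, j). if i = g j then 1 else (0 :: 'a))"
  have U: "U \<in> carrier_mat a nr" and W: "W \<in> carrier_mat nc b"
    by (auto simp: U_def W_def)
  have UX: "(U * X) $$ (i, j) = X $$ (f i, j)" if "i < a" "j < nc" for i j
  proof -
    have "(U * X) $$ (i, j) = (\<Sum>k\<in>{0..<nr}. (if k = f i then 1 else 0) * X $$ (k, j))"
      using that X by (auto simp: U_def scalar_prod_def)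
    also have "\<dots> = (\<Sum>k\<in>{0..<nr}. if k = f i then X $$ (k, j) else 0)"
      by (rule sum.cong) auto
    finally show ?thesis using f[OF that(1)] by simp
  qed
  have "U * X * W = mat a b (\<lambda>(i, j). X $$ (f i, g j))"
  proof (rule eq_matI)
    fix i j assume "i < dim_row (mat a b (\<lambda>(i, j). X $$ (f i, g j)))" "j < dim_col (mat a b (\<lambda>(i, j). X $$ (f i, g j)))"
    then have ij: "i < a" "j < b" by auto
    have "(U * X * W) $$ (i, j) = (\<Sum>k\<in>{0..<nc}. (U * X) $$ (i, k) * (if k = g j then 1 else 0))"
      using ij X U by (auto simp: W_def scalar_prod_def)
    also have "\<dots> = (\<Sum>k\<in>{0..<nc}. if k = g j then (U * X) $$ (i, k) else 0)"
      by (rule sum.cong) auto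
    finally show "(U * X * W) $$ (i, j) = mat a b (\<lambda>(i, j). X $$ (f i, g j)) $$ (i, j)"
      using g[OF ij(2)] ij UX by simp
  qed (use U W in auto)
  then show ?thesis using mrank_mult_le[OF X U W] by simp
qed

section \<open>Genericity along a line\<close>

text \<open>Along the line the determinant is a polynomial in t. It is non-zero since its value at
  t0 is, so it has finitely many roots.\<close>

lemma finite_det_line:
  fixes N0 N1 :: "'a::idom mat"
  assumes N0: "N0 \<in> carrier_mat n n" and N1: "N1 \<in> carrier_mat n n"
    and nz: "det (N0 + t0 \<cdot>\<^sub>m N1) \<noteq> 0"
  shows "finite {t. det (N0 + t \<cdot>\<^sub>m N1) = 0}"
proof -
  define p where "p = det (mat n n (\<lambda>(i, j). [:N0 $$ (i, j), N1 $$ (i, j):]))"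
  have p: "poly p t = det (N0 + t \<cdot>\<^sub>m N1)" for t
  proof -
    have ev: "comm_ring_hom (\<lambda>p :: 'a poly. poly p t)" by unfold_locales auto
    have "poly p t = det (map_mat (\<lambda>p. poly p t) (mat n n (\<lambda>(i, j). [:N0 $$ (i, j), N1 $$ (i, j):])))"
      unfolding p_def by (simp only: comm_ring_hom.hom_det[OF ev])
    also have "map_mat (\<lambda>p. poly p t) (mat n n (\<lambda>(i, j). [:N0 $$ (i, j), N1 $$ (i, j):])) = N0 + t \<cdot>\<^sub>m N1"
      using N0 N1 by (intro eq_matI) auto
    finally show ?thesis .
  qed
  then have "p \<noteq> 0" using nz by (metis poly_0)
  from poly_roots_finite[OF this] show ?thesis by (simp add: p)
qed

text \<open>The certificate at t0 is kept fixed for all t. Wherever the determinant of the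
  compressed square matrix is non-zero, the rank is still at least n, so the determinant on a line
  decides.\<close>

lemma finite_rank_drop_line:
  fixes Y0 Y1 :: "'a::field mat"
  assumes Y0: "Y0 \<in> carrier_mat nr nc" and Y1: "Y1 \<in> carrier_mat nr nc"
    and n: "n \<le> mrank (Y0 + t0 \<cdot>\<^sub>m Y1)"
  shows "finite {t. \<not> n \<le> mrank (Y0 + t \<cdot>\<^sub>m Y1)}"
proof -
  have Y: "Y0 + t \<cdot>\<^sub>m Y1 \<in> carrier_mat nr nc" for t using Y0 Y1 by simp
  obtain P Q where P: "P \<in> carrier_mat n nr" and Q: "Q \<in> carrier_mat nc n"
    and PQ: "P * (Y0 + t0 \<cdot>\<^sub>m Y1) * Q = 1\<^sub>m n"
    using mrank_geE[OF Y n] .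
  define N0 where "N0 = P * Y0 * Q"
  define N1 where "N1 = P * Y1 * Q"
  have N: "N0 \<in> carrier_mat n n" "N1 \<in> carrier_mat n n"
    unfolding N0_def N1_def using P Q Y0 Y1 by auto
  have eq: "P * (Y0 + t \<cdot>\<^sub>m Y1) * Q = N0 + t \<cdot>\<^sub>m N1" for t
  proof -
    have "P * (Y0 + t \<cdot>\<^sub>m Y1) * Q = P * Y0 * Q + P * (t \<cdot>\<^sub>m Y1) * Q"
      using P Q Y0 Y1 by (simp add: mat_distribs)
    also have "P * (t \<cdot>\<^sub>m Y1) = t \<cdot>\<^sub>m (P * Y1)" by (rule mult_smult_distrib[OF P Y1])
    also have "t \<cdot>\<^sub>m (P * Y1) * Q = t \<cdot>\<^sub>m (P * Y1 * Q)"
      by (rule mult_smult_assoc_mat[OF mult_carrier_mat[OF P Y1] Q])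
    finally show ?thesis by (simp add: N0_def N1_def)
  qed
  have "{t. \<not> n \<le> mrank (Y0 + t \<cdot>\<^sub>m Y1)} \<subseteq> {t. det (N0 + t \<cdot>\<^sub>m N1) = 0}"
  proof
    fix t assume t: "t \<in> {t. \<not> n \<le> mrank (Y0 + t \<cdot>\<^sub>m Y1)}"
    have "mrank (N0 + t \<cdot>\<^sub>m N1) \<le> mrank (Y0 + t \<cdot>\<^sub>m Y1)"
      unfolding eq[symmetric] by (rule mrank_mult_le[OF Y P Q])
    with t have "\<not> n \<le> mrank (N0 + t \<cdot>\<^sub>m N1)" by simp
    then show "t \<in> {t. det (N0 + t \<cdot>\<^sub>m N1) = 0}"
      using mrank_full_iff_det[of "N0 + t \<cdot>\<^sub>m N1" n] N by simp
  qed
  moreover have "det (N0 + t0 \<cdot>\<^sub>m N1) \<noteq> 0" unfolding eq[symmetric] PQ by simp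
  ultimately show ?thesis using finite_det_line[OF N] finite_subset by blast
qed

text \<open>A gain serving all earlier conditions and one serving the new condition are joined by a
  line. Each condition holds at t = 0 or t = 1, hence fails for finitely many t only, and an
  infinite field leaves a common t.\<close>

lemma simultaneous_gain:
  fixes X :: "'s \<Rightarrow> 'a::field mat"
  assumes inf: "infinite (UNIV :: 'a set)" and fin: "finite S"
    and "\<And>s. s \<in> S \<Longrightarrow> X s \<in> carrier_mat (nr s) (nc s)"
    and "\<And>s. s \<in> S \<Longrightarrow> b s \<in> carrier_mat (nr s) q"
    and "\<And>s. s \<in> S \<Longrightarrow> c s \<in> carrier_mat r (nc s)"
    and "\<And>s. s \<in> S \<Longrightarrow> \<exists>K \<in> carrier_mat q r. n \<le> mrank (X s + b s * K * c s)"
  shows "\<exists>K \<in> carrier_mat q r. \<forall>s \<in> S. n \<le> mrank (X s + b s * K * c s)"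
  using fin assms(3-)
proof (induction S rule: finite_induct)
  case empty
  then show ?case by (auto intro: bexI[of _ "0\<^sub>m q r"])
next
  case (insert s0 S)
  then obtain K0 where K0: "K0 \<in> carrier_mat q r" "\<forall>s \<in> S. n \<le> mrank (X s + b s * K0 * c s)"
    by auto
  obtain K1 where K1: "K1 \<in> carrier_mat q r" "n \<le> mrank (X s0 + b s0 * K1 * c s0)"
    using insert.prems(4)[of s0] by auto
  define K where "K = (\<lambda>t. K0 + t \<cdot>\<^sub>m (K1 - K0))"
  have K: "K t \<in> carrier_mat q r" for t
    unfolding K_def by (intro add_carrier_mat smult_carrier_mat minus_carrier_mat K0(1))
  have "finite {t. \<not> n \<le> mrank (X s + b s * K t * c s)}" if s: "s \<in> insert s0 S" for s
  proof -
    note X = insert.prems(1)[OF s] and b = insert.prems(2)[OF s] and c = insert.prems(3)[OF s]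
    have eq: "X s + b s * K t * c s = (X s + b s * K0 * c s) + t \<cdot>\<^sub>m (b s * (K1 - K0) * c s)" for t
    proof -
      have D: "K1 - K0 \<in> carrier_mat q r" by (rule minus_carrier_mat[OF K0(1)])
      have "b s * K t * c s = b s * K0 * c s + b s * (t \<cdot>\<^sub>m (K1 - K0)) * c s"
        unfolding K_def using b c K0 D by (simp add: mat_distribs)
      also have "b s * (t \<cdot>\<^sub>m (K1 - K0)) = t \<cdot>\<^sub>m (b s * (K1 - K0))" by (rule mult_smult_distrib[OF b D])
      also have "t \<cdot>\<^sub>m (b s * (K1 - K0)) * c s = t \<cdot>\<^sub>m (b s * (K1 - K0) * c s)"
        by (rule mult_smult_assoc_mat[OF mult_carrier_mat[OF b D] c])
      finally show ?thesis
        using X mult_carrier_mat[OF mult_carrier_mat[OF b K0(1)] c] mult_carrier_mat[OF mult_carrier_mat[OF b D] c]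
        by (simp add: assoc_add_mat[of _ "nr s" "nc s"])
    qed
    have "K 0 = K0" "K 1 = K1" using K0 K1 by (auto simp: K_def intro!: eq_matI)
    then have "\<exists>t. n \<le> mrank (X s + b s * K t * c s)" using s K0 K1 by (metis insertE)
    then obtain t0 where "n \<le> mrank (X s + b s * K t0 * c s)" ..
    then show ?thesis
      unfolding eq using X mult_carrier_mat[OF mult_carrier_mat[OF b K0(1)] c]
        mult_carrier_mat[OF mult_carrier_mat[OF b minus_carrier_mat[OF K0(1)]] c]
      by (intro finite_rank_drop_line[of _ "nr s" "nc s"]) auto
  qed
  then have "finite (\<Union>s \<in> insert s0 S. {t. \<not> n \<le> mrank (X s + b s * K t * c s)})"
    using insert.hyps by blast
  from ex_new_if_finite[OF inf this] obtain t where
    "\<forall>s \<in> insert s0 S. n \<le> mrank (X s + b s * K t * c s)" by auto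
  then show ?case using K by blast
qed

section \<open>Concatenation\<close>

lemma hcat_on_empty [simp]: "hcat_on nr F {} = 0\<^sub>m nr 0"
  by (simp add: hcat_on_def hcat_def)

lemma vcat_on_empty [simp]: "vcat_on nc F {} = 0\<^sub>m 0 nc"
  by (simp add: vcat_on_def vcat_def)

lemma sorted_list_of_set_insert_min:
  fixes j :: nat
  assumes "finite V" "\<And>i. i \<in> V \<Longrightarrow> j < i"
  shows "sorted_list_of_set (insert j V) = j # sorted_list_of_set V"
proof -
  have "j \<notin> V" using assms(2) by blast
  then show ?thesis
    using assms by (simp add: insort_is_Cons less_imp_le)
qed

text \<open>Concatenation folds over the sorted list of indices, so it is a new smallest index that
  is prepended. This is why the inductions over index sets below insert minima.\<close>

lemma hcat_on_insert_min:
  "finite V \<Longrightarrow> (\<And>i. i \<in> V \<Longrightarrow> j < i) \<Longrightarrow> hcat_on nr F (insert j V) = append_cols (F j) (hcat_on nr F V)"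
  by (simp add: hcat_on_def hcat_def sorted_list_of_set_insert_min del: sorted_list_of_set_insert_remove)

lemma vcat_on_insert_min:
  "finite V \<Longrightarrow> (\<And>i. i \<in> V \<Longrightarrow> j < i) \<Longrightarrow> vcat_on nc F (insert j V) = F j @\<^sub>r vcat_on nc F V"
  by (simp add: vcat_on_def vcat_def sorted_list_of_set_insert_min del: sorted_list_of_set_insert_remove)

lemma hcat_on_carrier:
  assumes "finite V" "\<And>i. i \<in> V \<Longrightarrow> F i \<in> carrier_mat nr (q i)"
  shows "hcat_on nr F V \<in> carrier_mat nr (\<Sum>i\<in>V. q i)"
  using assms
proof (induction V rule: finite_linorder_min_induct)
  case (insert j V)
  then have "j \<notin> V" by blast
  with insert show ?case by (simp add: hcat_on_insert_min)
qed simp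

lemma vcat_on_carrier:
  assumes "finite V" "\<And>i. i \<in> V \<Longrightarrow> F i \<in> carrier_mat (r i) nc"
  shows "vcat_on nc F V \<in> carrier_mat (\<Sum>i\<in>V. r i) nc"
  using assms
proof (induction V rule: finite_linorder_min_induct)
  case (insert j V)
  then have "j \<notin> V" by blast
  with insert show ?case by (simp add: vcat_on_insert_min)
qed simp

lemma msum_carrier [simp]: "msum nr nc F I \<in> carrier_mat nr nc"
  by (simp add: msum_def)

lemma msum_insert:
  assumes "finite I" "j \<notin> I" "F j \<in> carrier_mat nr nc"
  shows "msum nr nc F (insert j I) = F j + msum nr nc F I"
  using assms by (intro eq_matI) (auto simp: msum_def)

lemma msum_cong:
  "(\<And>i. i \<in> I \<Longrightarrow> F i = H i) \<Longrightarrow> msum nr nc F I = msum nr nc H I"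
  by (simp add: msum_def)

lemma hcat_on_mult_vcat_on:
  fixes F H :: "nat \<Rightarrow> 'a::semiring_1 mat"
  assumes "finite V" "\<And>i. i \<in> V \<Longrightarrow> F i \<in> carrier_mat nr (d i)"
    "\<And>i. i \<in> V \<Longrightarrow> H i \<in> carrier_mat (d i) nc"
  shows "hcat_on nr F V * vcat_on nc H V = msum nr nc (\<lambda>i. F i * H i) V"
  using assms
proof (induction V rule: finite_linorder_min_induct)
  case empty
  then show ?case by (intro eq_matI) (auto simp: msum_def scalar_prod_def)
next
  case (insert j V)
  then have j: "j \<notin> V" by blast
  have "hcat_on nr F (insert j V) * vcat_on nc H (insert j V) = F j * H j + hcat_on nr F V * vcat_on nc H V"
    using insert by (simp only: hcat_on_insert_min vcat_on_insert_min)
      (intro append_cols_mult_append_rows[of _ nr "d j" _ "\<Sum>i\<in>V. d i" _ nc] hcat_on_carrier vcat_on_carrier, auto)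
  also have "\<dots> = msum nr nc (\<lambda>i. F i * H i) (insert j V)"
    using insert.IH insert.prems insert.hyps(1) j mult_carrier_mat[of "F j" nr "d j" "H j" nc]
    by (subst msum_insert) auto
  finally show ?case .
qed

section \<open>Generic rank under decentralized gains\<close>

text \<open>The matrix of the Anderson-Clements rank test for decentralized fixed modes. The index
  set \<open>I\<close> is a parameter because channels are removed one at a time.\<close>

definition cut_mat where
  "cut_mat M B C I V = four_block_mat M (hcat_on (dim_row M) B V) (vcat_on (dim_col M) C (I - V))
     (0\<^sub>m (\<Sum>i\<in>I - V. dim_row (C i)) (\<Sum>i\<in>V. dim_col (B i)))"

text \<open>Seen from a cut of the other channels, a channel has zeros in the added rows and
  columns, so closing its loop changes only the upper left block, and does so independently of the
  cut.\<close>

lemma corner_gain: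
  fixes M :: "'a::ring_1 mat"
  assumes "M \<in> carrier_mat a b" "S \<in> carrier_mat a k" "T \<in> carrier_mat l b"
    "\<beta> \<in> carrier_mat a q" "\<gamma> \<in> carrier_mat r b" "K \<in> carrier_mat q r"
  shows "four_block_mat M S T (0\<^sub>m l k) + (\<beta> @\<^sub>r 0\<^sub>m l q) * K * append_cols \<gamma> (0\<^sub>m r k)
    = four_block_mat (M + \<beta> * K * \<gamma>) S T (0\<^sub>m l k)"
proof -
  have "(\<beta> @\<^sub>r 0\<^sub>m l q) * K = (\<beta> * K) @\<^sub>r (0\<^sub>m l r)"
    using assms by (subst append_rows_mult[of _ a q _ l _ r]) auto
  also have "\<dots> * append_cols \<gamma> (0\<^sub>m r k) = four_block_mat (\<beta> * K * \<gamma>) (0\<^sub>m a k) (0\<^sub>m l b) (0\<^sub>m l k)"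
    using assms by (subst append_rows_mult_append_cols[of _ a r _ l _ b _ k]) auto
  finally show ?thesis
    using assms by (simp add: add_four_block_mat[of _ a b _ k _ l])
qed

text \<open>Links the bordered matrix of \<open>single_channel_rank\<close> to the cut that contains
  the new channel: the two differ only in the position of the columns of \<beta>.\<close>

lemma mrank_corner_cols:
  fixes M :: "'a::field mat"
  assumes "M \<in> carrier_mat a b" "S \<in> carrier_mat a k" "T \<in> carrier_mat l b" "\<beta> \<in> carrier_mat a q"
  shows "mrank (four_block_mat M (append_cols \<beta> S) T (0\<^sub>m l (q + k)))
    \<le> mrank (append_cols (four_block_mat M S T (0\<^sub>m l k)) (\<beta> @\<^sub>r 0\<^sub>m l q))"
proof -
  define X where "X = append_cols (four_block_mat M S T (0\<^sub>m l k)) (\<beta> @\<^sub>r 0\<^sub>m l q)"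
  have X: "X \<in> carrier_mat (a + l) (b + k + q)"
    unfolding X_def using assms by (intro append_cols_carrier) auto
  \<comment> \<open>In \<open>X\<close> the columns of \<beta> stand last; in the cut matrix they
    directly follow those of \<open>M\<close>.\<close>
  define g where "g = (\<lambda>j. if j < b then j else if j < b + q then j + k else j - q)"
  have "four_block_mat M (append_cols \<beta> S) T (0\<^sub>m l (q + k)) =
      mat (a + l) (b + (q + k)) (\<lambda>(i, j). X $$ (i, g j))"
    using assms unfolding X_def g_def append_cols_def append_rows_def
    by (intro eq_matI) (auto simp: not_less add.commute[of q b])
  also have "mrank \<dots> \<le> mrank X"
    by (rule mrank_select_le[OF X]) (auto simp: g_def)
  finally show ?thesis unfolding X_def .
qed

text \<open>The counterpart for cuts that do not contain the new channel, which then contributes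
  rows.\<close>

lemma mrank_corner_rows:
  fixes M :: "'a::field mat"
  assumes "M \<in> carrier_mat a b" "S \<in> carrier_mat a k" "T \<in> carrier_mat l b" "\<gamma> \<in> carrier_mat r b"
  shows "mrank (four_block_mat M S (\<gamma> @\<^sub>r T) (0\<^sub>m (r + l) k))
    \<le> mrank (four_block_mat M S T (0\<^sub>m l k) @\<^sub>r append_cols \<gamma> (0\<^sub>m r k))"
proof -
  define X where "X = four_block_mat M S T (0\<^sub>m l k) @\<^sub>r append_cols \<gamma> (0\<^sub>m r k)"
  have X: "X \<in> carrier_mat (a + l + r) (b + k)"
    unfolding X_def using assms by (intro carrier_append_rows) auto
  define g where "g = (\<lambda>j. if j < a then j else if j < a + r then j + l else j - r)"
  have "four_block_mat M S (\<gamma> @\<^sub>r T) (0\<^sub>m (r + l) k) =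
      mat (a + (r + l)) (b + k) (\<lambda>(i, j). X $$ (g i, j))"
    using assms unfolding X_def g_def append_cols_def append_rows_def
    by (intro eq_matI) (auto simp: not_less add.commute[of r a])
  also have "mrank \<dots> \<le> mrank X"
    by (rule mrank_select_le[OF X]) (auto simp: g_def)
  finally show ?thesis unfolding X_def .
qed

text \<open>The gains are chosen one channel at a time; the gain of channel \<open>j\<close> has to serve all
  cuts of the remaining channels simultaneously.\<close>

lemma decentralized_gain_exists:
  fixes M :: "'a::field mat"
  assumes inf: "infinite (UNIV :: 'a set)" and fin: "finite I"
    and M: "M \<in> carrier_mat nr nc"
    and B: "\<And>i. i \<in> I \<Longrightarrow> B i \<in> carrier_mat nr (q i)"
    and C: "\<And>i. i \<in> I \<Longrightarrow> C i \<in> carrier_mat (r i) nc"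
    and cut: "\<And>V. V \<subseteq> I \<Longrightarrow> n \<le> mrank (cut_mat M B C I V)"
  shows "\<exists>K. (\<forall>i \<in> I. K i \<in> carrier_mat (q i) (r i)) \<and>
    n \<le> mrank (M + msum nr nc (\<lambda>i. B i * K i * C i) I)"
  using fin M B C cut
proof (induction I arbitrary: M rule: finite_linorder_min_induct)
  case empty
  have "cut_mat M B C {} {} = M"
    unfolding cut_mat_def by (intro eq_matI) auto
  moreover have "M + msum nr nc (\<lambda>i. B i * K i * C i) {} = M" for K
    using empty.prems(1) by (intro eq_matI) (auto simp: msum_def)
  ultimately show ?case using empty.prems(4)[of "{}"] by simp
next
  case (insert j I)
  have j: "j \<notin> I" using insert.hyps by blast
  have M: "M \<in> carrier_mat nr nc" by fact
  have Bj: "B j \<in> carrier_mat nr (q j)" and Cj: "C j \<in> carrier_mat (r j) nc"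
    using insert.prems by auto
  have B: "\<And>i. i \<in> I \<Longrightarrow> B i \<in> carrier_mat nr (q i)" and C: "\<And>i. i \<in> I \<Longrightarrow> C i \<in> carrier_mat (r i) nc"
    using insert.prems by auto
  define k where "k = (\<lambda>V. \<Sum>i\<in>V. dim_col (B i))"
  define l where "l = (\<lambda>V. \<Sum>i\<in>I - V. dim_row (C i))"
  define X where "X = (\<lambda>V. four_block_mat M (hcat_on nr B V) (vcat_on nc C (I - V)) (0\<^sub>m (l V) (k V)))"
  define b where "b = (\<lambda>V. B j @\<^sub>r 0\<^sub>m (l V) (q j))"
  define c where "c = (\<lambda>V. append_cols (C j) (0\<^sub>m (r j) (k V)))"
  have S: "hcat_on nr B V \<in> carrier_mat nr (k V)" if "V \<subseteq> I" for V
    unfolding k_def using that B insert.hyps(1) by (intro hcat_on_carrier) (auto dest: finite_subset)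
  have T: "vcat_on nc C (I - V) \<in> carrier_mat (l V) nc" for V
    unfolding l_def using C insert.hyps(1) by (intro vcat_on_carrier) auto
  have Xc: "X V \<in> carrier_mat (nr + l V) (nc + k V)" for V
    unfolding X_def using M by simp
  have bc: "b V \<in> carrier_mat (nr + l V) (q j)" for V
    unfolding b_def using Bj by simp
  have cc: "c V \<in> carrier_mat (r j) (nc + k V)" for V
    unfolding c_def using Cj by simp
  \<comment> \<open>For a fixed \<open>V\<close>, the cuts \<open>insert j V\<close> and
    \<open>V\<close> of the larger channel set supply the column and the row hypothesis of the
    one-channel result.\<close>
  have ex: "\<exists>K \<in> carrier_mat (q j) (r j). n \<le> mrank (X V + b V * K * c V)" if V: "V \<subseteq> I" for V
  proof -
    have finV: "finite V" using V insert.hyps(1) finite_subset by blast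
    have jV: "j \<notin> V" using V j by blast
    have "cut_mat M B C (insert j I) (insert j V) =
        four_block_mat M (append_cols (B j) (hcat_on nr B V)) (vcat_on nc C (I - V)) (0\<^sub>m (l V) (q j + k V))"
    proof -
      have "insert j I - insert j V = I - V" using j by blast
      moreover have "hcat_on nr B (insert j V) = append_cols (B j) (hcat_on nr B V)"
        using V insert.hyps(2) by (intro hcat_on_insert_min[OF finV]) blast
      ultimately show ?thesis
        unfolding cut_mat_def using M Bj finV jV by (simp add: l_def k_def)
    qed
    moreover have "n \<le> mrank (cut_mat M B C (insert j I) (insert j V))"
      using V by (intro insert.prems(4)) blast
    ultimately have 1: "n \<le> mrank (append_cols (X V) (b V))"
      using mrank_corner_cols[OF M S[OF V] T Bj, of V] by (simp add: X_def b_def)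
    have "cut_mat M B C (insert j I) V =
        four_block_mat M (hcat_on nr B V) (C j @\<^sub>r vcat_on nc C (I - V)) (0\<^sub>m (r j + l V) (k V))"
    proof -
      have eq: "insert j I - V = insert j (I - V)" using jV by blast
      moreover have "vcat_on nc C (insert j (I - V)) = C j @\<^sub>r vcat_on nc C (I - V)"
        using insert.hyps by (intro vcat_on_insert_min) auto
      ultimately show ?thesis
        unfolding cut_mat_def using M Cj j insert.hyps(1) by (simp add: l_def k_def)
    qed
    moreover have "n \<le> mrank (cut_mat M B C (insert j I) V)"
      using V by (intro insert.prems(4)) blast
    ultimately have 2: "n \<le> mrank (X V @\<^sub>r c V)"
      using mrank_corner_rows[OF M S[OF V] T Cj, of V] by (simp add: X_def c_def)
    from single_channel_rank[OF Xc bc cc 1 2] show ?thesis by blast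
  qed
  have "\<exists>K \<in> carrier_mat (q j) (r j). \<forall>V \<in> Pow I. n \<le> mrank (X V + b V * K * c V)"
    by (rule simultaneous_gain[OF inf _ Xc bc cc]) (use insert.hyps(1) ex in auto)
  then obtain Kj where
    Kj: "Kj \<in> carrier_mat (q j) (r j)" and all: "\<And>V. V \<subseteq> I \<Longrightarrow> n \<le> mrank (X V + b V * Kj * c V)"
    by blast
  \<comment> \<open>Closing the loop of channel j yields a system with channels \<open>I\<close>
    whose cut matrices are exactly the matrices controlled by \<open>Kj\<close>, so the induction
    hypothesis applies to it.\<close>
  define M' where "M' = M + B j * Kj * C j"
  have M': "M' \<in> carrier_mat nr nc" unfolding M'_def using M Bj Kj Cj by simp
  have "n \<le> mrank (cut_mat M' B C I V)" if V: "V \<subseteq> I" for V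
  proof -
    have "X V + b V * Kj * c V = cut_mat M' B C I V"
      using corner_gain[OF M S[OF V] T[of V] Bj Cj Kj] M'
      by (simp add: X_def b_def c_def cut_mat_def M'_def[symmetric] l_def k_def)
    with all[OF V] show ?thesis by simp
  qed
  from insert.IH[OF M' B C this] obtain K where K: "\<forall>i\<in>I. K i \<in> carrier_mat (q i) (r i)"
    and n: "n \<le> mrank (M' + msum nr nc (\<lambda>i. B i * K i * C i) I)" by blast
  define K' where "K' = K(j := Kj)"
  have "msum nr nc (\<lambda>i. B i * K' i * C i) (insert j I) = B j * Kj * C j + msum nr nc (\<lambda>i. B i * K' i * C i) I"
    using j insert.hyps(1) Bj Kj Cj by (subst msum_insert) (auto simp: K'_def)
  also have "msum nr nc (\<lambda>i. B i * K' i * C i) I = msum nr nc (\<lambda>i. B i * K i * C i) I"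
    using j by (intro msum_cong) (auto simp: K'_def)
  finally have "M + msum nr nc (\<lambda>i. B i * K' i * C i) (insert j I) = M' + msum nr nc (\<lambda>i. B i * K i * C i) I"
    using M Bj Kj Cj by (simp add: M'_def assoc_add_mat[of _ nr nc])
  then show ?case
    using K Kj n by (intro exI[of _ K']) (auto simp: K'_def)
qed

text \<open>The closed-loop matrix is the row (1, \<beta>) times the cut matrix times the column (1,
  \<kappa>): \<kappa> stacks K C over the channels in V, and \<beta> lines up B K over the others.
  The zero corner prevents a mixed term.\<close>

lemma cut_mat_rank_bound:
  fixes M :: "'a::field mat"
  assumes fin: "finite I" and V: "V \<subseteq> I" and M: "M \<in> carrier_mat nr nc"
    and B: "\<And>i. i \<in> I \<Longrightarrow> B i \<in> carrier_mat nr (q i)"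
    and C: "\<And>i. i \<in> I \<Longrightarrow> C i \<in> carrier_mat (r i) nc"
    and K: "\<And>i. i \<in> I \<Longrightarrow> K i \<in> carrier_mat (q i) (r i)"
  shows "mrank (M + msum nr nc (\<lambda>i. B i * K i * C i) I) \<le> mrank (cut_mat M B C I V)"
proof -
  have finV: "finite V" using fin V finite_subset by blast
  define k where "k = (\<Sum>i\<in>V. q i)"
  define l where "l = (\<Sum>i\<in>I - V. r i)"
  have S: "hcat_on nr B V \<in> carrier_mat nr k"
    unfolding k_def using B V finV by (intro hcat_on_carrier) auto
  have T: "vcat_on nc C (I - V) \<in> carrier_mat l nc"
    unfolding l_def using C fin by (intro vcat_on_carrier) auto
  have kl: "(\<Sum>i\<in>V. dim_col (B i)) = k" "(\<Sum>i\<in>I - V. dim_row (C i)) = l"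
    unfolding k_def l_def using B C V by (auto intro!: sum.cong)
  define \<kappa> where "\<kappa> = vcat_on nc (\<lambda>i. K i * C i) V"
  define \<beta> where "\<beta> = hcat_on nr (\<lambda>i. B i * K i) (I - V)"
  have \<kappa>: "\<kappa> \<in> carrier_mat k nc"
    unfolding \<kappa>_def k_def by (intro vcat_on_carrier finV mult_carrier_mat[OF K C]) (use V in auto)
  have \<beta>: "\<beta> \<in> carrier_mat nr l"
    unfolding \<beta>_def l_def by (intro hcat_on_carrier mult_carrier_mat[OF B K]) (use fin in auto)
  have X: "cut_mat M B C I V \<in> carrier_mat (nr + l) (nc + k)"
    unfolding cut_mat_def kl using M by simp
  have 1: "hcat_on nr B V * \<kappa> = msum nr nc (\<lambda>i. B i * K i * C i) V"
  proof -
    have "hcat_on nr B V * \<kappa> = msum nr nc (\<lambda>i. B i * (K i * C i)) V"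
      unfolding \<kappa>_def by (rule hcat_on_mult_vcat_on[OF finV, of _ _ q])
        (use V B mult_carrier_mat[OF K C] in auto)
    also have "\<dots> = msum nr nc (\<lambda>i. B i * K i * C i) V"
      using V by (intro msum_cong assoc_mult_mat[OF B K C, symmetric]) auto
    finally show ?thesis .
  qed
  have 2: "\<beta> * vcat_on nc C (I - V) = msum nr nc (\<lambda>i. B i * K i * C i) (I - V)"
    unfolding \<beta>_def by (rule hcat_on_mult_vcat_on[of _ _ _ r]) (use fin C mult_carrier_mat[OF B K] in auto)
  have "cut_mat M B C I V * (1\<^sub>m nc @\<^sub>r \<kappa>) =
      (M + hcat_on nr B V * \<kappa>) @\<^sub>r vcat_on nc C (I - V)"
  proof -
    have "cut_mat M B C I V * (1\<^sub>m nc @\<^sub>r \<kappa>) =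
      four_block_mat M (hcat_on nr B V) (vcat_on nc C (I - V)) (0\<^sub>m l k) *
      four_block_mat (1\<^sub>m nc) (0\<^sub>m nc 0) \<kappa> (0\<^sub>m k 0)"
      using M \<kappa> by (simp add: cut_mat_def kl append_rows_def)
    then show ?thesis
      using M S T \<kappa> by (subst (asm) mult_four_block_mat[of _ nr nc _ k _ l _ _ nc _ 0])
        (auto simp: append_rows_def)
  qed
  then have "append_cols (1\<^sub>m nr) \<beta> * (cut_mat M B C I V * (1\<^sub>m nc @\<^sub>r \<kappa>)) =
     1\<^sub>m nr * (M + hcat_on nr B V * \<kappa>) + \<beta> * vcat_on nc C (I - V)"
    using M S T \<kappa> \<beta> by (simp add: append_cols_mult_append_rows[of _ nr nr _ l _ nc])
  also have "\<dots> = M + msum nr nc (\<lambda>i. B i * K i * C i) I"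
    unfolding 1 2 using M fin V
    by (intro eq_matI) (auto simp: msum_def sum.subset_diff[OF V fin])
  finally have "M + msum nr nc (\<lambda>i. B i * K i * C i) I =
      append_cols (1\<^sub>m nr) \<beta> * cut_mat M B C I V * (1\<^sub>m nc @\<^sub>r \<kappa>)"
    using \<beta> \<kappa> X by (simp add: mat_assoc append_cols_def append_rows_def)
  then show ?thesis
    using mrank_mult_le[OF X append_cols_carrier[OF one_carrier_mat \<beta>] carrier_append_rows[OF one_carrier_mat \<kappa>]]
    by simp
qed

section \<open>Evaluation of polynomials\<close>

definition eval_monom :: "(nat \<Rightarrow> 'a::comm_semiring_1) \<Rightarrow> (nat \<Rightarrow>\<^sub>0 nat) \<Rightarrow> 'a" where
  "eval_monom f m = (\<Prod>x\<in>Poly_Mapping.keys m. f x ^ Poly_Mapping.lookup m x)"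

definition eval_mpoly :: "(nat \<Rightarrow> 'a::comm_semiring_1) \<Rightarrow> ((nat \<Rightarrow>\<^sub>0 nat) \<Rightarrow>\<^sub>0 'a) \<Rightarrow> 'a" where
  "eval_mpoly f p = (\<Sum>m\<in>Poly_Mapping.keys p. Poly_Mapping.lookup p m * eval_monom f m)"

text \<open>A common index set makes the products belonging to two monomials comparable;
  \<open>eval_mpoly_superset\<close> does the same for the sums of two polynomials.\<close>

lemma eval_monom_superset:
  assumes "finite S" "Poly_Mapping.keys m \<subseteq> S"
  shows "eval_monom f m = (\<Prod>x\<in>S. f x ^ Poly_Mapping.lookup m x)"
  unfolding eval_monom_def
  by (rule prod.mono_neutral_left) (use assms in \<open>auto simp: in_keys_iff\<close>)

lemma eval_monom_add: "eval_monom f (m + m') = eval_monom f m * eval_monom f m'"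
proof -
  let ?S = "Poly_Mapping.keys m \<union> Poly_Mapping.keys m'"
  have "Poly_Mapping.keys (m + m') \<subseteq> ?S" by (rule keys_add)
  then have "eval_monom f (m + m') = (\<Prod>x\<in>?S. f x ^ Poly_Mapping.lookup (m + m') x)"
    by (intro eval_monom_superset) auto
  also have "\<dots> = (\<Prod>x\<in>?S. f x ^ Poly_Mapping.lookup m x) * (\<Prod>x\<in>?S. f x ^ Poly_Mapping.lookup m' x)"
    by (simp add: lookup_add power_add prod.distrib)
  also have "\<dots> = eval_monom f m * eval_monom f m'"
    by (subst (1 2) eval_monom_superset[of ?S]) auto
  finally show ?thesis .
qed

lemma eval_mpoly_superset:
  assumes "finite S" "Poly_Mapping.keys p \<subseteq> S"
  shows "eval_mpoly f p = (\<Sum>m\<in>S. Poly_Mapping.lookup p m * eval_monom f m)"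
  unfolding eval_mpoly_def
  by (rule sum.mono_neutral_left) (use assms in \<open>auto simp: in_keys_iff\<close>)

lemma eval_mpoly_add: "eval_mpoly f (p + q) = eval_mpoly f p + eval_mpoly f q"
proof -
  let ?S = "Poly_Mapping.keys p \<union> Poly_Mapping.keys q"
  have "Poly_Mapping.keys (p + q) \<subseteq> ?S" by (rule keys_add)
  then have "eval_mpoly f (p + q) = (\<Sum>m\<in>?S. Poly_Mapping.lookup (p + q) m * eval_monom f m)"
    by (intro eval_mpoly_superset) auto
  also have "\<dots> = (\<Sum>m\<in>?S. Poly_Mapping.lookup p m * eval_monom f m) + (\<Sum>m\<in>?S. Poly_Mapping.lookup q m * eval_monom f m)"
    by (simp add: lookup_add algebra_simps sum.distrib)
  also have "\<dots> = eval_mpoly f p + eval_mpoly f q"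
    by (subst (1 2) eval_mpoly_superset[of ?S]) auto
  finally show ?thesis .
qed

lemma eval_mpoly_0 [simp]: "eval_mpoly f 0 = 0"
  by (simp add: eval_mpoly_def)

lemma eval_mpoly_sum: "eval_mpoly f (sum g A) = (\<Sum>a\<in>A. eval_mpoly f (g a))"
  by (induction A rule: infinite_finite_induct) (auto simp: eval_mpoly_add)

lemma eval_mpoly_single [simp]: "eval_mpoly f (Poly_Mapping.single m c) = c * eval_monom f m"
  by (subst eval_mpoly_superset[of "{m}"]) auto

lemma mpoly_sum_single:
  fixes p :: "'a \<Rightarrow>\<^sub>0 'b::comm_monoid_add"
  shows "(\<Sum>m\<in>Poly_Mapping.keys p. Poly_Mapping.single m (Poly_Mapping.lookup p m)) = p"
proof (rule poly_mapping_eqI)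
  fix k
  have "Poly_Mapping.lookup (\<Sum>m\<in>Poly_Mapping.keys p. Poly_Mapping.single m (Poly_Mapping.lookup p m)) k
      = (\<Sum>m\<in>Poly_Mapping.keys p. if m = k then Poly_Mapping.lookup p m else 0)"
    by (simp add: lookup_sum lookup_single when_def)
  also have "\<dots> = Poly_Mapping.lookup p k" by (simp add: in_keys_iff)
  finally show "Poly_Mapping.lookup (\<Sum>m\<in>Poly_Mapping.keys p. Poly_Mapping.single m (Poly_Mapping.lookup p m)) k = Poly_Mapping.lookup p k" .
qed

text \<open>Writing both factors as sums of monomials reduces the claim to
  \<open>eval_monom_add\<close>.\<close>

lemma eval_mpoly_mult:
  fixes p q :: "(nat \<Rightarrow>\<^sub>0 nat) \<Rightarrow>\<^sub>0 'a::comm_semiring_1"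
  shows "eval_mpoly f (p * q) = eval_mpoly f p * eval_mpoly f q"
proof -
  have "p * q = (\<Sum>m\<in>Poly_Mapping.keys p. Poly_Mapping.single m (Poly_Mapping.lookup p m)) *
      (\<Sum>m\<in>Poly_Mapping.keys q. Poly_Mapping.single m (Poly_Mapping.lookup q m))"
    by (simp add: mpoly_sum_single)
  also have "\<dots> = (\<Sum>m\<in>Poly_Mapping.keys p. \<Sum>m'\<in>Poly_Mapping.keys q. Poly_Mapping.single (m + m') (Poly_Mapping.lookup p m * Poly_Mapping.lookup q m'))"
    by (simp add: sum_product mult_single)
  finally have "eval_mpoly f (p * q) = (\<Sum>m\<in>Poly_Mapping.keys p. \<Sum>m'\<in>Poly_Mapping.keys q.
      (Poly_Mapping.lookup p m * eval_monom f m) * (Poly_Mapping.lookup q m' * eval_monom f m'))"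
    by (simp add: eval_mpoly_sum eval_monom_add mult_ac)
  then show ?thesis by (simp add: eval_mpoly_def sum_product)
qed

lemma comm_ring_hom_eval_mpoly:
  "comm_ring_hom (eval_mpoly f :: _ \<Rightarrow> 'a::comm_ring_1)"
proof unfold_locales
  have "eval_mpoly f (Poly_Mapping.single 0 1) = 1"
    by (subst eval_mpoly_single) (simp add: eval_monom_def)
  then show "eval_mpoly f 1 = 1" by simp
qed (auto simp: eval_mpoly_add eval_mpoly_mult)

section \<open>Rank under field extensions\<close>

definition poly_rf :: "((nat \<Rightarrow>\<^sub>0 nat) \<Rightarrow>\<^sub>0 complex) \<Rightarrow> ratfun" where
  "poly_rf p = Fraction_Field.Fract p 1"

lemma comm_ring_hom_poly_rf: "comm_ring_hom poly_rf"
  by unfold_locales (auto simp: poly_rf_def One_fract_def Zero_fract_def)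

lemma poly_rf_eq_0_iff [simp]: "poly_rf p = 0 \<longleftrightarrow> p = 0"
  by (simp add: poly_rf_def Zero_fract_def eq_fract)

lemma const_rf_poly_rf: "const_rf c = poly_rf (Poly_Mapping.single 0 c)"
  by (simp add: const_rf_def poly_rf_def)

lemma comm_ring_hom_single_0:
  "comm_ring_hom (Poly_Mapping.single 0 :: 'a::comm_ring_1 \<Rightarrow> ('b::comm_monoid_add \<Rightarrow>\<^sub>0 'a))"
  by unfold_locales (auto simp: single_add mult_single)

lemma comm_ring_hom_const_rf: "comm_ring_hom const_rf"
proof -
  interpret s: comm_ring_hom "Poly_Mapping.single 0 :: complex \<Rightarrow> ((nat \<Rightarrow>\<^sub>0 nat) \<Rightarrow>\<^sub>0 complex)"
    by (rule comm_ring_hom_single_0)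
  interpret p: comm_ring_hom poly_rf by (rule comm_ring_hom_poly_rf)
  show ?thesis
    by unfold_locales (auto simp: const_rf_poly_rf s.hom_add s.hom_mult p.hom_add p.hom_mult)
qed

text \<open>Both the certificate and the factorisation from \<open>rank_factorization\<close> are
  matrix equations, so their images bound the rank from below and from above by the same
  number.\<close>

lemma mrank_map_mat:
  fixes h :: "'a::field \<Rightarrow> 'b::field"
  assumes "comm_ring_hom h"
  shows "mrank (map_mat h X) = mrank X"
proof -
  interpret comm_ring_hom h by fact
  define nr where "nr = dim_row X"
  define nc where "nc = dim_col X"
  have X: "X \<in> carrier_mat nr nc" by (rule carrier_matI) (simp_all add: nr_def nc_def)
  define k where "k = mrank X"
  obtain P Q where P: "P \<in> carrier_mat k nr" and Q: "Q \<in> carrier_mat nc k"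
    and PXQ: "P * X * Q = 1\<^sub>m k" and fact: "X = X * Q * (P * X)"
    unfolding k_def by (rule rank_factorization[OF X])
  have "map_mat h P * map_mat h X * map_mat h Q = map_mat h (P * X * Q)"
    unfolding mat_hom_mult[OF mult_carrier_mat[OF P X] Q] mat_hom_mult[OF P X] ..
  also have "\<dots> = 1\<^sub>m k" unfolding PXQ by (rule mat_hom_one)
  finally have 1: "map_mat h P * map_mat h X * map_mat h Q = 1\<^sub>m k" .
  have "k \<le> mrank (map_mat h X)"
    by (rule mrank_geI[OF _ _ _ 1]) (use P Q X in simp_all)
  moreover have "mrank (map_mat h X) \<le> k"
  proof -
    have "map_mat h X = map_mat h (X * Q * (P * X))" using fact by (rule arg_cong)
    also have "\<dots> = map_mat h (X * Q) * map_mat h (P * X)"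
      by (rule mat_hom_mult[OF mult_carrier_mat[OF X Q] mult_carrier_mat[OF P X]])
    finally have "mrank (map_mat h X) = mrank (map_mat h (X * Q) * map_mat h (P * X))"
      by (rule arg_cong)
    also have "\<dots> \<le> k"
      by (rule mrank_leI) (use mult_carrier_mat[OF X Q] mult_carrier_mat[OF P X] in simp_all)
    finally show ?thesis .
  qed
  ultimately show ?thesis unfolding k_def by (rule antisym[rotated])
qed

lemma map_mat_append_cols:
  assumes "M \<in> carrier_mat nr a" "N \<in> carrier_mat nr b" "h 0 = 0"
  shows "map_mat h (append_cols M N) = append_cols (map_mat h M) (map_mat h N)"
  using assms unfolding append_cols_def by (intro eq_matI) auto

lemma map_mat_append_rows:
  assumes "M \<in> carrier_mat a nc" "N \<in> carrier_mat b nc" "h 0 = 0"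
  shows "map_mat h (M @\<^sub>r N) = map_mat h M @\<^sub>r map_mat h N"
  using assms unfolding append_rows_def by (intro eq_matI) auto

lemma map_mat_hcat_on:
  assumes "finite V" "h 0 = 0" "\<And>i. i \<in> V \<Longrightarrow> F i \<in> carrier_mat nr (q i)"
  shows "map_mat h (hcat_on nr F V) = hcat_on nr (\<lambda>i. map_mat h (F i)) V"
  using assms(1,3)
proof (induction V rule: finite_linorder_min_induct)
  case (insert j V)
  have "hcat_on nr F V \<in> carrier_mat nr (\<Sum>i\<in>V. q i)"
    using insert by (intro hcat_on_carrier) auto
  then show ?case
    using insert map_mat_append_cols[of "F j" nr "q j" "hcat_on nr F V" _ h] assms(2)
    by (simp add: hcat_on_insert_min)
qed auto

lemma map_mat_vcat_on:
  assumes "finite V" "h 0 = 0" "\<And>i. i \<in> V \<Longrightarrow> F i \<in> carrier_mat (r i) nc"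
  shows "map_mat h (vcat_on nc F V) = vcat_on nc (\<lambda>i. map_mat h (F i)) V"
  using assms(1,3)
proof (induction V rule: finite_linorder_min_induct)
  case (insert j V)
  have "vcat_on nc F V \<in> carrier_mat (\<Sum>i\<in>V. r i) nc"
    using insert by (intro vcat_on_carrier) auto
  then show ?case
    using insert map_mat_append_rows[of "F j" "r j" nc "vcat_on nc F V" _ h] assms(2)
    by (simp add: vcat_on_insert_min)
qed auto

lemma (in comm_ring_hom) map_mat_msum:
  assumes "\<And>i. i \<in> I \<Longrightarrow> F i \<in> carrier_mat nr nc"
  shows "map_mat hom (msum nr nc F I) = msum nr nc (\<lambda>i. map_mat hom (F i)) I"
proof (rule eq_matI)
  fix a b assume "a < dim_row (msum nr nc (\<lambda>i. map_mat hom (F i)) I)"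
    "b < dim_col (msum nr nc (\<lambda>i. map_mat hom (F i)) I)"
  then have ab: "a < nr" "b < nc" by (auto simp: msum_def)
  have "map_mat hom (F i) $$ (a, b) = hom (F i $$ (a, b))" if "i \<in> I" for i
    using assms[OF that] ab by simp
  then show "map_mat hom (msum nr nc F I) $$ (a, b) = msum nr nc (\<lambda>i. map_mat hom (F i)) I $$ (a, b)"
    using ab by (simp add: msum_def hom_sum)
qed (auto simp: msum_def)

lemma (in comm_ring_hom) map_mat_gain_sum:
  assumes M: "M \<in> carrier_mat nr nc"
    and B: "\<And>i. i \<in> I \<Longrightarrow> B i \<in> carrier_mat nr (q i)"
    and C: "\<And>i. i \<in> I \<Longrightarrow> C i \<in> carrier_mat (r i) nc"
    and K: "\<And>i. i \<in> I \<Longrightarrow> K i \<in> carrier_mat (q i) (r i)"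
  shows "map_mat hom (M + msum nr nc (\<lambda>i. B i * K i * C i) I) =
    map_mat hom M + msum nr nc (\<lambda>i. map_mat hom (B i) * map_mat hom (K i) * map_mat hom (C i)) I"
proof -
  have "map_mat hom (B i * K i * C i) = map_mat hom (B i) * map_mat hom (K i) * map_mat hom (C i)"
    if "i \<in> I" for i
    by (simp only: mat_hom_mult[OF mult_carrier_mat[OF B K] C] mat_hom_mult[OF B K] that)
  moreover have "B i * K i * C i \<in> carrier_mat nr nc" if "i \<in> I" for i
    by (rule mult_carrier_mat[OF mult_carrier_mat[OF B[OF that] K[OF that]] C[OF that]])
  ultimately have "map_mat hom (msum nr nc (\<lambda>i. B i * K i * C i) I) =
    msum nr nc (\<lambda>i. map_mat hom (B i) * map_mat hom (K i) * map_mat hom (C i)) I"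
    by (subst map_mat_msum) (auto intro: msum_cong)
  moreover have "map_mat hom (M + msum nr nc F I) = map_mat hom M + map_mat hom (msum nr nc F I)" for F
    using M by (intro eq_matI) (auto simp: msum_def hom_add)
  ultimately show ?thesis by simp
qed

text \<open>Over the rational functions a determinant is the image of a polynomial, hence non-zero as
  soon as it does not vanish for one particular choice of the gains.\<close>

lemma generic_det_nonzero:
  fixes M :: "complex mat"
  assumes M: "M \<in> carrier_mat n n"
    and B: "\<And>i. i \<in> I \<Longrightarrow> B i \<in> carrier_mat n (q i)"
    and C: "\<And>i. i \<in> I \<Longrightarrow> C i \<in> carrier_mat (r i) n"
    and K: "\<And>i. i \<in> I \<Longrightarrow> K i \<in> carrier_mat (q i) (r i)"
    and det: "det (M + msum n n (\<lambda>i. B i * K i * C i) I) \<noteq> 0"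
  shows "det (lift_rf M + msum n n (\<lambda>i. lift_rf (B i) * gain_mat i (q i) (r i) * lift_rf (C i)) I) \<noteq> 0"
proof -
  define G :: "nat \<Rightarrow> ((nat \<Rightarrow>\<^sub>0 nat) \<Rightarrow>\<^sub>0 complex) mat" where "G = (\<lambda>i. mat (q i) (r i) (\<lambda>(a, b).
    Poly_Mapping.single (Poly_Mapping.single (prod_encode (i, prod_encode (a, b))) 1) 1))"
  \<comment> \<open>Inverts the numbering of the indeterminates: the variable of channel i at
    position (a, b) receives the entry of \<open>K i\<close> there.\<close>
  define f where "f = (\<lambda>x. case prod_decode x of (i, y) \<Rightarrow> K i $$ prod_decode y)"
  let ?s = "map_mat (Poly_Mapping.single 0 :: complex \<Rightarrow> ((nat \<Rightarrow>\<^sub>0 nat) \<Rightarrow>\<^sub>0 complex))"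
  \<comment> \<open>A matrix over the polynomial ring above both others: evaluation at
    \<open>f\<close> maps it to the complex matrix, and \<open>poly_rf\<close> maps it to the one
    over the rational functions.\<close>
  define X where "X = ?s M + msum n n (\<lambda>i. ?s (B i) * G i * ?s (C i)) I"
  interpret e: comm_ring_hom "eval_mpoly f" by (rule comm_ring_hom_eval_mpoly)
  interpret p: comm_ring_hom poly_rf by (rule comm_ring_hom_poly_rf)
  have [simp]: "eval_monom f 0 = 1" for f :: "nat \<Rightarrow> complex" by (simp add: eval_monom_def)
  have es: "map_mat (eval_mpoly f) (?s Y) = Y" for Y
    by (intro eq_matI) auto
  have ps: "map_mat poly_rf (?s Y) = lift_rf Y" for Y
    by (intro eq_matI) (auto simp: const_rf_poly_rf)
  have eG: "map_mat (eval_mpoly f) (G i) = K i" if "i \<in> I" for i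
    using K[OF that] by (intro eq_matI) (auto simp: G_def f_def eval_monom_def)
  have pG: "map_mat poly_rf (G i) = gain_mat i (q i) (r i)" for i
    by (intro eq_matI) (auto simp: G_def gain_mat_def gain_var_def poly_rf_def)
  have sM: "?s M \<in> carrier_mat n n" using M by simp
  have sB: "?s (B i) \<in> carrier_mat n (q i)" and sC: "?s (C i) \<in> carrier_mat (r i) n" if "i \<in> I" for i
    using B C that by auto
  have sG: "G i \<in> carrier_mat (q i) (r i)" for i by (simp add: G_def)
  have "map_mat (eval_mpoly f) X = M + msum n n (\<lambda>i. B i * K i * C i) I"
    using e.map_mat_gain_sum[where B = "\<lambda>i. ?s (B i)" and C = "\<lambda>i. ?s (C i)" and K = G and q = q and r = r and I = I, OF sM sB sC sG] eG
    unfolding X_def es by (simp cong: msum_cong)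
  then have "eval_mpoly f (det X) \<noteq> 0" using det e.hom_det[of X] by simp
  then have "det X \<noteq> 0" by auto
  moreover have "map_mat poly_rf X = lift_rf M + msum n n (\<lambda>i. lift_rf (B i) * gain_mat i (q i) (r i) * lift_rf (C i)) I"
    using p.map_mat_gain_sum[where B = "\<lambda>i. ?s (B i)" and C = "\<lambda>i. ?s (C i)" and K = G and q = q and r = r and I = I, OF sM sB sC sG]
    unfolding X_def ps pG by simp
  ultimately show ?thesis using p.hom_det[of X] by simp
qed

lemma lift_cut_mat:
  assumes "finite I" "V \<subseteq> I" and M: "M \<in> carrier_mat nr nc"
    and B: "\<And>i. i \<in> I \<Longrightarrow> B i \<in> carrier_mat nr (q i)"
    and C: "\<And>i. i \<in> I \<Longrightarrow> C i \<in> carrier_mat (r i) nc"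
  shows "lift_rf (cut_mat M B C I V) = cut_mat (lift_rf M) (\<lambda>i. lift_rf (B i)) (\<lambda>i. lift_rf (C i)) I V"
proof -
  interpret comm_ring_hom const_rf by (rule comm_ring_hom_const_rf)
  have fin: "finite V" "finite (I - V)" using assms(1,2) finite_subset by auto
  have B': "B i \<in> carrier_mat nr (q i)" if "i \<in> V" for i using B that assms(2) by auto
  have C': "C i \<in> carrier_mat (r i) nc" if "i \<in> I - V" for i using C that by auto
  define k where "k = (\<Sum>i\<in>V. dim_col (B i))"
  define l where "l = (\<Sum>i\<in>I - V. dim_row (C i))"
  have kl: "k = (\<Sum>i\<in>V. q i)" "l = (\<Sum>i\<in>I - V. r i)"
    unfolding k_def l_def by (rule sum.cong, simp, use B' C' in blast)+
  have "lift_rf (cut_mat M B C I V) = four_block_mat (lift_rf M) (lift_rf (hcat_on nr B V))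
      (lift_rf (vcat_on nc C (I - V))) (lift_rf (0\<^sub>m l k))"
    unfolding cut_mat_def carrier_matD[OF M] k_def[symmetric] l_def[symmetric]
    using hcat_on_carrier[OF fin(1) B'] vcat_on_carrier[OF fin(2) C'] M
    by (intro map_four_block_mat[of _ nr nc _ k _ l]) (auto simp: kl)
  also have "lift_rf (0\<^sub>m l k) = 0\<^sub>m l k" by (intro eq_matI) auto
  finally show ?thesis
    using M map_mat_hcat_on[of V const_rf, OF fin(1) hom_zero B'] map_mat_vcat_on[of "I - V" const_rf, OF fin(2) hom_zero C']
    by (simp add: cut_mat_def k_def l_def)
qed

text \<open>Proved as a cycle. Complex gains with non-zero determinant give full generic rank; the
  generic gains factor through each lifted cut matrix, whose rank does not change under lifting; and
  large cut ranks give complex gains, since the complex field is infinite.\<close>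

theorem generic_rank_iff_cuts:
  fixes M :: "complex mat"
  assumes fin: "finite I" and M: "M \<in> carrier_mat n n"
    and B: "\<And>i. i \<in> I \<Longrightarrow> B i \<in> carrier_mat n (q i)"
    and C: "\<And>i. i \<in> I \<Longrightarrow> C i \<in> carrier_mat (r i) n"
  defines "X \<equiv> lift_rf M + msum n n (\<lambda>i. lift_rf (B i) * gain_mat i (q i) (r i) * lift_rf (C i)) I"
  shows "(\<exists>K. (\<forall>i\<in>I. K i \<in> carrier_mat (q i) (r i)) \<and> det (M + msum n n (\<lambda>i. B i * K i * C i) I) \<noteq> 0)
      \<longleftrightarrow> n \<le> mrank X" (is "?ex \<longleftrightarrow> _")
    and "n \<le> mrank X \<longleftrightarrow> (\<forall>V \<subseteq> I. n \<le> mrank (cut_mat M B C I V))" (is "_ \<longleftrightarrow> ?cut")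
proof -
  have X: "X \<in> carrier_mat n n" using M by (simp add: X_def)
  have 1: "n \<le> mrank X" if ex: ?ex
  proof -
    obtain K where K: "\<forall>i\<in>I. K i \<in> carrier_mat (q i) (r i)"
      and det: "det (M + msum n n (\<lambda>i. B i * K i * C i) I) \<noteq> 0"
      using ex by (elim exE conjE)
    have "det X \<noteq> 0"
      unfolding X_def by (rule generic_det_nonzero[OF M B C bspec[OF K] det])
    then show ?thesis unfolding mrank_full_iff_det[OF X] .
  qed
  have 2: ?cut if n: "n \<le> mrank X"
  proof (intro allI impI)
    fix V assume V: "V \<subseteq> I"
    have lB: "lift_rf (B i) \<in> carrier_mat n (q i)" and lC: "lift_rf (C i) \<in> carrier_mat (r i) n"
      if "i \<in> I" for i using B[OF that] C[OF that] by simp_all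
    have lK: "gain_mat i (q i) (r i) \<in> carrier_mat (q i) (r i)" for i by (simp add: gain_mat_def)
    have "lift_rf M \<in> carrier_mat n n" using M by simp
    note n
    also have "mrank X \<le> mrank (cut_mat (lift_rf M) (\<lambda>i. lift_rf (B i)) (\<lambda>i. lift_rf (C i)) I V)"
      unfolding X_def
      by (rule cut_mat_rank_bound[where B = "\<lambda>i. lift_rf (B i)" and C = "\<lambda>i. lift_rf (C i)" and q = q and r = r
            and K = "\<lambda>i. gain_mat i (q i) (r i)", OF fin V \<open>lift_rf M \<in> _\<close> lB lC lK])
    also have "cut_mat (lift_rf M) (\<lambda>i. lift_rf (B i)) (\<lambda>i. lift_rf (C i)) I V = lift_rf (cut_mat M B C I V)"
      by (rule sym, rule lift_cut_mat[OF fin V M B C])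
    also have "mrank \<dots> = mrank (cut_mat M B C I V)"
      by (rule mrank_map_mat[OF comm_ring_hom_const_rf])
    finally show "n \<le> mrank (cut_mat M B C I V)" .
  qed
  have 3: ?ex if ?cut
  proof -
    have "infinite (UNIV :: complex set)" by (rule infinite_UNIV_char_0)
    then have "\<exists>K. (\<forall>i \<in> I. K i \<in> carrier_mat (q i) (r i)) \<and>
        n \<le> mrank (M + msum n n (\<lambda>i. B i * K i * C i) I)"
      by (rule decentralized_gain_exists[OF _ fin M B C]) (use that in blast)+
    then obtain K where K: "\<forall>i\<in>I. K i \<in> carrier_mat (q i) (r i)"
      and n: "n \<le> mrank (M + msum n n (\<lambda>i. B i * K i * C i) I)"
      by (elim exE conjE)
    have "M + msum n n (\<lambda>i. B i * K i * C i) I \<in> carrier_mat n n"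
      using M by simp
    from n[unfolded mrank_full_iff_det[OF this]] K show ?thesis
      by (intro exI[of _ K] conjI)
  qed
  show "?ex \<longleftrightarrow> n \<le> mrank X" using 1 2 3 by iprover
  show "n \<le> mrank X \<longleftrightarrow> ?cut" using 1 2 3 by iprover
qed

section \<open>Moving rows and columns to the end\<close>

text \<open>Moves \<open>S\<close> to the end rather than to the front, so that the invertible block
  becomes the upper left pivot of the Schur complement. \<open>pick\<close> keeps both parts in
  increasing order, as \<open>submatrix\<close> does.\<close>

definition perm_idx :: "nat \<Rightarrow> nat set \<Rightarrow> nat \<Rightarrow> nat" where
  "perm_idx m S i = (if i < m - card S then pick (- S) i else pick S (i - (m - card S)))"

text \<open>These cardinalities are the dimensions in the definition of \<open>submatrix\<close>;
  the last form is what the simplifier makes of the second.\<close>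

lemma card_idx:
  assumes "S \<subseteq> {..<m}"
  shows "card {i. i < m \<and> i \<in> S} = card S" "card {i. i < m \<and> i \<in> - S} = m - card S"
    "card {i. i < m \<and> i \<notin> S} = m - card S"
proof -
  have fin: "finite S" using assms finite_subset by blast
  have "{i. i < m \<and> i \<in> S} = S" using assms by auto
  then show "card {i. i < m \<and> i \<in> S} = card S" by simp
  have "{i. i < m \<and> i \<in> - S} = {..<m} - S" by auto
  then show 1: "card {i. i < m \<and> i \<in> - S} = m - card S"
    using card_Diff_subset[OF fin assms] by simp
  then show "card {i. i < m \<and> i \<notin> S} = m - card S" by simp
qed

lemma card_idx_le: "S \<subseteq> {..<m} \<Longrightarrow> card S \<le> m" for m :: nat
  using card_mono[of "{..<m}" S] by simp

lemma inj_on_pick: "(\<And>n. n \<in> A \<Longrightarrow> n < card S \<or> infinite S) \<Longrightarrow> inj_on (pick S) A"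
proof (rule inj_onI)
  fix x y assume A: "\<And>n. n \<in> A \<Longrightarrow> n < card S \<or> infinite S"
    and xy: "x \<in> A" "y \<in> A" "pick S x = pick S y"
  show "x = y"
  proof (rule ccontr)
    assume "x \<noteq> y"
    then consider "x < y" | "y < x" by linarith
    then show False
      using pick_mono[OF A[OF xy(2)], of x] pick_mono[OF A[OF xy(1)], of y] xy(3) by cases auto
  qed
qed

text \<open>\<open>pick\<close> is strictly increasing, and the two ranges of positions are sent
  into the disjoint sets \<open>- S\<close> and \<open>S\<close>; an injective self-map of a finite
  set is onto.\<close>

lemma perm_idx_bij:
  assumes S: "S \<subseteq> {..<m}"
  shows "bij_betw (perm_idx m S) {..<m} {..<m}"
proof -
  have fin: "finite S" using S finite_subset by blast
  then have inf: "infinite (- S)" by (metis finite_compl infinite_UNIV_nat)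
  have le: "card S \<le> m" using card_idx_le[OF S] .
  have in1: "pick (- S) i \<in> - S" for i by (rule pick_in_set_inf[OF inf])
  have in2: "pick S (i - (m - card S)) \<in> S" if "i < m" "\<not> i < m - card S" for i
    using that le by (intro pick_in_set_le) auto
  have "perm_idx m S i < m" if "i < m" for i
  proof (cases "i < m - card S")
    case True
    then show ?thesis using pick_le[of i m "- S"] card_idx(2)[OF S] by (simp add: perm_idx_def)
  next
    case False
    then show ?thesis using in2[OF that False] S by (auto simp: perm_idx_def)
  qed
  then have sub: "perm_idx m S ` {..<m} \<subseteq> {..<m}" by auto
  have "inj_on (perm_idx m S) {..<m}"
  proof (rule inj_onI)
    fix x y assume x: "x \<in> {..<m}" and y: "y \<in> {..<m}" and eq: "perm_idx m S x = perm_idx m S y"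
    have inj1: "inj_on (pick (- S)) UNIV" by (rule inj_on_pick) (use inf in blast)
    have inj2: "inj_on (pick S) {..<card S}" by (rule inj_on_pick) simp
    show "x = y"
    proof (cases "x < m - card S")
      case xs: True
      show ?thesis
      proof (cases "y < m - card S")
        case True
        then have "pick (- S) x = pick (- S) y" using eq xs by (simp add: perm_idx_def)
        then show ?thesis by (rule inj_onD[OF inj1]) simp_all
      next
        case False
        then have "pick (- S) x = pick S (y - (m - card S))" using eq xs by (simp add: perm_idx_def)
        then show ?thesis using in1[of x] in2[of y] y False by simp
      qed
    next
      case xs: False
      show ?thesis
      proof (cases "y < m - card S")
        case True
        then have "pick (- S) y = pick S (x - (m - card S))" using eq xs by (simp add: perm_idx_def)
        then show ?thesis using in1[of y] in2[of x] x xs by simp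
      next
        case False
        then have "pick S (x - (m - card S)) = pick S (y - (m - card S))"
          using eq xs by (simp add: perm_idx_def)
        then have "x - (m - card S) = y - (m - card S)"
          by (rule inj_onD[OF inj2]) (use x y xs False le in auto)
        then show ?thesis using False xs by simp
      qed
    qed
  qed
  then show ?thesis
    using endo_inj_surj[OF _ sub] by (auto simp: bij_betw_def)
qed

lemma perm_idx_less: "S \<subseteq> {..<m} \<Longrightarrow> i < m \<Longrightarrow> perm_idx m S i < m"
  using bij_betwE[OF perm_idx_bij] by auto

lemma mrank_permute:
  fixes X :: "'a::field mat"
  assumes X: "X \<in> carrier_mat m m"
    and f: "bij_betw f {..<m} {..<m}" and g: "bij_betw g {..<m} {..<m}"
  shows "mrank (mat m m (\<lambda>(i, j). X $$ (f i, g j))) = mrank X"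
proof (rule antisym)
  let ?Y = "mat m m (\<lambda>(i, j). X $$ (f i, g j))"
  show "mrank ?Y \<le> mrank X"
    using bij_betwE[OF f] bij_betwE[OF g] by (intro mrank_select_le[OF X]) auto
  define f' where "f' = the_inv_into {..<m} f"
  define g' where "g' = the_inv_into {..<m} g"
  have f': "f' i < m" "f (f' i) = i" if "i < m" for i
    using bij_betwE[OF bij_betw_the_inv_into[OF f]] f_the_inv_into_f_bij_betw[OF f] that
    by (auto simp: f'_def)
  have g': "g' i < m" "g (g' i) = i" if "i < m" for i
    using bij_betwE[OF bij_betw_the_inv_into[OF g]] f_the_inv_into_f_bij_betw[OF g] that
    by (auto simp: g'_def)
  have "X = mat m m (\<lambda>(i, j). ?Y $$ (f' i, g' j))"
    using X f' g' by (intro eq_matI) auto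
  then have "mrank X = mrank (mat m m (\<lambda>(i, j). ?Y $$ (f' i, g' j)))" by (rule arg_cong)
  also have "\<dots> \<le> mrank ?Y"
    by (rule mrank_select_le[of _ m m]) (use f' g' in auto)
  finally show "mrank X \<le> mrank ?Y" .
qed

lemma select_mult:
  fixes X :: "'a::semiring_0 mat"
  assumes "X \<in> carrier_mat nr q" "Y \<in> carrier_mat q nc"
    "\<And>i. i < a \<Longrightarrow> f i < nr" "\<And>j. j < b \<Longrightarrow> g j < nc"
  shows "mat a q (\<lambda>(i, j). X $$ (f i, j)) * mat q b (\<lambda>(i, j). Y $$ (i, g j))
    = mat a b (\<lambda>(i, j). (X * Y) $$ (f i, g j))"
  using assms by (intro eq_matI) (auto simp: scalar_prod_def)

text \<open>Reordering rows acts on the B factors and reordering columns on the C factors, so the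
  gains remain the same and no conjugation occurs.\<close>

lemma select_gain_sum:
  fixes M :: "'a::semiring_0 mat"
  assumes M: "M \<in> carrier_mat m m"
    and B: "\<And>i. i \<in> I \<Longrightarrow> B i \<in> carrier_mat m (q i)"
    and C: "\<And>i. i \<in> I \<Longrightarrow> C i \<in> carrier_mat (r i) m"
    and K: "\<And>i. i \<in> I \<Longrightarrow> K i \<in> carrier_mat (q i) (r i)"
    and f: "\<And>i. i < m \<Longrightarrow> f i < m" and g: "\<And>i. i < m \<Longrightarrow> g i < m"
  shows "mat m m (\<lambda>(a, b). (M + msum m m (\<lambda>i. B i * K i * C i) I) $$ (f a, g b))
    = mat m m (\<lambda>(a, b). M $$ (f a, g b)) +
      msum m m (\<lambda>i. mat m (q i) (\<lambda>(a, b). B i $$ (f a, b)) * K i * mat (r i) m (\<lambda>(a, b). C i $$ (a, g b))) I"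
proof -
  have "mat m (q i) (\<lambda>(a, b). B i $$ (f a, b)) * K i * mat (r i) m (\<lambda>(a, b). C i $$ (a, g b))
      = mat m m (\<lambda>(a, b). (B i * K i * C i) $$ (f a, g b))" if i: "i \<in> I" for i
  proof -
    have "K i = mat (q i) (r i) (\<lambda>(a, b). K i $$ (a, b))" using K[OF i] by (intro eq_matI) auto
    then have "mat m (q i) (\<lambda>(a, b). B i $$ (f a, b)) * K i = 
        mat m (q i) (\<lambda>(a, b). B i $$ (f a, b)) * mat (q i) (r i) (\<lambda>(a, b). K i $$ (a, b))"
      by (rule arg_cong)
    also have "\<dots> = mat m (r i) (\<lambda>(a, b). (B i * K i) $$ (f a, b))"
      by (rule select_mult[OF B[OF i] K[OF i] f])
    finally show ?thesis
      using select_mult[OF mult_carrier_mat[OF B[OF i] K[OF i]] C[OF i] f g] by simp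
  qed
  then have "msum m m (\<lambda>i. mat m (q i) (\<lambda>(a, b). B i $$ (f a, b)) * K i * mat (r i) m (\<lambda>(a, b). C i $$ (a, g b))) I
      = msum m m (\<lambda>i. mat m m (\<lambda>(a, b). (B i * K i * C i) $$ (f a, g b))) I"
    by (rule msum_cong)
  then show ?thesis
    using M f g by (intro eq_matI) (auto simp: msum_def)
qed

lemma permuted_four_block:
  assumes X: "X \<in> carrier_mat m m" and L: "L \<subseteq> {..<m}" and R: "R \<subseteq> {..<m}"
  shows "mat m m (\<lambda>(i, j). X $$ (perm_idx m L i, perm_idx m R j)) =
    four_block_mat (submatrix X (- L) (- R)) (submatrix X (- L) R) (submatrix X L (- R)) (submatrix X L R)"
  using X card_idx[OF L] card_idx[OF R] card_idx_le[OF L] card_idx_le[OF R]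
  by (intro eq_matI) (auto simp: submatrix_def perm_idx_def)

lemma permuted_append_rows:
  assumes X: "X \<in> carrier_mat m q" and L: "L \<subseteq> {..<m}"
  shows "mat m q (\<lambda>(i, j). X $$ (perm_idx m L i, j)) = submatrix X (- L) UNIV @\<^sub>r submatrix X L UNIV"
  using X card_idx[OF L] card_idx_le[OF L]
  by (intro eq_matI) (auto simp: submatrix_def perm_idx_def append_rows_def pick_UNIV)

lemma permuted_append_cols:
  assumes X: "X \<in> carrier_mat r m" and R: "R \<subseteq> {..<m}"
  shows "mat r m (\<lambda>(i, j). X $$ (i, perm_idx m R j)) = append_cols (submatrix X UNIV (- R)) (submatrix X UNIV R)"
  using X card_idx[OF R] card_idx_le[OF R]
  by (intro eq_matI) (auto simp: submatrix_def perm_idx_def append_cols_def pick_UNIV)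

section \<open>Jordan matrices\<close>

abbreviation jdim :: "(nat \<times> complex) list \<Rightarrow> nat" where
  "jdim ns \<equiv> sum_list (map fst ns)"

lemma jordan_matrix_Cons_index:
  assumes "i < k + jdim ns" "j < k + jdim ns"
  shows "jordan_matrix ((k, a) # ns) $$ (i, j) =
    (if i < k then if j < k then (if i = j then a else if Suc i = j then 1 else 0) else 0
     else if j < k then 0 else jordan_matrix ns $$ (i - k, j - k))"
  using assms by (simp add: jordan_matrix_Cons jordan_block_def)

lemma Collect_less_length_Cons:
  "{f k | k. k < length (x # xs) \<and> P ((x # xs) ! k)} =
    (if P x then {f 0} else {}) \<union> {f (Suc k) | k. k < length xs \<and> P (xs ! k)}"
proof -
  have "y \<in> {f k | k. k < length (x # xs) \<and> P ((x # xs) ! k)} \<longleftrightarrow>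
    y \<in> (if P x then {f 0} else {}) \<union> {f (Suc k) | k. k < length xs \<and> P (xs ! k)}" for y
    by (simp add: Ex_less_Suc2 conj_commute[of "_ = _"] ex_simps flip: ex_simps)
  then show ?thesis by blast
qed

lemma first_idx_Cons:
  "first_idx ((k, a) # ns) \<mu> = (if a = \<mu> then {0} else {}) \<union> (+) k ` first_idx ns \<mu>"
  unfolding first_idx_def Collect_less_length_Cons[where P = "\<lambda>x. snd x = \<mu>"] by auto

lemma last_idx_Cons:
  assumes "0 \<notin> fst ` set ns"
  shows "last_idx ((k, a) # ns) \<mu> = (if a = \<mu> then {k - 1} else {}) \<union> (+) k ` last_idx ns \<mu>"
proof -
  \<comment> \<open>Subtraction of natural numbers truncates at 0. The shift by k passes through it
    because the partial sum includes a block of positive size.\<close>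
  have "k + sum_list (map fst (take (Suc i) ns)) - 1 = k + (sum_list (map fst (take (Suc i) ns)) - 1)"
    if "i < length ns" for i
  proof -
    have "fst (ns ! i) \<noteq> 0" using assms that by (metis image_eqI nth_mem)
    then show ?thesis using that by (simp add: take_Suc_conv_app_nth)
  qed
  then have "{k + sum_list (map fst (take (Suc i) ns)) - 1 | i. i < length ns \<and> snd (ns ! i) = \<mu>} =
    (+) k ` last_idx ns \<mu>"
    unfolding last_idx_def by (force simp: image_iff)
  then show ?thesis
    unfolding last_idx_def[of "(k, a) # ns"] Collect_less_length_Cons[where P = "\<lambda>x. snd x = \<mu>"] by simp
qed

lemma num_jblocks_Cons:
  "num_jblocks ((k, a) # ns) \<mu> = (if a = \<mu> then 1 else 0) + num_jblocks ns \<mu>"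
proof -
  have "{i. i < length ((k, a) # ns) \<and> snd (((k, a) # ns) ! i) = \<mu>} =
    (if a = \<mu> then {0} else {}) \<union> Suc ` {i. i < length ns \<and> snd (ns ! i) = \<mu>}"
    using Collect_less_length_Cons[of "\<lambda>i. i" "(k, a)" ns "\<lambda>x. snd x = \<mu>"] by auto
  then show ?thesis
    by (auto simp: num_jblocks_def card_image card_insert_if)
qed

text \<open>Positive sizes keep the first indices of different blocks apart, so they are as many as
  the blocks. The same holds for the last indices below.\<close>

lemma first_idx_props:
  assumes "0 \<notin> fst ` set ns"
  shows "first_idx ns \<mu> \<subseteq> {..<jdim ns}" "card (first_idx ns \<mu>) = num_jblocks ns \<mu>"
proof -
  have "first_idx ns \<mu> \<subseteq> {..<jdim ns} \<and> card (first_idx ns \<mu>) = num_jblocks ns \<mu>"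
    using assms
  proof (induction ns)
    case Nil
    then show ?case by (simp add: first_idx_def num_jblocks_def)
  next
    case (Cons x ns)
    obtain k a where x: "x = (k, a)" by (cases x)
    have k: "0 < k" and ns: "0 \<notin> fst ` set ns" using Cons.prems x by simp_all
    have IH: "first_idx ns \<mu> \<subseteq> {..<jdim ns}" "card (first_idx ns \<mu>) = num_jblocks ns \<mu>"
      using Cons.IH[OF ns] by simp_all
    have fin: "finite (first_idx ns \<mu>)" by (rule finite_subset[OF IH(1)]) simp
    have notin: "0 \<notin> (+) k ` first_idx ns \<mu>" using k by auto
    have card: "card ((+) k ` first_idx ns \<mu>) = num_jblocks ns \<mu>" using IH(2) by (simp add: card_image)
    have sub: "(+) k ` first_idx ns \<mu> \<subseteq> {..<k + jdim ns}" using IH(1) by auto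
    show ?case
      unfolding x first_idx_Cons num_jblocks_Cons using k fin notin card sub
      by (cases "a = \<mu>") simp_all
  qed
  then show "first_idx ns \<mu> \<subseteq> {..<jdim ns}" "card (first_idx ns \<mu>) = num_jblocks ns \<mu>" by auto
qed

lemma last_idx_props:
  assumes "0 \<notin> fst ` set ns"
  shows "last_idx ns \<mu> \<subseteq> {..<jdim ns}" "card (last_idx ns \<mu>) = num_jblocks ns \<mu>"
proof -
  have "last_idx ns \<mu> \<subseteq> {..<jdim ns} \<and> card (last_idx ns \<mu>) = num_jblocks ns \<mu>"
    using assms
  proof (induction ns)
    case Nil
    then show ?case by (simp add: last_idx_def num_jblocks_def)
  next
    case (Cons x ns)
    obtain k a where x: "x = (k, a)" by (cases x)
    have k: "0 < k" and ns: "0 \<notin> fst ` set ns" using Cons.prems x by simp_all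
    have IH: "last_idx ns \<mu> \<subseteq> {..<jdim ns}" "card (last_idx ns \<mu>) = num_jblocks ns \<mu>"
      using Cons.IH[OF ns] by simp_all
    have fin: "finite (last_idx ns \<mu>)" by (rule finite_subset[OF IH(1)]) simp
    have notin: "k - 1 \<notin> (+) k ` last_idx ns \<mu>" using k by auto
    have card: "card ((+) k ` last_idx ns \<mu>) = num_jblocks ns \<mu>" using IH(2) by (simp add: card_image)
    have sub: "(+) k ` last_idx ns \<mu> \<subseteq> {..<k + jdim ns}" using IH(1) by auto
    show ?case
      unfolding x last_idx_Cons[OF ns] num_jblocks_Cons using k fin notin card sub
      by (cases "a = \<mu>") simp_all
  qed
  then show "last_idx ns \<mu> \<subseteq> {..<jdim ns}" "card (last_idx ns \<mu>) = num_jblocks ns \<mu>" by auto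
qed

lemma jordan_matrix_bidiagonal:
  "i < jdim ns \<Longrightarrow> j < jdim ns \<Longrightarrow> j \<noteq> i \<Longrightarrow> j \<noteq> Suc i \<Longrightarrow> jordan_matrix ns $$ (i, j) = 0"
proof (induction ns arbitrary: i j)
  case (Cons x ns)
  obtain k a where x: "x = (k, a)" by (cases x)
  show ?case using Cons unfolding x by (auto simp: jordan_matrix_Cons_index)
qed simp

text \<open>The last row of a block has no superdiagonal entry, so the pencil at \<mu> has a zero
  row there. Dually, the first column of a block has no entry above the diagonal.\<close>

lemma jordan_matrix_last_row:
  "0 \<notin> fst ` set ns \<Longrightarrow> i \<in> last_idx ns \<mu> \<Longrightarrow> j < jdim ns \<Longrightarrow>
    jordan_matrix ns $$ (i, j) = (if i = j then \<mu> else 0)"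
proof (induction ns arbitrary: i j)
  case Nil
  then show ?case by simp
next
  case (Cons x ns)
  obtain k a where x: "x = (k, a)" by (cases x)
  have k: "0 < k" and ns: "0 \<notin> fst ` set ns" using Cons.prems x by simp_all
  from Cons.prems(2) have "(a = \<mu> \<and> i = k - 1) \<or> (\<exists>i' \<in> last_idx ns \<mu>. i = k + i')"
    unfolding x last_idx_Cons[OF ns] by (auto split: if_splits)
  then show ?case
  proof
    assume "a = \<mu> \<and> i = k - 1"
    then show ?thesis using Cons.prems(3) k unfolding x by (auto simp: jordan_matrix_Cons_index)
  next
    assume "\<exists>i' \<in> last_idx ns \<mu>. i = k + i'"
    then obtain i' where i': "i' \<in> last_idx ns \<mu>" "i = k + i'" by blast
    have "i' < jdim ns" using last_idx_props(1)[OF ns] i' by auto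
    then show ?thesis
      using Cons.prems(3) Cons.IH[OF ns i'(1), of "j - k"] i' unfolding x
      by (auto simp: jordan_matrix_Cons_index)
  qed
qed

lemma jordan_matrix_first_col:
  "0 \<notin> fst ` set ns \<Longrightarrow> j \<in> first_idx ns \<mu> \<Longrightarrow> i < jdim ns \<Longrightarrow>
    jordan_matrix ns $$ (i, j) = (if i = j then \<mu> else 0)"
proof (induction ns arbitrary: i j)
  case Nil
  then show ?case by simp
next
  case (Cons x ns)
  obtain k a where x: "x = (k, a)" by (cases x)
  have k: "0 < k" and ns: "0 \<notin> fst ` set ns" using Cons.prems x by simp_all
  from Cons.prems(2) have "(a = \<mu> \<and> j = 0) \<or> (\<exists>j' \<in> first_idx ns \<mu>. j = k + j')"
    unfolding x first_idx_Cons by (auto split: if_splits)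
  then show ?case
  proof
    assume "a = \<mu> \<and> j = 0"
    then show ?thesis using Cons.prems(3) k unfolding x by (auto simp: jordan_matrix_Cons_index)
  next
    assume "\<exists>j' \<in> first_idx ns \<mu>. j = k + j'"
    then obtain j' where j': "j' \<in> first_idx ns \<mu>" "j = k + j'" by blast
    have "j' < jdim ns" using first_idx_props(1)[OF ns] j' by auto
    then show ?thesis
      using Cons.prems(3) Cons.IH[OF ns j'(1), of "i - k"] j' unfolding x
      by (auto simp: jordan_matrix_Cons_index)
  qed
qed

text \<open>A column with diagonal entry \<mu> that does not start a block has the superdiagonal 1
  of its block directly above the diagonal. This 1 is the pivot in the back substitution
  below.\<close>

lemma jordan_matrix_not_first:
  "j < jdim ns \<Longrightarrow> j \<notin> first_idx ns \<mu> \<Longrightarrow> jordan_matrix ns $$ (j, j) = \<mu> \<Longrightarrow>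
    \<exists>i. j = Suc i \<and> jordan_matrix ns $$ (i, i) = \<mu> \<and> jordan_matrix ns $$ (i, j) = 1"
proof (induction ns arbitrary: j)
  case (Cons x ns)
  obtain k a where x: "x = (k, a)" by (cases x)
  show ?case
  proof (cases "j < k")
    case True
    then have "a = \<mu>" "j \<noteq> 0"
      using Cons.prems unfolding x by (auto simp: jordan_matrix_Cons_index first_idx_Cons split: if_splits)
    then show ?thesis
      using True Cons.prems(1) unfolding x
      by (intro exI[of _ "j - 1"]) (auto simp: jordan_matrix_Cons_index)
  next
    case False
    have 1: "j - k < jdim ns" using Cons.prems(1) False unfolding x by simp
    have "j - k \<notin> first_idx ns \<mu>"
    proof
      assume "j - k \<in> first_idx ns \<mu>"
      then have "k + (j - k) \<in> (+) k ` first_idx ns \<mu>" by blast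
      with False have "j \<in> (+) k ` first_idx ns \<mu>" by simp
      then show False using Cons.prems(2) unfolding x first_idx_Cons by blast
    qed
    moreover have "jordan_matrix ns $$ (j - k, j - k) = \<mu>"
      using Cons.prems(1,3) False unfolding x by (simp add: jordan_matrix_Cons_index)
    ultimately obtain i where "j - k = Suc i" "jordan_matrix ns $$ (i, i) = \<mu>" "jordan_matrix ns $$ (i, j - k) = 1"
      using Cons.IH[OF 1] by blast
    then show ?thesis
      using Cons.prems(1) False unfolding x
      by (intro exI[of _ "k + i"]) (auto simp: jordan_matrix_Cons_index)
  qed
qed simp

lemma pencil_carrier: "pencil ns z \<in> carrier_mat (jdim ns) (jdim ns)"
  unfolding pencil_def by (intro carrier_matI) auto

lemma pencil_index:
  "i < jdim ns \<Longrightarrow> j < jdim ns \<Longrightarrow>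
    pencil ns z $$ (i, j) = (if i = j then z else 0) - jordan_matrix ns $$ (i, j)"
  unfolding pencil_def by simp

text \<open>Back substitution from the last index: every column outside \<open>first_idx\<close> has
  a pivot, so a kernel vector that vanishes on \<open>first_idx\<close> vanishes altogether.\<close>

lemma pencil_kernel_trivial:
  assumes ns: "0 \<notin> fst ` set ns"
    and ker: "\<And>i. i < jdim ns \<Longrightarrow> (\<Sum>j<jdim ns. pencil ns \<mu> $$ (i, j) * y j) = 0"
    and R: "\<And>j. j \<in> first_idx ns \<mu> \<Longrightarrow> y j = 0"
    and j: "j < jdim ns"
  shows "y j = 0"
  using j
proof (induction "jdim ns - j" arbitrary: j rule: less_induct)
  case less
  let ?J = "jordan_matrix ns"
  have later: "y k = 0" if "j < k" "k < jdim ns" for k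
    using that by (intro less.hyps) auto
  show ?case
  proof (cases "j \<in> first_idx ns \<mu>")
    case True
    then show ?thesis by (rule R)
  next
    case nf: False
    show ?thesis
    proof (cases "?J $$ (j, j) = \<mu>")
      case True
      \<comment> \<open>Row j - 1 has diagonal entry \<mu> - \<mu> = 0, so its equation is just - y
        j = 0.\<close>
      obtain i where i: "j = Suc i" "?J $$ (i, i) = \<mu>" "?J $$ (i, j) = 1"
        using jordan_matrix_not_first[OF less.prems nf True] by blast
      have il: "i < jdim ns" using i less.prems by simp
      have "pencil ns \<mu> $$ (i, k) * y k = (if k = j then - y j else 0)" if "k < jdim ns" for k
        using jordan_matrix_bidiagonal[OF il that] i that il less.prems
        by (cases "k = i"; cases "k = j") (auto simp: pencil_index)
      then have "(\<Sum>k<jdim ns. pencil ns \<mu> $$ (i, k) * y k) = (\<Sum>k<jdim ns. if k = j then - y j else 0)"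
        by (intro sum.cong) auto
      then show ?thesis using ker[OF il] less.prems by simp
    next
      case False
      \<comment> \<open>Here the diagonal entry itself is the pivot: the only other possible entry
        of row j stands at j + 1, where \<open>y\<close> is already known to be 0.\<close>
      have "pencil ns \<mu> $$ (j, k) * y k = (if k = j then (\<mu> - ?J $$ (j, j)) * y j else 0)" if "k < jdim ns" for k
        using jordan_matrix_bidiagonal[OF less.prems that] later[of k] that less.prems
        by (cases "k = j"; cases "k = Suc j") (auto simp: pencil_index)
      then have "(\<Sum>k<jdim ns. pencil ns \<mu> $$ (j, k) * y k) =
          (\<Sum>k<jdim ns. if k = j then (\<mu> - ?J $$ (j, j)) * y j else 0)"
        by (intro sum.cong) auto
      then show ?thesis using ker[OF less.prems] less.prems False by simp
    qed
  qed
qed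

text \<open>The first three blocks vanish by the zero rows and columns of the pencil. A kernel
  vector of the remaining block, extended by zeros on \<open>first_idx\<close>, lies in the kernel
  of the whole pencil, hence is zero.\<close>

lemma jd_blocks:
  assumes ns: "0 \<notin> fst ` set ns"
    and n1_def: "n1 = num_jblocks ns \<mu>" and n2_def: "n2 = jdim ns - n1"
  shows "n1 \<le> jdim ns"
    and "jd_A11 ns \<mu> \<mu> = 0\<^sub>m n1 n1" and "jd_A12 ns \<mu> \<mu> = 0\<^sub>m n1 n2" and "jd_A21 ns \<mu> \<mu> = 0\<^sub>m n2 n1"
    and "jd_A22 ns \<mu> \<mu> \<in> carrier_mat n2 n2" and "det (jd_A22 ns \<mu> \<mu>) \<noteq> 0"
    and "mat (jdim ns) (jdim ns) (\<lambda>(i, j). pencil ns \<mu> $$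
        (perm_idx (jdim ns) (last_idx ns \<mu>) i, perm_idx (jdim ns) (first_idx ns \<mu>) j))
      = four_block_mat (jd_A22 ns \<mu> \<mu>) (0\<^sub>m n2 n1) (0\<^sub>m n1 n2) (0\<^sub>m n1 n1)"
proof -
  define m where "m = jdim ns"
  note L = last_idx_props[OF ns, of \<mu>, folded m_def, folded n1_def]
    and R = first_idx_props[OF ns, of \<mu>, folded m_def, folded n1_def]
  note cL = card_idx[OF L(1), unfolded L(2)] and cR = card_idx[OF R(1), unfolded R(2)]
  have finL: "finite (last_idx ns \<mu>)" and finR: "finite (first_idx ns \<mu>)"
    using L(1) R(1) finite_subset by blast+
  have infR: "infinite (- first_idx ns \<mu>)" and infL: "infinite (- last_idx ns \<mu>)"
    using finL finR by (metis finite_compl infinite_UNIV_nat)+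
  have n1: "n1 \<le> m" using card_idx_le[OF L(1)] L(2) by simp
  then show "n1 \<le> jdim ns" by (simp add: m_def)
  have n2: "n2 = m - n1" by (simp add: n2_def m_def)
  have P: "pencil ns \<mu> \<in> carrier_mat m m" unfolding m_def by (rule pencil_carrier)
  have row0: "pencil ns \<mu> $$ (i, j) = 0" if "i \<in> last_idx ns \<mu>" "j < m" for i j
    using jordan_matrix_last_row[OF ns that(1)] that L(1) by (auto simp: pencil_index m_def)
  have col0: "pencil ns \<mu> $$ (i, j) = 0" if "j \<in> first_idx ns \<mu>" "i < m" for i j
    using jordan_matrix_first_col[OF ns that(1)] that R(1) by (auto simp: pencil_index m_def)
  have pL: "pick (last_idx ns \<mu>) i \<in> last_idx ns \<mu>" if "i < n1" for i
    using that L(2) by (intro pick_in_set_le) simp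
  have pR: "pick (first_idx ns \<mu>) i \<in> first_idx ns \<mu>" if "i < n1" for i
    using that R(2) by (intro pick_in_set_le) simp
  have pnL: "pick (- last_idx ns \<mu>) i < m" if "i < n2" for i
    using that cL n2 by (intro pick_le) simp
  have pnR: "pick (- first_idx ns \<mu>) i < m" if "i < n2" for i
    using that cR n2 by (intro pick_le) simp
  have pR': "pick (first_idx ns \<mu>) i < m" if "i < n1" for i
    using pR[OF that] R(1) by auto
  note sm = submatrix_def carrier_matD[OF P] cL cR n2[symmetric]
  show A11: "jd_A11 ns \<mu> \<mu> = 0\<^sub>m n1 n1"
    unfolding jd_A11_def by (intro eq_matI) (simp_all add: sm row0[OF pL pR'])
  show A12: "jd_A12 ns \<mu> \<mu> = 0\<^sub>m n1 n2"
    unfolding jd_A12_def by (intro eq_matI) (simp_all add: sm row0[OF pL pnR])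
  show A21: "jd_A21 ns \<mu> \<mu> = 0\<^sub>m n2 n1"
    unfolding jd_A21_def by (intro eq_matI) (simp_all add: sm col0[OF pR pnL])
  show A22: "jd_A22 ns \<mu> \<mu> \<in> carrier_mat n2 n2"
    unfolding jd_A22_def by (intro carrier_matI) (simp_all add: sm)
  show perm: "mat (jdim ns) (jdim ns) (\<lambda>(i, j). pencil ns \<mu> $$
        (perm_idx (jdim ns) (last_idx ns \<mu>) i, perm_idx (jdim ns) (first_idx ns \<mu>) j))
      = four_block_mat (jd_A22 ns \<mu> \<mu>) (0\<^sub>m n2 n1) (0\<^sub>m n1 n2) (0\<^sub>m n1 n1)"
    using permuted_four_block[OF P L(1) R(1)] A11 A12 A21
    unfolding jd_A11_def jd_A12_def jd_A21_def jd_A22_def m_def by simp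
  show "det (jd_A22 ns \<mu> \<mu>) \<noteq> 0"
  proof
    assume "det (jd_A22 ns \<mu> \<mu>) = 0"
    then obtain x where x: "x \<in> carrier_vec n2" "x \<noteq> 0\<^sub>v n2" and Ax: "jd_A22 ns \<mu> \<mu> *\<^sub>v x = 0\<^sub>v n2"
      using det_0_iff_vec_prod_zero[OF A22] by blast
    define f where "f = perm_idx m (last_idx ns \<mu>)"
    define g where "g = perm_idx m (first_idx ns \<mu>)"
    have f: "bij_betw f {..<m} {..<m}" and g: "bij_betw g {..<m} {..<m}"
      unfolding f_def g_def using perm_idx_bij L(1) R(1) by blast+
    \<comment> \<open>\<open>z\<close> pads the kernel vector with zeros in the reordered
      coordinates, and \<open>y\<close> is the same vector in the original column order.\<close>
    define z where "z = (\<lambda>j. if j < n2 then x $ j else 0)"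
    define y where "y = (\<lambda>j. z (the_inv_into {..<m} g j))"
    have yg: "y (g j) = z j" if "j < m" for j
      using the_inv_into_f_f[OF bij_betw_imp_inj_on[OF g]] that by (simp add: y_def)
    have "y j = 0" if j: "j < m" for j
    proof (rule pencil_kernel_trivial[OF ns])
      show "j < jdim ns" using j by (simp add: m_def)
    next
      fix j assume "j \<in> first_idx ns \<mu>"
      moreover then obtain k where k: "k < m" "g k = j"
        using R(1) bij_betw_imp_surj_on[OF g] by (metis image_iff lessThan_iff subsetD)
      ultimately have "\<not> k < n2"
        using pick_in_set_inf[OF infR, of k] R(2) n2 by (auto simp: g_def perm_idx_def)
      then show "y j = 0" using yg[OF k(1)] k(2) by (simp add: z_def)
    next
      fix i' assume "i' < jdim ns"
      then obtain i where i: "i < m" "f i = i'"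
        using bij_betw_imp_surj_on[OF f] unfolding m_def by (metis image_iff lessThan_iff)
      have "(\<Sum>j<jdim ns. pencil ns \<mu> $$ (i', j) * y j) = (\<Sum>j<m. pencil ns \<mu> $$ (f i, g j) * y (g j))"
        using sum.reindex_bij_betw[OF g, of "\<lambda>j. pencil ns \<mu> $$ (f i, j) * y j"] i by (simp add: m_def)
      also have "\<dots> = (\<Sum>j<m. if j < n2 then pencil ns \<mu> $$ (f i, g j) * x $ j else 0)"
        by (intro sum.cong) (auto simp: yg z_def)
      also have "\<dots> = (\<Sum>j<n2. pencil ns \<mu> $$ (f i, g j) * x $ j)"
        by (rule sum.mono_neutral_cong_right) (use n2 in auto)
      also have "\<dots> = 0"
      proof (cases "i < n2")
        case True
        have "(jd_A22 ns \<mu> \<mu> *\<^sub>v x) $ i = (\<Sum>j<n2. jd_A22 ns \<mu> \<mu> $$ (i, j) * x $ j)"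
          using A22 x True by (simp add: scalar_prod_def atLeast0LessThan)
        also have "\<dots> = (\<Sum>j<n2. pencil ns \<mu> $$ (f i, g j) * x $ j)"
        proof (rule sum.cong)
          fix j assume "j \<in> {..<n2}"
          then have "jd_A22 ns \<mu> \<mu> $$ (i, j) = pencil ns \<mu> $$ (f i, g j)"
            unfolding jd_A22_def f_def g_def perm_idx_def
            using True by (simp add: sm L(2) R(2))
          then show "jd_A22 ns \<mu> \<mu> $$ (i, j) * x $ j = pencil ns \<mu> $$ (f i, g j) * x $ j" by simp
        qed simp
        finally show ?thesis using Ax True by simp
      next
        case False
        \<comment> \<open>The rows outside the block are zero rows of the pencil, so they impose no
          condition.\<close>
        then have "f i \<in> last_idx ns \<mu>"
          using pL[of "i - n2"] i n2 n1 L(2) by (auto simp: f_def perm_idx_def)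
        moreover have "g j < m" if "j < n2" for j
          using bij_betwE[OF g] that n2 by auto
        ultimately show ?thesis using row0 by (intro sum.neutral) auto
      qed
      finally show "(\<Sum>j<jdim ns. pencil ns \<mu> $$ (i', j) * y j) = 0" .
    qed
    then have z0: "z j = 0" if "j < m" for j
      using yg[OF that] bij_betwE[OF g] that by (metis lessThan_iff)
    have "x $ j = 0" if "j < n2" for j
    proof -
      have "j < m" using that n2 by linarith
      from z0[OF this] show ?thesis using that by (simp add: z_def)
    qed
    then have "x = 0\<^sub>v n2"
      using x(1) by (intro eq_vecI) auto
    with x(2) show False ..
  qed
qed

section \<open>Algebra of concatenations\<close>

lemma mult_hcat_on:
  fixes F :: "nat \<Rightarrow> 'a::semiring_1 mat"
  assumes "finite V" "Y \<in> carrier_mat a b" "\<And>i. i \<in> V \<Longrightarrow> F i \<in> carrier_mat b (q i)"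
  shows "Y * hcat_on b F V = hcat_on a (\<lambda>i. Y * F i) V"
  using assms(1,3)
proof (induction V rule: finite_linorder_min_induct)
  case empty
  then show ?case using assms(2) by simp
next
  case (insert j V)
  have "hcat_on b F V \<in> carrier_mat b (\<Sum>i\<in>V. q i)"
    using insert by (intro hcat_on_carrier) auto
  then show ?case
    using insert assms(2) by (simp add: hcat_on_insert_min mult_append_cols[of _ b "q j" _ "\<Sum>i\<in>V. q i" _ a])
qed

lemma vcat_on_mult:
  fixes F :: "nat \<Rightarrow> 'a::semiring_1 mat"
  assumes "finite V" "Y \<in> carrier_mat b c" "\<And>i. i \<in> V \<Longrightarrow> F i \<in> carrier_mat (r i) b"
  shows "vcat_on b F V * Y = vcat_on c (\<lambda>i. F i * Y) V"
  using assms(1,3)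
proof (induction V rule: finite_linorder_min_induct)
  case empty
  then show ?case using assms(2) by simp
next
  case (insert j V)
  have "vcat_on b F V \<in> carrier_mat (\<Sum>i\<in>V. r i) b"
    using insert by (intro vcat_on_carrier) auto
  then show ?case
    using insert assms(2) by (simp add: vcat_on_insert_min append_rows_mult[of _ "r j" b _ "\<Sum>i\<in>V. r i" _ c])
qed

lemma hcat_on_uminus:
  fixes F :: "nat \<Rightarrow> 'a::group_add mat"
  assumes "finite V" "\<And>i. i \<in> V \<Longrightarrow> F i \<in> carrier_mat nr (q i)"
  shows "hcat_on nr (\<lambda>i. - F i) V = - hcat_on nr F V"
  using assms
proof (induction V rule: finite_linorder_min_induct)
  case (insert j V)
  have "hcat_on nr F V \<in> carrier_mat nr (\<Sum>i\<in>V. q i)"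
    using insert by (intro hcat_on_carrier) auto
  moreover have "F j \<in> carrier_mat nr (q j)" using insert by simp
  ultimately have "append_cols (- F j) (- hcat_on nr F V) = - append_cols (F j) (hcat_on nr F V)"
    unfolding append_cols_def by (intro eq_matI) auto
  then show ?case using insert by (simp add: hcat_on_insert_min)
qed simp

lemma hcat_on_append_rows:
  fixes F H :: "nat \<Rightarrow> 'a::zero mat"
  assumes "finite V" "\<And>i. i \<in> V \<Longrightarrow> F i \<in> carrier_mat a (q i)" "\<And>i. i \<in> V \<Longrightarrow> H i \<in> carrier_mat b (q i)"
  shows "hcat_on (a + b) (\<lambda>i. F i @\<^sub>r H i) V = hcat_on a F V @\<^sub>r hcat_on b H V"
  using assms
proof (induction V rule: finite_linorder_min_induct)
  case empty
  then show ?case by (intro eq_matI) (auto simp: append_rows_def)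
next
  case (insert j V)
  have "hcat_on a F V \<in> carrier_mat a (\<Sum>i\<in>V. q i)" "hcat_on b H V \<in> carrier_mat b (\<Sum>i\<in>V. q i)"
    using insert by (auto intro!: hcat_on_carrier)
  moreover have "F j \<in> carrier_mat a (q j)" "H j \<in> carrier_mat b (q j)" using insert by simp_all
  ultimately have "append_cols (F j @\<^sub>r H j) (hcat_on a F V @\<^sub>r hcat_on b H V) =
    append_cols (F j) (hcat_on a F V) @\<^sub>r append_cols (H j) (hcat_on b H V)"
    unfolding append_rows_def append_cols_def by (intro eq_matI) auto
  then show ?case using insert by (simp add: hcat_on_insert_min)
qed

lemma vcat_on_append_cols:
  fixes F H :: "nat \<Rightarrow> 'a::zero mat"
  assumes "finite V" "\<And>i. i \<in> V \<Longrightarrow> F i \<in> carrier_mat (r i) a" "\<And>i. i \<in> V \<Longrightarrow> H i \<in> carrier_mat (r i) b"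
  shows "vcat_on (a + b) (\<lambda>i. append_cols (F i) (H i)) V = append_cols (vcat_on a F V) (vcat_on b H V)"
  using assms
proof (induction V rule: finite_linorder_min_induct)
  case empty
  then show ?case by (intro eq_matI) (auto simp: append_cols_def)
next
  case (insert j V)
  have "vcat_on a F V \<in> carrier_mat (\<Sum>i\<in>V. r i) a" "vcat_on b H V \<in> carrier_mat (\<Sum>i\<in>V. r i) b"
    using insert by (auto intro!: vcat_on_carrier)
  moreover have "F j \<in> carrier_mat (r j) a" "H j \<in> carrier_mat (r j) b" using insert by simp_all
  ultimately have "append_cols (F j) (H j) @\<^sub>r append_cols (vcat_on a F V) (vcat_on b H V) =
    append_cols (F j @\<^sub>r vcat_on a F V) (H j @\<^sub>r vcat_on b H V)"
    unfolding append_rows_def append_cols_def by (intro eq_matI) auto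
  then show ?case using insert by (simp add: vcat_on_insert_min)
qed

lemma hcat_on_cong: "finite V \<Longrightarrow> (\<And>i. i \<in> V \<Longrightarrow> F i = H i) \<Longrightarrow> hcat_on nr F V = hcat_on nr H V"
  unfolding hcat_on_def by (intro arg_cong[where f = "hcat nr"] map_cong) auto

lemma vcat_on_cong: "finite V \<Longrightarrow> (\<And>i. i \<in> V \<Longrightarrow> F i = H i) \<Longrightarrow> vcat_on nr F V = vcat_on nr H V"
  unfolding vcat_on_def by (intro arg_cong[where f = "vcat nr"] map_cong) auto

text \<open>The last block row of a network cut belongs to \<open>Rx\<close>, which is not a relay
  index, so it has to be split off at the level of lists.\<close>

lemma vcat_on_snoc:
  assumes "finite V" "\<And>i. i \<in> V \<Longrightarrow> F i \<in> carrier_mat (r i) nc" "Y \<in> carrier_mat b nc"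
  shows "vcat nc (map F (sorted_list_of_set V) @ [Y]) = vcat_on nc F V @\<^sub>r Y"
  using assms(1,2)
proof (induction V rule: finite_linorder_min_induct)
  case empty
  have "vcat nc [Y] = Y"
    using assms(3) unfolding vcat_def by (simp add: append_rows_def) (intro eq_matI, auto)
  moreover have "0\<^sub>m 0 nc @\<^sub>r Y = Y"
    using assms(3) unfolding append_rows_def by (intro eq_matI) auto
  ultimately show ?case by simp
next
  case (insert j V)
  have "vcat_on nc F V \<in> carrier_mat (\<Sum>i\<in>V. r i) nc"
    using insert by (intro vcat_on_carrier) auto
  moreover have "F j \<in> carrier_mat (r j) nc" using insert by simp
  ultimately have "F j @\<^sub>r (vcat_on nc F V @\<^sub>r Y) = (F j @\<^sub>r vcat_on nc F V) @\<^sub>r Y"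
    using assms(3) unfolding append_rows_def by (intro eq_matI) auto
  moreover have "vcat nc (map F (sorted_list_of_set (insert j V)) @ [Y]) =
      F j @\<^sub>r vcat nc (map F (sorted_list_of_set V) @ [Y])"
    using insert by (simp add: sorted_list_of_set_insert_min vcat_def del: sorted_list_of_set_insert_remove)
  ultimately show ?case using insert by (simp add: vcat_on_insert_min)
qed

lemma gain_sum_four_block:
  fixes B1 B2 C1 C2 K :: "nat \<Rightarrow> 'a::ring_1 mat"
  assumes B1: "\<And>i. i \<in> I \<Longrightarrow> B1 i \<in> carrier_mat n1 (q i)" and B2: "\<And>i. i \<in> I \<Longrightarrow> B2 i \<in> carrier_mat n2 (q i)"
    and C1: "\<And>i. i \<in> I \<Longrightarrow> C1 i \<in> carrier_mat (r i) n1" and C2: "\<And>i. i \<in> I \<Longrightarrow> C2 i \<in> carrier_mat (r i) n2"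
    and K: "\<And>i. i \<in> I \<Longrightarrow> K i \<in> carrier_mat (q i) (r i)"
  shows "msum (n2 + n1) (n2 + n1) (\<lambda>i. (B2 i @\<^sub>r B1 i) * K i * append_cols (C2 i) (C1 i)) I =
    four_block_mat (msum n2 n2 (\<lambda>i. B2 i * K i * C2 i) I) (msum n2 n1 (\<lambda>i. B2 i * K i * C1 i) I)
      (msum n1 n2 (\<lambda>i. B1 i * K i * C2 i) I) (msum n1 n1 (\<lambda>i. B1 i * K i * C1 i) I)"
proof -
  have 1: "(B2 i @\<^sub>r B1 i) * K i * append_cols (C2 i) (C1 i) =
    four_block_mat (B2 i * K i * C2 i) (B2 i * K i * C1 i) (B1 i * K i * C2 i) (B1 i * K i * C1 i)"
    if i: "i \<in> I" for i
    unfolding append_rows_mult[OF B2[OF i] B1[OF i] K[OF i]]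
    by (rule append_rows_mult_append_cols[OF mult_carrier_mat[OF B2[OF i] K[OF i]]
          mult_carrier_mat[OF B1[OF i] K[OF i]] C2[OF i] C1[OF i]])
  have 2: "dim_row (B2 i * K i * C2 i) = n2" "dim_col (B2 i * K i * C2 i) = n2"
    "dim_row (B1 i * K i * C1 i) = n1" "dim_col (B1 i * K i * C1 i) = n1" if i: "i \<in> I" for i
    using carrier_matD[OF B2[OF i]] carrier_matD[OF C2[OF i]] carrier_matD[OF B1[OF i]] carrier_matD[OF C1[OF i]]
    by simp_all
  have "msum (n2 + n1) (n2 + n1) (\<lambda>i. (B2 i @\<^sub>r B1 i) * K i * append_cols (C2 i) (C1 i)) I =
    msum (n2 + n1) (n2 + n1) (\<lambda>i. four_block_mat (B2 i * K i * C2 i) (B2 i * K i * C1 i) (B1 i * K i * C2 i) (B1 i * K i * C1 i)) I"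
    by (rule msum_cong) (rule 1)
  also have "\<dots> = four_block_mat (msum n2 n2 (\<lambda>i. B2 i * K i * C2 i) I) (msum n2 n1 (\<lambda>i. B2 i * K i * C1 i) I)
      (msum n1 n2 (\<lambda>i. B1 i * K i * C2 i) I) (msum n1 n1 (\<lambda>i. B1 i * K i * C1 i) I)"
    by (intro eq_matI) (auto simp: msum_def 2 simp del: index_mult_mat intro!: sum.cong)
  finally show ?thesis .
qed

lemma msum_uminus:
  fixes F :: "nat \<Rightarrow> 'a::ab_group_add mat"
  assumes "\<And>i. i \<in> I \<Longrightarrow> F i \<in> carrier_mat nr nc"
  shows "msum nr nc (\<lambda>i. - F i) I = - msum nr nc F I"
  using carrier_matD[OF assms] by (intro eq_matI) (auto simp: msum_def simp flip: sum_negf)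

section \<open>Push-through identity\<close>

text \<open>A Woodbury identity: it trades the loop inverse of size d for an inverse of size n.
  Multiplying D E = 1 + b c E by \<open>Di\<close> gives E = Di + Di b c E, which is what makes the
  product with the proposed inverse collapse to 1.\<close>

lemma push_through:
  fixes D :: "'a::field mat"
  assumes D: "D \<in> carrier_mat n n" and Di: "Di \<in> carrier_mat n n" "Di * D = 1\<^sub>m n"
    and b: "b \<in> carrier_mat n d" and c: "c \<in> carrier_mat d n"
    and E: "E \<in> carrier_mat n n" "(D - b * c) * E = 1\<^sub>m n"
  shows "minv (1\<^sub>m d - c * Di * b) = 1\<^sub>m d + c * E * b"
proof (rule minv_eqI(1)[where n = d])
  note dims = carrier_matD[OF D] carrier_matD[OF Di(1)] carrier_matD[OF b] carrier_matD[OF c] carrier_matD[OF E(1)]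
  show "1\<^sub>m d - c * Di * b \<in> carrier_mat d d" "1\<^sub>m d + c * E * b \<in> carrier_mat d d"
    by (auto intro!: carrier_matI simp: dims)
  have "D * E = 1\<^sub>m n + b * (c * E)"
  proof -
    have "D * E - b * (c * E) = 1\<^sub>m n"
      using E(2) by (simp add: mat_distribs mat_assoc dims)
    moreover have "D * E = (D * E - b * (c * E)) + b * (c * E)"
      by (intro eq_matI) (auto simp: dims simp del: index_mult_mat(1))
    ultimately show ?thesis by simp
  qed
  then have "Di * (D * E) = Di + Di * (b * (c * E))"
    using Di(1) by (simp add: mat_distribs dims)
  moreover have "Di * (D * E) = E"
    by (rule mat_cancel[OF Di(2)]) (simp_all add: dims)
  ultimately have EDi: "E = Di + Di * (b * (c * E))" by simp
  have "c * (E * b) = c * ((Di + Di * (b * (c * E))) * b)"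
    using EDi by simp
  then have 1: "c * (E * b) = c * (Di * b) + c * (Di * (b * (c * (E * b))))"
    by (simp add: mat_distribs mat_assoc dims)
  have "(1\<^sub>m d - c * Di * b) * (1\<^sub>m d + c * E * b)
      = (1\<^sub>m d + c * (E * b)) - (c * (Di * b) + c * (Di * (b * (c * (E * b)))))"
    using mult_carrier_mat[OF c mult_carrier_mat[OF Di(1) b]] mult_carrier_mat[OF c mult_carrier_mat[OF E(1) b]] b
    by (simp add: mat_distribs mat_assoc dims) (intro eq_matI, auto simp: dims simp del: index_mult_mat(1))
  also have "\<dots> = 1\<^sub>m d"
    unfolding 1[symmetric] by (intro eq_matI) (auto simp: dims simp del: index_mult_mat(1))
  finally show "(1\<^sub>m d - c * Di * b) * (1\<^sub>m d + c * E * b) = 1\<^sub>m d" .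
qed

section \<open>The four characterisations for a partitioned system\<close>

text \<open>Forgets the Jordan structure: after reordering, all that remains of the pencil is an
  invertible pivot \<open>D\<close> padded with zeros.\<close>

locale partitioned_system =
  fixes v n1 n2 :: nat and q r :: "nat \<Rightarrow> nat" and D :: "complex mat"
    and B1 B2 C1 C2 :: "nat \<Rightarrow> complex mat"
  assumes D: "D \<in> carrier_mat n2 n2" and det_D: "det D \<noteq> 0"
    and B1: "\<And>i. i < v \<Longrightarrow> B1 i \<in> carrier_mat n1 (q i)"
    and B2: "\<And>i. i < v \<Longrightarrow> B2 i \<in> carrier_mat n2 (q i)"
    and C1: "\<And>i. i < v \<Longrightarrow> C1 i \<in> carrier_mat (r i) n1"
    and C2: "\<And>i. i < v \<Longrightarrow> C2 i \<in> carrier_mat (r i) n2"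
begin

abbreviation "K i \<equiv> gain_mat i (q i) (r i)"

definition "M = four_block_mat D (0\<^sub>m n2 n1) (0\<^sub>m n1 n2) (0\<^sub>m n1 n1)"
text \<open>The sign turns the subtracted feedback term into the added gain sum of the general rank
  theorem; part 2 comes first to match the position of \<open>D\<close> in \<open>M\<close>.\<close>

definition "B i = (- B2 i) @\<^sub>r (- B1 i)"
definition "C i = append_cols (C2 i) (C1 i)"

text \<open>Absorbing the gains into \<beta> turns each sum over channels into one product \<beta>
  \<gamma>, the form required by the push-through identity.\<close>

definition "\<beta>1 = hcat_on n1 (\<lambda>i. lift_rf (B1 i) * K i) {..<v}"
definition "\<beta>2 = hcat_on n2 (\<lambda>i. lift_rf (B2 i) * K i) {..<v}"
definition "\<gamma>1 = vcat_on n1 (\<lambda>i. lift_rf (C1 i)) {..<v}"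
definition "\<gamma>2 = vcat_on n2 (\<lambda>i. lift_rf (C2 i)) {..<v}"
definition "d = (\<Sum>i<v. r i)"
definition "F = lift_rf D - \<beta>2 * \<gamma>2"
text \<open>This is \<open>G_jd\<close> at z = \<mu>, with its vanishing blocks removed.\<close>

definition "G = - (\<beta>1 * \<gamma>1) - \<beta>1 * \<gamma>2 * minv F * (\<beta>2 * \<gamma>1)"

lemma K_carrier: "K i \<in> carrier_mat (q i) (r i)"
  by (simp add: gain_mat_def)

lemma lift_carriers:
  assumes "i \<in> {..<v}"
  shows "lift_rf (B1 i) \<in> carrier_mat n1 (q i)" "lift_rf (B2 i) \<in> carrier_mat n2 (q i)"
    "lift_rf (C1 i) \<in> carrier_mat (r i) n1" "lift_rf (C2 i) \<in> carrier_mat (r i) n2"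
  using B1[of i] B2[of i] C1[of i] C2[of i] assms by simp_all

lemma BK_carriers:
  assumes "i \<in> {..<v}"
  shows "lift_rf (B1 i) * K i \<in> carrier_mat n1 (r i)" "lift_rf (B2 i) * K i \<in> carrier_mat n2 (r i)"
  using lift_carriers[OF assms] K_carrier by (auto intro: mult_carrier_mat)

lemma \<beta>\<gamma>_carriers:
  "\<beta>1 \<in> carrier_mat n1 d" "\<beta>2 \<in> carrier_mat n2 d" "\<gamma>1 \<in> carrier_mat d n1" "\<gamma>2 \<in> carrier_mat d n2"
  unfolding \<beta>1_def \<beta>2_def \<gamma>1_def \<gamma>2_def d_def
  by (rule hcat_on_carrier[OF finite_lessThan BK_carriers(1)] hcat_on_carrier[OF finite_lessThan BK_carriers(2)]
      vcat_on_carrier[OF finite_lessThan lift_carriers(3)] vcat_on_carrier[OF finite_lessThan lift_carriers(4)]; assumption)+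

lemma \<beta>\<gamma>_msum:
  "\<beta>1 * \<gamma>1 = msum n1 n1 (\<lambda>i. lift_rf (B1 i) * K i * lift_rf (C1 i)) {..<v}"
  "\<beta>1 * \<gamma>2 = msum n1 n2 (\<lambda>i. lift_rf (B1 i) * K i * lift_rf (C2 i)) {..<v}"
  "\<beta>2 * \<gamma>1 = msum n2 n1 (\<lambda>i. lift_rf (B2 i) * K i * lift_rf (C1 i)) {..<v}"
  "\<beta>2 * \<gamma>2 = msum n2 n2 (\<lambda>i. lift_rf (B2 i) * K i * lift_rf (C2 i)) {..<v}"
  unfolding \<beta>1_def \<beta>2_def \<gamma>1_def \<gamma>2_def
  by (rule hcat_on_mult_vcat_on[OF finite_lessThan BK_carriers(1) lift_carriers(3)]
      hcat_on_mult_vcat_on[OF finite_lessThan BK_carriers(1) lift_carriers(4)]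
      hcat_on_mult_vcat_on[OF finite_lessThan BK_carriers(2) lift_carriers(3)]
      hcat_on_mult_vcat_on[OF finite_lessThan BK_carriers(2) lift_carriers(4)]; assumption)+

lemma lift_uminus: "lift_rf (- X) = - lift_rf X"
proof -
  interpret comm_ring_hom const_rf by (rule comm_ring_hom_const_rf)
  show ?thesis by (intro eq_matI) (auto simp: hom_uminus)
qed

lemma lift_zero: "lift_rf (0\<^sub>m a b) = 0\<^sub>m a b"
proof -
  interpret comm_ring_hom const_rf by (rule comm_ring_hom_const_rf)
  show ?thesis by (intro eq_matI) auto
qed

lemma F_carrier: "F \<in> carrier_mat n2 n2"
  unfolding F_def using \<beta>\<gamma>_carriers by (intro minus_carrier_mat mult_carrier_mat)

text \<open>\<open>F\<close> is invertible because it specialises to \<open>D\<close> for zero gains.\<close>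

lemma det_F: "det F \<noteq> 0"
proof -
  have nB2: "- B2 i \<in> carrier_mat n2 (q i)" if "i \<in> {..<v}" for i using B2 that by simp
  have C2': "C2 i \<in> carrier_mat (r i) n2" if "i \<in> {..<v}" for i using C2 that by simp
  have "- B2 i * 0\<^sub>m (q i) (r i) * C2 i = 0\<^sub>m n2 n2" if "i \<in> {..<v}" for i
    using nB2[OF that] C2'[OF that] by simp
  then have "msum n2 n2 (\<lambda>i. - B2 i * 0\<^sub>m (q i) (r i) * C2 i) {..<v} = msum n2 n2 (\<lambda>i. 0\<^sub>m n2 n2) {..<v}"
    by (rule msum_cong)
  also have "D + \<dots> = D" using D by (intro eq_matI) (auto simp: msum_def)
  finally have "det (D + msum n2 n2 (\<lambda>i. - B2 i * 0\<^sub>m (q i) (r i) * C2 i) {..<v}) \<noteq> 0"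
    using det_D by simp
  from generic_det_nonzero[OF D nB2 C2' zero_carrier_mat this]
  have "det (lift_rf D + msum n2 n2 (\<lambda>i. lift_rf (- B2 i) * K i * lift_rf (C2 i)) {..<v}) \<noteq> 0" .
  also have "msum n2 n2 (\<lambda>i. lift_rf (- B2 i) * K i * lift_rf (C2 i)) {..<v} =
    msum n2 n2 (\<lambda>i. - (lift_rf (B2 i) * K i * lift_rf (C2 i))) {..<v}"
  proof (rule msum_cong)
    fix i assume i: "i \<in> {..<v}"
    note dims = carrier_matD[OF lift_carriers(2)[OF i]] carrier_matD[OF lift_carriers(4)[OF i]] carrier_matD[OF K_carrier]
    show "lift_rf (- B2 i) * K i * lift_rf (C2 i) = - (lift_rf (B2 i) * K i * lift_rf (C2 i))"
      by (simp only: lift_uminus mat_distribs dims index_mult_mat)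
  qed
  also have "\<dots> = - (\<beta>2 * \<gamma>2)"
    unfolding \<beta>\<gamma>_msum by (rule msum_uminus[OF mult_carrier_mat[OF BK_carriers(2) lift_carriers(4)]])
  also have "lift_rf D + - (\<beta>2 * \<gamma>2) = F"
    unfolding F_def using D \<beta>\<gamma>_carriers by (intro eq_matI) auto
  finally show ?thesis .
qed

lemma minv_F: "minv F \<in> carrier_mat n2 n2" "F * minv F = 1\<^sub>m n2" "minv F * F = 1\<^sub>m n2"
  using minv_inverse[OF F_carrier det_F] by auto

lemma minv_D: "minv D \<in> carrier_mat n2 n2" "D * minv D = 1\<^sub>m n2" "minv D * D = 1\<^sub>m n2"
  using minv_inverse[OF D det_D] by auto

lemma B_carrier: "i \<in> {..<v} \<Longrightarrow> B i \<in> carrier_mat (n2 + n1) (q i)"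
  unfolding B_def using B1 B2 by (intro carrier_append_rows) auto

lemma C_carrier: "i \<in> {..<v} \<Longrightarrow> C i \<in> carrier_mat (r i) (n2 + n1)"
  unfolding C_def using C1 C2 by (intro append_cols_carrier) auto

lemma M_carrier: "M \<in> carrier_mat (n2 + n1) (n2 + n1)"
  unfolding M_def using D by simp

abbreviation "X \<equiv> lift_rf M + msum (n2 + n1) (n2 + n1) (\<lambda>i. lift_rf (B i) * K i * lift_rf (C i)) {..<v}"

lemma X_four_block: "X = four_block_mat F (- (\<beta>2 * \<gamma>1)) (- (\<beta>1 * \<gamma>2)) (- (\<beta>1 * \<gamma>1))"
proof -
  have lz: "const_rf 0 = 0" using lift_zero[of 1 1] by (simp add: mat_eq_iff)
  have lB: "lift_rf (B i) = (- lift_rf (B2 i)) @\<^sub>r (- lift_rf (B1 i))" if "i < v" for i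
    unfolding B_def using map_mat_append_rows[of "- B2 i" n2 "q i" "- B1 i" n1 const_rf] B1[OF that] B2[OF that] lz
    by (simp add: lift_uminus)
  have lC: "lift_rf (C i) = append_cols (lift_rf (C2 i)) (lift_rf (C1 i))" if "i < v" for i
    unfolding C_def using map_mat_append_cols[of "C2 i" "r i" n2 "C1 i" n1 const_rf] C1[OF that] C2[OF that] lz
    by simp
  have neg: "msum a b (\<lambda>i. (- P i) * K i * Q i) {..<v} = - msum a b (\<lambda>i. P i * K i * Q i) {..<v}"
    if P: "\<And>i. i < v \<Longrightarrow> P i \<in> carrier_mat a (q i)" and Q: "\<And>i. i < v \<Longrightarrow> Q i \<in> carrier_mat (r i) b"
    for a b and P Q :: "nat \<Rightarrow> ratfun mat"
  proof -
    have "(- P i) * K i * Q i = - (P i * K i * Q i)" if "i \<in> {..<v}" for i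
    proof -
      have i: "i < v" using that by simp
      show ?thesis
        by (simp only: mat_distribs carrier_matD[OF P[OF i]] carrier_matD[OF Q[OF i]] carrier_matD[OF K_carrier] index_mult_mat)
    qed
    then have "msum a b (\<lambda>i. (- P i) * K i * Q i) {..<v} = msum a b (\<lambda>i. - (P i * K i * Q i)) {..<v}"
      by (rule msum_cong)
    also have "\<dots> = - msum a b (\<lambda>i. P i * K i * Q i) {..<v}"
      by (rule msum_uminus) (use P Q K_carrier in \<open>auto intro!: mult_carrier_mat\<close>)
    finally show ?thesis .
  qed
  have l: "lift_rf (B1 i) \<in> carrier_mat n1 (q i)" "lift_rf (B2 i) \<in> carrier_mat n2 (q i)"
    "lift_rf (C1 i) \<in> carrier_mat (r i) n1" "lift_rf (C2 i) \<in> carrier_mat (r i) n2" if "i < v" for i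
    using lift_carriers that by auto
  have "msum (n2 + n1) (n2 + n1) (\<lambda>i. lift_rf (B i) * K i * lift_rf (C i)) {..<v} =
    msum (n2 + n1) (n2 + n1) (\<lambda>i. ((- lift_rf (B2 i)) @\<^sub>r (- lift_rf (B1 i))) * K i *
      append_cols (lift_rf (C2 i)) (lift_rf (C1 i))) {..<v}"
    by (rule msum_cong) (simp only: lB lC lessThan_iff)
  also have "\<dots> = four_block_mat (msum n2 n2 (\<lambda>i. (- lift_rf (B2 i)) * K i * lift_rf (C2 i)) {..<v})
      (msum n2 n1 (\<lambda>i. (- lift_rf (B2 i)) * K i * lift_rf (C1 i)) {..<v})
      (msum n1 n2 (\<lambda>i. (- lift_rf (B1 i)) * K i * lift_rf (C2 i)) {..<v})
      (msum n1 n1 (\<lambda>i. (- lift_rf (B1 i)) * K i * lift_rf (C1 i)) {..<v})"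
    by (rule gain_sum_four_block) (use l K_carrier in auto)
  also have "\<dots> = four_block_mat (- (\<beta>2 * \<gamma>2)) (- (\<beta>2 * \<gamma>1)) (- (\<beta>1 * \<gamma>2)) (- (\<beta>1 * \<gamma>1))"
    unfolding \<beta>\<gamma>_msum by (simp only: neg l)
  moreover have "lift_rf M = four_block_mat (lift_rf D) (0\<^sub>m n2 n1) (0\<^sub>m n1 n2) (0\<^sub>m n1 n1)"
    unfolding M_def using D by (subst map_four_block_mat[of _ n2 n2 _ n1 _ n1]) (auto simp: lift_zero)
  ultimately have "X = four_block_mat (lift_rf D) (0\<^sub>m n2 n1) (0\<^sub>m n1 n2) (0\<^sub>m n1 n1) +
      four_block_mat (- (\<beta>2 * \<gamma>2)) (- (\<beta>2 * \<gamma>1)) (- (\<beta>1 * \<gamma>2)) (- (\<beta>1 * \<gamma>1))"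
    by simp
  also have "\<dots> = four_block_mat F (- (\<beta>2 * \<gamma>1)) (- (\<beta>1 * \<gamma>2)) (- (\<beta>1 * \<gamma>1))"
    unfolding F_def using D \<beta>\<gamma>_carriers
    by (intro eq_matI) (auto simp del: index_mult_mat(1))
  finally show ?thesis .
qed

text \<open>\<open>G\<close> is the Schur complement of \<open>F\<close> in the generic closed-loop
  matrix; the signs of the two outer factors cancel.\<close>

lemma mrank_X_iff: "n2 + n1 \<le> mrank X \<longleftrightarrow> n1 \<le> mrank G"
proof -
  note c = \<beta>\<gamma>_carriers
  have "n2 + n1 \<le> mrank X \<longleftrightarrow> n1 \<le> mrank (- (\<beta>1 * \<gamma>1) - (- (\<beta>1 * \<gamma>2)) * minv F * (- (\<beta>2 * \<gamma>1)))"
    unfolding X_four_block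
    by (rule mrank_four_block_schur[OF F_carrier _ _ _ minv_F]) (use c in auto)
  also have "(- (\<beta>1 * \<gamma>2)) * minv F * (- (\<beta>2 * \<gamma>1)) = \<beta>1 * \<gamma>2 * minv F * (\<beta>2 * \<gamma>1)"
    by (simp add: mat_distribs carrier_matD[OF minv_F(1)] carrier_matD[OF c(1)] carrier_matD[OF c(2)]
        carrier_matD[OF c(3)] carrier_matD[OF c(4)])
  finally show ?thesis by (simp only: G_def)
qed

text \<open>Push-through replaces the loop inverse by 1 + \<gamma>2 (minv F) \<beta>2. Expanding the
  product yields the two terms of \<open>G\<close>.\<close>

lemma transfer_eq_G:
  "lift_rf (0\<^sub>m n1 n1) + (- \<beta>1) * minv (1\<^sub>m d - \<gamma>2 * lift_rf (minv D) * \<beta>2) * \<gamma>1 = G"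
proof -
  interpret comm_ring_hom const_rf by (rule comm_ring_hom_const_rf)
  note c = \<beta>\<gamma>_carriers
  have "lift_rf (minv D) * lift_rf D = lift_rf (minv D * D)"
    by (rule mat_hom_mult[OF minv_D(1) D, symmetric])
  also have "\<dots> = 1\<^sub>m n2" unfolding minv_D by (rule mat_hom_one)
  finally have "lift_rf (minv D) * lift_rf D = 1\<^sub>m n2" .
  then have "minv (1\<^sub>m d - \<gamma>2 * lift_rf (minv D) * \<beta>2) = 1\<^sub>m d + \<gamma>2 * minv F * \<beta>2"
    using D minv_D minv_F c unfolding F_def[symmetric]
    by (intro push_through[of "lift_rf D" n2]) (auto simp flip: F_def)
  moreover have "- \<beta>1 * (1\<^sub>m d + \<gamma>2 * minv F * \<beta>2) * \<gamma>1 = - (\<beta>1 * \<gamma>1) - \<beta>1 * \<gamma>2 * minv F * (\<beta>2 * \<gamma>1)"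
    using c by (simp add: mat_distribs mat_assoc carrier_matD[OF minv_F(1)] carrier_matD[OF c(1)] carrier_matD[OF c(2)]
        carrier_matD[OF c(3)] carrier_matD[OF c(4)])
      (intro eq_matI, auto simp del: index_mult_mat(1) simp: carrier_matD[OF minv_F(1)])
  moreover have "- (\<beta>1 * \<gamma>1) - \<beta>1 * \<gamma>2 * minv F * (\<beta>2 * \<gamma>1) \<in> carrier_mat n1 n1"
    by (intro carrier_matI) (simp_all add: carrier_matD[OF c(1)] carrier_matD[OF c(3)])
  ultimately show ?thesis
    unfolding G_def lift_zero by (simp only: left_add_zero_mat)
qed

definition "P V = four_block_mat (0\<^sub>m n1 n1) (- hcat_on n1 B1 V) (vcat_on n1 C1 ({..<v} - V))
  (vcat_on n2 C2 ({..<v} - V) * minv D * hcat_on n2 B2 V)"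

text \<open>With \<open>D\<close> as pivot, its borders are (0, - b2) and (0, c2). The Schur
  complement leaves the other blocks alone and fills the zero corner with c2 (minv D) b2, positive
  since two signs cancel.\<close>

lemma cut_iff:
  assumes V: "V \<subseteq> {..<v}"
  shows "n2 + n1 \<le> mrank (cut_mat M B C {..<v} V) \<longleftrightarrow> n1 \<le> mrank (P V)"
proof -
  have finV: "finite V" using V finite_subset by blast
  define k where "k = (\<Sum>i\<in>V. q i)"
  define l where "l = (\<Sum>i\<in>{..<v} - V. r i)"
  define b1 where "b1 = hcat_on n1 B1 V"
  define b2 where "b2 = hcat_on n2 B2 V"
  define c1 where "c1 = vcat_on n1 C1 ({..<v} - V)"
  define c2 where "c2 = vcat_on n2 C2 ({..<v} - V)"
  have b1: "b1 \<in> carrier_mat n1 k" and b2: "b2 \<in> carrier_mat n2 k"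
    unfolding b1_def b2_def k_def by (rule hcat_on_carrier; use finV V B1 B2 in auto)+
  have c1: "c1 \<in> carrier_mat l n1" and c2: "c2 \<in> carrier_mat l n2"
    unfolding c1_def c2_def l_def by (rule vcat_on_carrier; use C1 C2 in auto)+
  have kl: "(\<Sum>i\<in>V. dim_col (B i)) = k" "(\<Sum>i\<in>{..<v} - V. dim_row (C i)) = l"
    unfolding k_def l_def using carrier_matD(2)[OF B_carrier] carrier_matD(1)[OF C_carrier] V
    by (auto intro!: sum.cong)
  have hB: "hcat_on (n2 + n1) B V = (- b2) @\<^sub>r (- b1)"
  proof -
    have "hcat_on (n2 + n1) B V = hcat_on n2 (\<lambda>i. - B2 i) V @\<^sub>r hcat_on n1 (\<lambda>i. - B1 i) V"
      unfolding B_def by (rule hcat_on_append_rows[OF finV, where q = q]) (use V B1 B2 in auto)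
    also have "hcat_on n2 (\<lambda>i. - B2 i) V = - b2"
      unfolding b2_def by (rule hcat_on_uminus[OF finV, where q = q]) (use V B2 in auto)
    also have "hcat_on n1 (\<lambda>i. - B1 i) V = - b1"
      unfolding b1_def by (rule hcat_on_uminus[OF finV, where q = q]) (use V B1 in auto)
    finally show ?thesis .
  qed
  have vC: "vcat_on (n2 + n1) C ({..<v} - V) = append_cols c2 c1"
    unfolding C_def c1_def c2_def by (rule vcat_on_append_cols[where r = r]) (use C1 C2 in auto)
  have "cut_mat M B C {..<v} V = four_block_mat M ((- b2) @\<^sub>r (- b1)) (append_cols c2 c1) (0\<^sub>m l k)"
    unfolding cut_mat_def carrier_matD[OF M_carrier] hB vC kl ..
  \<comment> \<open>The same matrix regrouped so that \<open>D\<close> alone is the upper left block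
    and the zero block of \<open>M\<close> joins the corner.\<close>
  also have "\<dots> = four_block_mat D (append_cols (0\<^sub>m n2 n1) (- b2)) (0\<^sub>m n1 n2 @\<^sub>r c2)
      (four_block_mat (0\<^sub>m n1 n1) (- b1) c1 (0\<^sub>m l k))"
    unfolding M_def append_rows_def append_cols_def using D b1 b2 c1 c2
    by (intro eq_matI) auto
  finally have "n2 + n1 \<le> mrank (cut_mat M B C {..<v} V) \<longleftrightarrow>
     n1 \<le> mrank (four_block_mat (0\<^sub>m n1 n1) (- b1) c1 (0\<^sub>m l k) - (0\<^sub>m n1 n2 @\<^sub>r c2) * minv D * append_cols (0\<^sub>m n2 n1) (- b2))"
    using mrank_four_block_schur[OF D _ _ _ minv_D, of "append_cols (0\<^sub>m n2 n1) (- b2)" "n1 + k" "0\<^sub>m n1 n2 @\<^sub>r c2" "n1 + l"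
        "four_block_mat (0\<^sub>m n1 n1) (- b1) c1 (0\<^sub>m l k)" n1] b1 b2 c1 c2
    by simp
  also have "(0\<^sub>m n1 n2 @\<^sub>r c2) * minv D * append_cols (0\<^sub>m n2 n1) (- b2) =
      four_block_mat (0\<^sub>m n1 n1) (0\<^sub>m n1 k) (0\<^sub>m l n1) (- (c2 * minv D * b2))"
  proof -
    have "(0\<^sub>m n1 n2 @\<^sub>r c2) * minv D = 0\<^sub>m n1 n2 @\<^sub>r (c2 * minv D)"
      using c2 minv_D(1) by (subst append_rows_mult[of _ n1 n2 _ l _ n2]) auto
    also have "\<dots> * append_cols (0\<^sub>m n2 n1) (- b2) =
      four_block_mat (0\<^sub>m n1 n2 * 0\<^sub>m n2 n1) (0\<^sub>m n1 n2 * - b2) (c2 * minv D * 0\<^sub>m n2 n1) (c2 * minv D * - b2)"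
      using mult_carrier_mat[OF c2 minv_D(1)] b2 by (intro append_rows_mult_append_cols[of _ n1 n2 _ l _ n1 _ k]) auto
    also have "c2 * minv D * - b2 = - (c2 * minv D * b2)"
      using b2 carrier_matD[OF minv_D(1)] by (simp only: mat_distribs carrier_matD[OF b2] index_mult_mat)
    finally show ?thesis
      unfolding right_mult_zero_mat[OF mult_carrier_mat[OF c2 minv_D(1)]] using b2 by simp
  qed
  also have "four_block_mat (0\<^sub>m n1 n1) (- b1) c1 (0\<^sub>m l k) -
      four_block_mat (0\<^sub>m n1 n1) (0\<^sub>m n1 k) (0\<^sub>m l n1) (- (c2 * minv D * b2)) = P V"
    unfolding P_def b1_def[symmetric] b2_def[symmetric] c1_def[symmetric] c2_def[symmetric]
    using b1 b2 c1 c2 by (intro eq_matI) (auto simp del: index_mult_mat(1))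
  finally show ?thesis .
qed

theorem characterisations:
  shows "(\<exists>K. (\<forall>i\<in>{..<v}. K i \<in> carrier_mat (q i) (r i)) \<and>
      det (M + msum (n2 + n1) (n2 + n1) (\<lambda>i. B i * K i * C i) {..<v}) \<noteq> 0) \<longleftrightarrow> n1 \<le> mrank G"
    and "n1 \<le> mrank G \<longleftrightarrow> (\<forall>V \<subseteq> {..<v}. n1 \<le> mrank (P V))"
proof -
  note * = generic_rank_iff_cuts[where I = "{..<v}" and M = M and B = B and C = C and q = q and r = r,
      OF finite_lessThan M_carrier B_carrier C_carrier]
  show "(\<exists>K. (\<forall>i\<in>{..<v}. K i \<in> carrier_mat (q i) (r i)) \<and>
      det (M + msum (n2 + n1) (n2 + n1) (\<lambda>i. B i * K i * C i) {..<v}) \<noteq> 0) \<longleftrightarrow> n1 \<le> mrank G"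
    using *(1) unfolding mrank_X_iff .
  show "n1 \<le> mrank G \<longleftrightarrow> (\<forall>V \<subseteq> {..<v}. n1 \<le> mrank (P V))"
    using *(2) unfolding mrank_X_iff by (simp add: cut_iff)
qed

end

section \<open>The network\<close>

text \<open>In a network cut the relay rows precede those of \<open>Rx\<close>, while the partition
  matrix has the opposite order.\<close>

lemma mrank_append_rows_swap_le:
  fixes X Y :: "'a::field mat"
  assumes X: "X \<in> carrier_mat a n" and Y: "Y \<in> carrier_mat b n"
  shows "mrank (X @\<^sub>r Y) \<le> mrank (Y @\<^sub>r X)"
proof -
  have "X @\<^sub>r Y = mat (a + b) n (\<lambda>(i, j). (Y @\<^sub>r X) $$ (if i < a then b + i else i - a, j))"
    using X Y unfolding append_rows_def by (intro eq_matI) auto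
  also have "mrank \<dots> \<le> mrank (Y @\<^sub>r X)"
    by (rule mrank_select_le[OF carrier_append_rows[OF Y X]]) auto
  finally show ?thesis .
qed

context partitioned_system
begin

lemma out_eq: "hcat_on n1 (\<lambda>i. lift_rf (- B1 i) * K i) {..<v} = - \<beta>1"
proof -
  have "hcat_on n1 (\<lambda>i. lift_rf (- B1 i) * K i) {..<v} = hcat_on n1 (\<lambda>i. - (lift_rf (B1 i) * K i)) {..<v}"
  proof (rule hcat_on_cong)
    fix i assume i: "i \<in> {..<v}"
    show "lift_rf (- B1 i) * K i = - (lift_rf (B1 i) * K i)"
      by (simp only: lift_uminus mat_distribs carrier_matD[OF lift_carriers(1)[OF i]] carrier_matD[OF K_carrier])
  qed simp
  also have "\<dots> = - \<beta>1"
    unfolding \<beta>1_def by (rule hcat_on_uminus[OF finite_lessThan BK_carriers(1)])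
  finally show ?thesis .
qed

text \<open>Each block is a product of a factor depending on the row, the fixed inverse of
  \<open>D\<close>, and a factor depending on the column, so stacking pulls the outer factors out as
  \<gamma>2 and \<beta>2.\<close>

lemma loop_eq:
  "vcat_on d (\<lambda>j. hcat_on (r j) (\<lambda>i. lift_rf (C2 j * minv D * B2 i) * K i) {..<v}) {..<v}
    = \<gamma>2 * lift_rf (minv D) * \<beta>2"
proof -
  interpret comm_ring_hom const_rf by (rule comm_ring_hom_const_rf)
  have lD: "lift_rf (minv D) \<in> carrier_mat n2 n2" using minv_D(1) by simp
  have row: "hcat_on (r j) (\<lambda>i. lift_rf (C2 j * minv D * B2 i) * K i) {..<v} =
      lift_rf (C2 j) * (lift_rf (minv D) * \<beta>2)" if j: "j \<in> {..<v}" for j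
  proof -
    have j': "j < v" using j by simp
    have CD: "lift_rf (C2 j) * lift_rf (minv D) \<in> carrier_mat (r j) n2"
      by (rule mult_carrier_mat[OF lift_carriers(4)[OF j] lD])
    have "hcat_on (r j) (\<lambda>i. lift_rf (C2 j * minv D * B2 i) * K i) {..<v} =
      hcat_on (r j) (\<lambda>i. (lift_rf (C2 j) * lift_rf (minv D)) * (lift_rf (B2 i) * K i)) {..<v}"
    proof (rule hcat_on_cong)
      fix i assume i: "i \<in> {..<v}"
      have i': "i < v" using i by simp
      have "lift_rf (C2 j * minv D * B2 i) = lift_rf (C2 j) * lift_rf (minv D) * lift_rf (B2 i)"
        by (simp only: mat_hom_mult[OF mult_carrier_mat[OF C2[OF j'] minv_D(1)] B2[OF i']]
            mat_hom_mult[OF C2[OF j'] minv_D(1)])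
      then show "lift_rf (C2 j * minv D * B2 i) * K i =
          (lift_rf (C2 j) * lift_rf (minv D)) * (lift_rf (B2 i) * K i)"
        using assoc_mult_mat[OF CD lift_carriers(2)[OF i] K_carrier] by simp
    qed simp
    also have "\<dots> = (lift_rf (C2 j) * lift_rf (minv D)) * \<beta>2"
      unfolding \<beta>2_def by (rule mult_hcat_on[OF finite_lessThan CD BK_carriers(2), symmetric])
    also have "\<dots> = lift_rf (C2 j) * (lift_rf (minv D) * \<beta>2)"
      by (rule assoc_mult_mat[OF lift_carriers(4)[OF j] lD \<beta>\<gamma>_carriers(2)])
    finally show ?thesis .
  qed
  have "vcat_on d (\<lambda>j. hcat_on (r j) (\<lambda>i. lift_rf (C2 j * minv D * B2 i) * K i) {..<v}) {..<v} =
    vcat_on d (\<lambda>j. lift_rf (C2 j) * (lift_rf (minv D) * \<beta>2)) {..<v}"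
    by (rule vcat_on_cong[OF finite_lessThan row])
  also have "\<dots> = \<gamma>2 * (lift_rf (minv D) * \<beta>2)"
    unfolding \<gamma>2_def
    by (rule vcat_on_mult[OF finite_lessThan mult_carrier_mat[OF lD \<beta>\<gamma>_carriers(2)] lift_carriers(4), symmetric])
  also have "\<dots> = \<gamma>2 * lift_rf (minv D) * \<beta>2"
    by (rule assoc_mult_mat[OF \<beta>\<gamma>_carriers(4) lD \<beta>\<gamma>_carriers(2), symmetric])
  finally show ?thesis .
qed

text \<open>\<open>Tx\<close> contributes the columns C1 and 0, the relays in V the remaining ones.
  Pulling the common factors out of the rows and columns leaves the block rows of \<open>P V\<close>
  in swapped order.\<close>

lemma mrank_network_cut:
  assumes V: "V \<subseteq> {..<v}"
  shows "mrank (vcat (n1 + (\<Sum>i\<in>V. q i))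
      (map (\<lambda>j. hcat (r j) (C1 j # map (\<lambda>i. C2 j * minv D * B2 i) (sorted_list_of_set V)))
        (sorted_list_of_set ({..<v} - V)) @
       [hcat n1 (0\<^sub>m n1 n1 # map (\<lambda>i. - B1 i) (sorted_list_of_set V))])) = mrank (P V)"
    (is "mrank ?N = _")
proof -
  have finV: "finite V" using V finite_subset by blast
  have finW: "finite ({..<v} - V)" by simp
  define k where "k = (\<Sum>i\<in>V. q i)"
  define l where "l = (\<Sum>i\<in>{..<v} - V. r i)"
  define b1 where "b1 = hcat_on n1 B1 V"
  define b2 where "b2 = hcat_on n2 B2 V"
  define c1 where "c1 = vcat_on n1 C1 ({..<v} - V)"
  define c2 where "c2 = vcat_on n2 C2 ({..<v} - V)"
  have inV: "i < v" if "i \<in> V" for i using that V by auto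
  have inW: "i < v" if "i \<in> {..<v} - V" for i using that by auto
  note B1' = B1[OF inV] and B2' = B2[OF inV] and C1' = C1[OF inW] and C2' = C2[OF inW]
  have b1: "b1 \<in> carrier_mat n1 k" unfolding b1_def k_def by (rule hcat_on_carrier[OF finV B1'])
  have b2: "b2 \<in> carrier_mat n2 k" unfolding b2_def k_def by (rule hcat_on_carrier[OF finV B2'])
  have c1: "c1 \<in> carrier_mat l n1" unfolding c1_def l_def by (rule vcat_on_carrier[OF finW C1'])
  have c2: "c2 \<in> carrier_mat l n2" unfolding c2_def l_def by (rule vcat_on_carrier[OF finW C2'])
  have Db: "minv D * b2 \<in> carrier_mat n2 k" by (rule mult_carrier_mat[OF minv_D(1) b2])
  have cons: "hcat nr (Y # map H (sorted_list_of_set V)) = append_cols Y (hcat_on nr H V)" for nr Y and H :: "nat \<Rightarrow> complex mat"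
    by (simp add: hcat_def hcat_on_def)
  have row: "hcat (r j) (C1 j # map (\<lambda>i. C2 j * minv D * B2 i) (sorted_list_of_set V)) =
     append_cols (C1 j) (C2 j * (minv D * b2))" if j: "j \<in> {..<v} - V" for j
  proof -
    have "hcat_on (r j) (\<lambda>i. C2 j * minv D * B2 i) V = C2 j * minv D * b2"
      unfolding b2_def by (rule mult_hcat_on[OF finV mult_carrier_mat[OF C2'[OF j] minv_D(1)] B2', symmetric])
    also have "\<dots> = C2 j * (minv D * b2)"
      by (rule assoc_mult_mat[OF C2'[OF j] minv_D(1) b2])
    finally show ?thesis unfolding cons by simp
  qed
  have last: "hcat n1 (0\<^sub>m n1 n1 # map (\<lambda>i. - B1 i) (sorted_list_of_set V)) = append_cols (0\<^sub>m n1 n1) (- b1)"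
  proof -
    have "hcat_on n1 (\<lambda>i. - B1 i) V = - b1"
      unfolding b1_def by (rule hcat_on_uminus[OF finV B1'])
    then show ?thesis unfolding cons by simp
  qed
  have lastc: "append_cols (0\<^sub>m n1 n1) (- b1) \<in> carrier_mat n1 (n1 + k)"
    using b1 by simp
  have rowc: "append_cols (C1 j) (C2 j * (minv D * b2)) \<in> carrier_mat (r j) (n1 + k)" if j: "j \<in> {..<v} - V" for j
    by (rule append_cols_carrier[OF C1'[OF j] mult_carrier_mat[OF C2'[OF j] Db]])
  have "map (\<lambda>j. hcat (r j) (C1 j # map (\<lambda>i. C2 j * minv D * B2 i) (sorted_list_of_set V)))
      (sorted_list_of_set ({..<v} - V)) = map (\<lambda>j. append_cols (C1 j) (C2 j * (minv D * b2))) (sorted_list_of_set ({..<v} - V))"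
    by (rule map_cong) (simp_all only: row set_sorted_list_of_set[OF finW])
  then have "?N = vcat (n1 + k) (map (\<lambda>j. append_cols (C1 j) (C2 j * (minv D * b2))) (sorted_list_of_set ({..<v} - V)) @
      [append_cols (0\<^sub>m n1 n1) (- b1)])"
    unfolding last k_def by (simp only:)
  also have "\<dots> = vcat_on (n1 + k) (\<lambda>j. append_cols (C1 j) (C2 j * (minv D * b2))) ({..<v} - V) @\<^sub>r
      append_cols (0\<^sub>m n1 n1) (- b1)"
    by (rule vcat_on_snoc[OF finW rowc lastc])
  also have "vcat_on (n1 + k) (\<lambda>j. append_cols (C1 j) (C2 j * (minv D * b2))) ({..<v} - V) =
      append_cols c1 (vcat_on k (\<lambda>j. C2 j * (minv D * b2)) ({..<v} - V))"
    unfolding c1_def by (rule vcat_on_append_cols[OF finW C1' mult_carrier_mat[OF C2' Db]])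
  also have "vcat_on k (\<lambda>j. C2 j * (minv D * b2)) ({..<v} - V) = c2 * (minv D * b2)"
    unfolding c2_def by (rule vcat_on_mult[OF finW Db C2', symmetric])
  finally have N: "?N = append_cols c1 (c2 * (minv D * b2)) @\<^sub>r append_cols (0\<^sub>m n1 n1) (- b1)" .
  have top: "append_cols c1 (c2 * (minv D * b2)) \<in> carrier_mat l (n1 + k)"
    by (rule append_cols_carrier[OF c1 mult_carrier_mat[OF c2 Db]])
  have "P V = append_cols (0\<^sub>m n1 n1) (- b1) @\<^sub>r append_cols c1 (c2 * (minv D * b2))"
    unfolding P_def b1_def[symmetric] b2_def[symmetric] c1_def[symmetric] c2_def[symmetric]
      assoc_mult_mat[OF c2 minv_D(1) b2] append_rows_def append_cols_def
    using b1 b2 c1 c2 by (intro eq_matI) (auto simp del: index_mult_mat(1))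
  with N show ?thesis
    using mrank_append_rows_swap_le[OF top lastc] mrank_append_rows_swap_le[OF lastc top] by simp
qed

end

section \<open>Instantiation for a Jordan matrix and its network\<close>

lemma sorted_list_of_set_lessThan: "sorted_list_of_set {..<v} = [0..<v]" for v :: nat
  by (simp add: lessThan_atLeast0)

lemma sum_list_upt_lessThan: "(\<Sum>i\<leftarrow>[0..<v]. f i) = (\<Sum>i<v. f i)" for v :: nat
  by (simp add: interv_sum_list_conv_sum_set_nat lessThan_atLeast0)

lemma filter_upt_sorted_list_of_set: "filter p [0..<v] = sorted_list_of_set {i. i < v \<and> p i}"
proof -
  have "sorted_list_of_set (set (filter p [0..<v])) = filter p [0..<v]"
    by (intro sorted_list_of_set.idem_if_sorted_distinct) (auto intro: sorted_wrt_filter)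
  moreover have "set (filter p [0..<v]) = {i. i < v \<and> p i}" by auto
  ultimately show ?thesis by simp
qed

lemma Min_less_iff_ex: "finite S \<Longrightarrow> S \<noteq> {} \<Longrightarrow> Min (f ` S) < n \<longleftrightarrow> (\<exists>s\<in>S. f s < n)"
  for f :: "'b \<Rightarrow> nat"
  by (subst Min_less_iff) auto

locale jordan_system =
  fixes ns :: "(nat \<times> complex) list" and B C :: "nat \<Rightarrow> complex mat" and v :: nat and \<mu> :: complex
  assumes sizes: "0 \<notin> fst ` set ns"
    and B: "\<And>i. i < v \<Longrightarrow> dim_row (B i) = jdim ns"
    and C: "\<And>i. i < v \<Longrightarrow> dim_col (C i) = jdim ns"
begin

definition "m = jdim ns"
definition "n1 = num_jblocks ns \<mu>"
definition "n2 = m - n1"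

lemmas blocks = jd_blocks[OF sizes n1_def n2_def[unfolded m_def], folded m_def]
lemmas L = last_idx_props[OF sizes, of \<mu>, folded m_def n1_def]
lemmas R = first_idx_props[OF sizes, of \<mu>, folded m_def n1_def]
lemmas cL = card_idx[OF L(1), unfolded L(2), folded n2_def]
lemmas cR = card_idx[OF R(1), unfolded R(2), folded n2_def]

lemma m_eq: "n2 + n1 = m"
  using blocks(1) by (simp add: n2_def)

lemma B_carrier: "i < v \<Longrightarrow> B i \<in> carrier_mat m (dim_col (B i))"
  using B by (intro carrier_matI) (auto simp: m_def)

lemma C_carrier: "i < v \<Longrightarrow> C i \<in> carrier_mat (dim_row (C i)) m"
  using C by (intro carrier_matI) (auto simp: m_def)

sublocale ps: partitioned_system v n1 n2 "\<lambda>i. dim_col (B i)" "\<lambda>i. dim_row (C i)" "jd_A22 ns \<mu> \<mu>"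
  "\<lambda>i. jd_B1 ns \<mu> (B i)" "\<lambda>i. jd_B2 ns \<mu> (B i)" "\<lambda>i. jd_C1 ns \<mu> (C i)" "\<lambda>i. jd_C2 ns \<mu> (C i)"
proof
  show "jd_A22 ns \<mu> \<mu> \<in> carrier_mat n2 n2" "det (jd_A22 ns \<mu> \<mu>) \<noteq> 0" using blocks by auto
  fix i assume i: "i < v"
  note d = carrier_matD(1)[OF B_carrier[OF i]] carrier_matD(2)[OF C_carrier[OF i]]
  show "jd_B1 ns \<mu> (B i) \<in> carrier_mat n1 (dim_col (B i))" "jd_B2 ns \<mu> (B i) \<in> carrier_mat n2 (dim_col (B i))"
    "jd_C1 ns \<mu> (C i) \<in> carrier_mat (dim_row (C i)) n1" "jd_C2 ns \<mu> (C i) \<in> carrier_mat (dim_row (C i)) n2"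
    unfolding jd_B1_def jd_B2_def jd_C1_def jd_C2_def
    by (intro carrier_matI; simp add: dim_submatrix d cL cR)+
qed

lemma G_jd_eq: "G_jd v ns B C \<mu> \<mu> = ps.G"
proof -
  have dim: "dim_row (jordan_matrix ns) - n1 = n2"
    by (simp add: n2_def m_def)
  note c = ps.\<beta>\<gamma>_carriers
  have neg: "0\<^sub>m a b - Y = - Y" if "Y \<in> carrier_mat a b" for a b and Y :: "ratfun mat"
    using that by (intro eq_matI) auto
  have pos: "- 0\<^sub>m a b + Y = Y" if "Y \<in> carrier_mat a b" for a b and Y :: "ratfun mat"
    using that by (intro eq_matI) auto
  have "G_jd v ns B C \<mu> \<mu> = (0\<^sub>m n1 n1 - ps.\<beta>1 * ps.\<gamma>1) + (0\<^sub>m n1 n2 - ps.\<beta>1 * ps.\<gamma>2) * minv ps.F *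
      (- 0\<^sub>m n2 n1 + ps.\<beta>2 * ps.\<gamma>1)"
    unfolding G_jd_def Let_def n1_def[symmetric] dim blocks ps.lift_zero ps.F_def ps.\<beta>\<gamma>_msum ..
  also have "\<dots> = - (ps.\<beta>1 * ps.\<gamma>1) + (- (ps.\<beta>1 * ps.\<gamma>2)) * minv ps.F * (ps.\<beta>2 * ps.\<gamma>1)"
    unfolding neg[OF mult_carrier_mat[OF c(1) c(3)]] neg[OF mult_carrier_mat[OF c(1) c(4)]]
      pos[OF mult_carrier_mat[OF c(2) c(3)]] ..
  also have "\<dots> = - (ps.\<beta>1 * ps.\<gamma>1) + - (ps.\<beta>1 * ps.\<gamma>2 * minv ps.F * (ps.\<beta>2 * ps.\<gamma>1))"
    by (simp only: mat_distribs index_mult_mat carrier_matD[OF c(1)] carrier_matD[OF c(2)]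
        carrier_matD[OF c(3)] carrier_matD[OF c(4)] carrier_matD[OF ps.minv_F(1)])
  also have "\<dots> = ps.G"
    unfolding ps.G_def by (intro eq_matI) (auto simp: carrier_matD[OF c(1)] carrier_matD[OF c(3)] simp del: index_mult_mat(1))
  finally show ?thesis .
qed

lemma partition_matrix_eq: "partition_matrix v ns B C \<mu> V = ps.P V"
  unfolding partition_matrix_def ps.P_def Let_def by (simp add: n1_def n2_def m_def)

abbreviation "N \<equiv> jd_network v ns B C \<mu>"

lemma network_simps:
  "nrelays N = v" "tdim N Tx = n1" "tdim N (Relay i) = dim_col (B i)" "tdim N Rx = 0"
  "rdim N Tx = 0" "rdim N (Relay i) = dim_row (C i)" "rdim N Rx = n1"
  "chan N Tx Rx = 0\<^sub>m n1 n1" "chan N Tx (Relay i) = jd_C1 ns \<mu> (C i)"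
  "chan N (Relay i) Rx = - jd_B1 ns \<mu> (B i)"
  "chan N (Relay i) (Relay j) = jd_C2 ns \<mu> (C j) * minv (jd_A22 ns \<mu> \<mu>) * jd_B2 ns \<mu> (B i)"
  by (simp_all add: jd_network_def Let_def n1_def)

lemma transfer_matrix_eq: "transfer_matrix N = ps.G"
proof -
  have h: "hcat nr (map H [0..<v]) = hcat_on nr H {..<v}" for nr and H :: "nat \<Rightarrow> ratfun mat"
    by (simp only: hcat_on_def sorted_list_of_set_lessThan)
  have w: "vcat nr (map H [0..<v]) = vcat_on nr H {..<v}" for nr and H :: "nat \<Rightarrow> ratfun mat"
    by (simp only: vcat_on_def sorted_list_of_set_lessThan)
  have "transfer_matrix N = lift_rf (0\<^sub>m n1 n1) + (- ps.\<beta>1) *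
      minv (1\<^sub>m ps.d - ps.\<gamma>2 * lift_rf (minv (jd_A22 ns \<mu> \<mu>)) * ps.\<beta>2) * ps.\<gamma>1"
    unfolding transfer_matrix_def Let_def relays_def relay_gain_def block_mat_def network_simps h w
      sum_list_upt_lessThan ps.out_eq ps.d_def[symmetric] ps.loop_eq ps.\<gamma>1_def[symmetric] ..
  also have "\<dots> = ps.G" by (rule ps.transfer_eq_G)
  finally show ?thesis .
qed

lemma mrank_cut_matrix:
  assumes W: "Tx \<in> W" "Rx \<notin> W"
  shows "mrank (cut_matrix N W) = mrank (ps.P {i. i < v \<and> Relay i \<in> W})"
proof -
  define V where "V = {i. i < v \<and> Relay i \<in> W}"
  have V: "V \<subseteq> {..<v}" by (auto simp: V_def)
  have V': "{..<v} - V = {i. i < v \<and> Relay i \<notin> W}" by (auto simp: V_def)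
  have sel: "filter (\<lambda>x. x \<in> W) (nodes N) = Tx # map Relay (sorted_list_of_set V)"
    using W unfolding nodes_def relays_def network_simps V_def filter_upt_sorted_list_of_set[symmetric]
    by (simp add: filter_map o_def)
  have unsel: "filter (\<lambda>x. x \<notin> W) (nodes N) = map Relay (sorted_list_of_set ({..<v} - V)) @ [Rx]"
    using W unfolding nodes_def relays_def network_simps V' filter_upt_sorted_list_of_set[symmetric]
    by (simp add: filter_map o_def)
  have sum: "(\<Sum>i\<leftarrow>sorted_list_of_set V. dim_col (B i)) = (\<Sum>i\<in>V. dim_col (B i))"
    using finite_subset[OF V] by (simp add: sum_list_distinct_conv_sum_set)
  have "cut_matrix N W = vcat (n1 + (\<Sum>i\<in>V. dim_col (B i)))
      (map (\<lambda>j. hcat (dim_row (C j)) (jd_C1 ns \<mu> (C j) # map (\<lambda>i. jd_C2 ns \<mu> (C j) * minv (jd_A22 ns \<mu> \<mu>) * jd_B2 ns \<mu> (B i))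
          (sorted_list_of_set V))) (sorted_list_of_set ({..<v} - V)) @
       [hcat n1 (0\<^sub>m n1 n1 # map (\<lambda>i. - jd_B1 ns \<mu> (B i)) (sorted_list_of_set V))])"
    unfolding cut_matrix_def block_mat_def sel unsel by (simp add: network_simps o_def sum)
  then show ?thesis
    using ps.mrank_network_cut[OF V] by (simp only: V_def[symmetric])
qed

text \<open>A cut always contains \<open>Tx\<close> and never \<open>Rx\<close>, so it is determined
  by its relays; cuts and subsets of the channels correspond to each other.\<close>

lemma mincut_less_iff:
  "mincut_rank N < n \<longleftrightarrow> (\<exists>V \<subseteq> {..<v}. mrank (ps.P V) < n)"
proof -
  let ?S = "{W. W \<subseteq> set (nodes N) \<and> Tx \<in> W \<and> Rx \<notin> W}"
  have nodes: "set (nodes N) = {Tx, Rx} \<union> Relay ` {..<v}"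
    by (auto simp: nodes_def relays_def network_simps)
  have "finite ?S" by (rule finite_subset[of _ "Pow (set (nodes N))"]) auto
  \<comment> \<open>The set of cuts must be non-empty for \<open>Min\<close> to be
    meaningful.\<close>
  moreover have "{Tx} \<in> ?S" by (simp add: nodes)
  ultimately have "mincut_rank N < n \<longleftrightarrow> (\<exists>W\<in>?S. mrank (cut_matrix N W) < n)"
    unfolding mincut_rank_def by (intro Min_less_iff_ex) auto
  also have "\<dots> \<longleftrightarrow> (\<exists>V \<subseteq> {..<v}. mrank (ps.P V) < n)"
  proof
    assume "\<exists>W\<in>?S. mrank (cut_matrix N W) < n"
    then obtain W where W: "W \<in> ?S" "mrank (cut_matrix N W) < n" by (rule bexE)
    have "mrank (ps.P {i. i < v \<and> Relay i \<in> W}) < n"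
      using W(2) mrank_cut_matrix[of W] W(1) by simp
    then show "\<exists>V \<subseteq> {..<v}. mrank (ps.P V) < n"
      by (intro exI[of _ "{i. i < v \<and> Relay i \<in> W}"] conjI) auto
  next
    assume "\<exists>V \<subseteq> {..<v}. mrank (ps.P V) < n"
    then obtain V where V: "V \<subseteq> {..<v}" "mrank (ps.P V) < n" by (elim exE conjE)
    define W where "W = insert Tx (Relay ` V)"
    have eq: "{i. i < v \<and> Relay i \<in> W} = V" using V(1) by (auto simp: W_def)
    have W: "Tx \<in> W" "Rx \<notin> W" by (auto simp: W_def)
    have "mrank (cut_matrix N W) < n"
      using V(2) unfolding mrank_cut_matrix[OF W] eq .
    moreover have "W \<in> ?S"
      unfolding nodes W_def using V(1) by blast
    ultimately show "\<exists>W\<in>?S. mrank (cut_matrix N W) < n" by (rule bexI)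
  qed
  finally show ?thesis .
qed

lemma partition_less_iff:
  "Min ((\<lambda>V. mrank (partition_matrix v ns B C \<mu> V)) ` Pow {..<v}) < n \<longleftrightarrow>
    (\<exists>V \<subseteq> {..<v}. mrank (ps.P V) < n)"
proof -
  have "Min ((\<lambda>V. mrank (ps.P V)) ` Pow {..<v}) < n \<longleftrightarrow> (\<exists>V \<in> Pow {..<v}. mrank (ps.P V) < n)"
    by (rule Min_less_iff_ex) auto
  then show ?thesis
    unfolding partition_matrix_eq Bex_def Pow_iff .
qed

lemma submatrix_uminus: "submatrix (- X) I UNIV = - submatrix X I UNIV" for X :: "complex mat"
  unfolding submatrix_def
  by (intro eq_matI) (auto simp: pick_UNIV pick_le)

lemma jd_B_uminus: "jd_B1 ns \<mu> (- Y) = - jd_B1 ns \<mu> Y" "jd_B2 ns \<mu> (- Y) = - jd_B2 ns \<mu> Y"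
  unfolding jd_B1_def jd_B2_def by (rule submatrix_uminus)+

text \<open>Rows and columns are permuted differently, so the determinant may change sign. Comparing
  ranks avoids tracking it.\<close>

lemma det_permuted_iff:
  assumes K: "\<And>i. i < v \<Longrightarrow> K i \<in> carrier_mat (dim_col (B i)) (dim_row (C i))"
  shows "det (pencil ns \<mu> + msum m m (\<lambda>i. - B i * K i * C i) {..<v}) \<noteq> 0 \<longleftrightarrow>
    det (ps.M + msum (n2 + n1) (n2 + n1) (\<lambda>i. ps.B i * K i * ps.C i) {..<v}) \<noteq> 0"
proof -
  let ?f = "perm_idx m (last_idx ns \<mu>)" and ?g = "perm_idx m (first_idx ns \<mu>)"
  let ?X = "pencil ns \<mu> + msum m m (\<lambda>i. - B i * K i * C i) {..<v}"
  have P: "pencil ns \<mu> \<in> carrier_mat m m" unfolding m_def by (rule pencil_carrier)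
  have X: "?X \<in> carrier_mat m m" using P by simp
  have nB: "- B i \<in> carrier_mat m (dim_col (B i))" if "i \<in> {..<v}" for i
    unfolding uminus_carrier_iff_mat by (rule B_carrier[OF that[unfolded lessThan_iff]])
  have C': "C i \<in> carrier_mat (dim_row (C i)) m" if "i \<in> {..<v}" for i
    by (rule C_carrier[OF that[unfolded lessThan_iff]])
  have K': "K i \<in> carrier_mat (dim_col (B i)) (dim_row (C i))" if "i \<in> {..<v}" for i
    by (rule K[OF that[unfolded lessThan_iff]])
  have "mat m m (\<lambda>(a, b). ?X $$ (?f a, ?g b)) = mat m m (\<lambda>(a, b). pencil ns \<mu> $$ (?f a, ?g b)) +
      msum m m (\<lambda>i. mat m (dim_col (B i)) (\<lambda>(a, b). (- B i) $$ (?f a, b)) * K i *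
        mat (dim_row (C i)) m (\<lambda>(a, b). C i $$ (a, ?g b))) {..<v}"
    by (rule select_gain_sum[OF P nB C' K' perm_idx_less[OF L(1)] perm_idx_less[OF R(1)]])
  also have "mat m m (\<lambda>(a, b). pencil ns \<mu> $$ (?f a, ?g b)) = ps.M"
    using blocks(7) by (simp only: ps.M_def)
  also have "msum m m (\<lambda>i. mat m (dim_col (B i)) (\<lambda>(a, b). (- B i) $$ (?f a, b)) * K i *
        mat (dim_row (C i)) m (\<lambda>(a, b). C i $$ (a, ?g b))) {..<v} =
      msum m m (\<lambda>i. ps.B i * K i * ps.C i) {..<v}"
  proof (rule msum_cong)
    fix i assume i: "i \<in> {..<v}"
    have "mat m (dim_col (B i)) (\<lambda>(a, b). (- B i) $$ (?f a, b)) = ps.B i"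
      unfolding permuted_append_rows[OF nB[OF i] L(1)] jd_B1_def[symmetric] jd_B2_def[symmetric] jd_B_uminus ps.B_def ..
    moreover have "mat (dim_row (C i)) m (\<lambda>(a, b). C i $$ (a, ?g b)) = ps.C i"
      unfolding permuted_append_cols[OF C'[OF i] R(1)] jd_C1_def[symmetric] jd_C2_def[symmetric] ps.C_def ..
    ultimately show "mat m (dim_col (B i)) (\<lambda>(a, b). (- B i) $$ (?f a, b)) * K i *
        mat (dim_row (C i)) m (\<lambda>(a, b). C i $$ (a, ?g b)) = ps.B i * K i * ps.C i"
      by (simp only:)
  qed
  finally have eq: "mat m m (\<lambda>(a, b). ?X $$ (?f a, ?g b)) =
    ps.M + msum m m (\<lambda>i. ps.B i * K i * ps.C i) {..<v}" .
  have r: "mrank (ps.M + msum m m (\<lambda>i. ps.B i * K i * ps.C i) {..<v}) = mrank ?X"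
    unfolding eq[symmetric] by (rule mrank_permute[OF X perm_idx_bij[OF L(1)] perm_idx_bij[OF R(1)]])
  have Y: "ps.M + msum m m (\<lambda>i. ps.B i * K i * ps.C i) {..<v} \<in> carrier_mat m m"
    by (intro add_carrier_mat msum_carrier)
  show ?thesis
    unfolding m_eq mrank_full_iff_det[OF X, symmetric] mrank_full_iff_det[OF Y, symmetric] r ..
qed

text \<open>\<open>char_matrix\<close> has the opposite sign to the pencil, which does not affect
  the vanishing of the determinant.\<close>

lemma not_fixed_mode_iff:
  "\<not> fixed_mode v (jordan_matrix ns) B C \<mu> \<longleftrightarrow>
    (\<exists>K. (\<forall>i\<in>{..<v}. K i \<in> carrier_mat (dim_col (B i)) (dim_row (C i))) \<and>
      det (pencil ns \<mu> + msum m m (\<lambda>i. - B i * K i * C i) {..<v}) \<noteq> 0)"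
proof -
  have spec: "\<mu> \<in> spectrum (jordan_matrix ns + msum m m (\<lambda>i. B i * K i * C i) {..<v}) \<longleftrightarrow>
    det (pencil ns \<mu> + msum m m (\<lambda>i. - B i * K i * C i) {..<v}) = 0"
    if K: "\<forall>i\<in>{..<v}. K i \<in> carrier_mat (dim_col (B i)) (dim_row (C i))" for K
  proof -
    let ?Y = "jordan_matrix ns + msum m m (\<lambda>i. B i * K i * C i) {..<v}"
    have J: "jordan_matrix ns \<in> carrier_mat m m" unfolding m_def by simp
    have Y: "?Y \<in> carrier_mat m m" using J by simp
    have c: "B i * K i * C i \<in> carrier_mat m m" if "i \<in> {..<v}" for i
      by (rule mult_carrier_mat[OF mult_carrier_mat[OF B_carrier bspec[OF K that]] C_carrier]; rule that[unfolded lessThan_iff])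
    have "msum m m (\<lambda>i. - B i * K i * C i) {..<v} = msum m m (\<lambda>i. - (B i * K i * C i)) {..<v}"
    proof (rule msum_cong)
      fix i assume i: "i \<in> {..<v}"
      note d = carrier_matD[OF bspec[OF K i]]
      show "- B i * K i * C i = - (B i * K i * C i)"
        by (simp only: mat_distribs d index_mult_mat)
    qed
    also have "\<dots> = - msum m m (\<lambda>i. B i * K i * C i) {..<v}"
      by (rule msum_uminus[OF c])
    finally have neg: "msum m m (\<lambda>i. - B i * K i * C i) {..<v} = - msum m m (\<lambda>i. B i * K i * C i) {..<v}" .
    have cm: "char_matrix ?Y \<mu> \<in> carrier_mat m m" using Y by simp
    have "pencil ns \<mu> + msum m m (\<lambda>i. - B i * K i * C i) {..<v} = - char_matrix ?Y \<mu>"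
      unfolding neg pencil_def char_matrix_def using J
      by (intro eq_matI) (auto simp: msum_def)
    then show ?thesis
      unfolding spectrum_def using eigenvalue_det[OF Y] det_0_negate[OF cm] by simp
  qed
  show ?thesis
    unfolding fixed_mode_def using spec by (auto simp: m_def)
qed

theorem fixed_mode_characterisations:
  "(fixed_mode v (jordan_matrix ns) B C \<mu> \<longleftrightarrow> mrank (G_jd v ns B C \<mu> \<mu>) < n1)
    \<and> (mrank (G_jd v ns B C \<mu> \<mu>) < n1 \<longleftrightarrow> mrank (transfer_matrix N) < n1)
    \<and> (mrank (transfer_matrix N) < n1 \<longleftrightarrow> mincut_rank N < n1)
    \<and> (mincut_rank N < n1
         \<longleftrightarrow> Min ((\<lambda>V. mrank (partition_matrix v ns B C \<mu> V)) ` Pow {..<v}) < n1)"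
proof -
  have "\<not> fixed_mode v (jordan_matrix ns) B C \<mu> \<longleftrightarrow>
    (\<exists>K. (\<forall>i\<in>{..<v}. K i \<in> carrier_mat (dim_col (B i)) (dim_row (C i))) \<and>
      det (ps.M + msum (n2 + n1) (n2 + n1) (\<lambda>i. ps.B i * K i * ps.C i) {..<v}) \<noteq> 0)"
    unfolding not_fixed_mode_iff using det_permuted_iff by (intro ex_cong1 conj_cong refl) auto
  then have 1: "fixed_mode v (jordan_matrix ns) B C \<mu> \<longleftrightarrow> mrank ps.G < n1"
    unfolding ps.characterisations(1) by linarith
  have "mrank ps.G < n1 \<longleftrightarrow> \<not> (\<forall>V \<subseteq> {..<v}. n1 \<le> mrank (ps.P V))"
    unfolding ps.characterisations(2)[symmetric] by linarith
  then have 2: "mrank ps.G < n1 \<longleftrightarrow> (\<exists>V \<subseteq> {..<v}. mrank (ps.P V) < n1)"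
    by (auto simp: not_le)
  show ?thesis
    unfolding G_jd_eq transfer_matrix_eq mincut_less_iff partition_less_iff 1 2 by simp
qed

end

theorem theorem8:
  fixes A :: "complex mat" and ns :: "(nat \<times> complex) list"
    and B C :: "nat \<Rightarrow> complex mat" and q r :: "nat \<Rightarrow> nat"
    and m v :: nat and \<mu> :: complex
  assumes "A \<in> carrier_mat m m"
    and "A = jordan_matrix ns" and "0 \<notin> fst ` set ns"
    and "\<And>i. i < v \<Longrightarrow> B i \<in> carrier_mat m (q i)"
    and "\<And>i. i < v \<Longrightarrow> C i \<in> carrier_mat (r i) m"
    and "eigenvalue A \<mu>"
  shows "(fixed_mode v A B C \<mu> \<longleftrightarrow> mrank (G_jd v ns B C \<mu> \<mu>) < num_jblocks ns \<mu>)
    \<and> (mrank (G_jd v ns B C \<mu> \<mu>) < num_jblocks ns \<mu>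
         \<longleftrightarrow> mrank (transfer_matrix (jd_network v ns B C \<mu>)) < num_jblocks ns \<mu>)
    \<and> (mrank (transfer_matrix (jd_network v ns B C \<mu>)) < num_jblocks ns \<mu>
         \<longleftrightarrow> mincut_rank (jd_network v ns B C \<mu>) < num_jblocks ns \<mu>)
    \<and> (mincut_rank (jd_network v ns B C \<mu>) < num_jblocks ns \<mu>
         \<longleftrightarrow> Min ((\<lambda>V. mrank (partition_matrix v ns B C \<mu> V)) ` Pow {..<v}) < num_jblocks ns \<mu>)"
proof -
  have m: "m = jdim ns" using assms(1,2) by (metis carrier_matD(1) jordan_matrix_dim(1))
  interpret jordan_system ns B C v \<mu>
    by unfold_locales (use assms(3-5) m in auto)
  show ?thesis
    using fixed_mode_characterisations unfolding n1_def assms(2) .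
qed

end
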